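(* Let $K$ be an imaginary quadratic field with discriminant $\Delta$ and ring of integers $\mathcal{O}$, let $\Gamma=\mathrm{PSL}_2(\mathcal{O})$, let $\delta\in\mathcal{O}$ have maximal magnitude among proper divisors of $\Delta$ in $\mathcal{O}$, and let $J\in\mathbb{Z}$ be such that $\mathcal{J}\big(2\max(|\delta|,J\sqrt{|\Delta|})\big)\leq J$. Then $\mathcal{S}(\Gamma)<14J\max(|\delta|,J\sqrt{|\Delta|})$.
   Context: Hyperbolic 3-space is $\mathbb{H}=\{(\zeta,t):\zeta\in\mathbb{C},t>0\}$, with coordinates $\zeta(P),t(P)$; $\Gamma$ acts in the standard way, with $t(gP)=t(P)/(|\mu\zeta(P)-\lambda|^2+|\mu|^2t(P)^2)$ for $g=\begin{bmatrix}\beta&-\alpha\\-\mu&\lambda\end{bmatrix}$. For a fundamental parallelogram $F$ of the lattice $\mathcal{O}\subset\mathbb{C}$, the Bianchi polyhedron is $\mathcal{B}=\{P\in\mathbb{H}:\zeta(P)\in\overline{F},\ t(P)\geq t(gP)\ \forall g\in\Gamma\}$. For coprime $\lambda,\mu\in\mathcal{O}$ (i.e. $(\lambda,\mu)=\mathcal{O}$), $\mu\ne0$, $S_{\lambda/\mu}$ is the open Euclidean hemisphere in $\mathbb{H}$ centered at $(\lambda/\mu,0)$ of radius $1/|\mu|$. Swan's number $\mathcal{S}(\Gamma)$ is the maximum $|\mu|$ such that $S_{\lambda/\mu}\cap\mathcal{B}$ contains an open subset of $S_{\lambda/\mu}$ for some $\lambda$ coprime to $\mu$. For a nonzero ideal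 $\mathfrak{a}\subseteq\mathcal{O}$, $\mathcal{j}(\mathfrak{a})$ is the minimal real number such that for every $\alpha\in\mathcal{O}$ (subject, when $2\mid\mathfrak{a}$, to the requirement that $(2,\alpha)$ is not a prime ideal lying above a split prime $2$), every closed interval of length $\mathcal{j}(\mathfrak{a})$ contains some $j\in\mathbb{Z}$ with $(\mathfrak{a},\alpha+j)=\mathcal{O}$. For $x>0$, $\mathcal{J}(x)$ is the maximum of $\mathcal{j}(\mathfrak{a})$ over ideals $\mathfrak{a}\subseteq\mathcal{O}$ with no principal prime ideal divisors and $\sqrt{\|\mathfrak{a}\|}<x$, where $\|\cdot\|$ is the ideal norm. *)

theory Defs
  imports
    "HOL-Analysis.Analysis"
    "HOL-Algebra.Ideal_Product"
    "HOL-Algebra.QuotRing"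
    "HOL-Algebra.Divisibility"
    "HOL-Algebra.Embedded_Algebras"
begin

section \<open>Imaginary quadratic fields\<close>

definition complex_ring :: "complex ring" where
  "complex_ring = \<lparr>carrier = UNIV, mult = (*), one = 1, zero = 0, add = (+)\<rparr>"

lemma ring_complex_ring: "ring complex_ring"
proof -
  have "\<exists>y. y + x = 0 \<and> x + y = 0" for x :: complex
    by (rule exI[of _ "-x"]) simp
  then show ?thesis
    by unfold_locales (auto simp: complex_ring_def algebra_simps Units_def)
qed

definition imaginary_quadratic_field :: "complex set \<Rightarrow> bool" where
  "imaginary_quadratic_field K \<longleftrightarrow>
     subfield K complex_ring \<and> ring.dimension complex_ring 2 \<rat> K \<and> \<not> K \<subseteq> \<real>"

definition ring_of_integers :: "complex set \<Rightarrow> complex ring" where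
  "ring_of_integers K = complex_ring\<lparr>carrier := {x \<in> K. algebraic_int x}\<rparr>"

definition lattice_basis :: "complex set \<Rightarrow> complex \<Rightarrow> complex \<Rightarrow> bool" where
  "lattice_basis L \<omega>\<^sub>1 \<omega>\<^sub>2 \<longleftrightarrow>
     (\<forall>s t :: real. of_real s * \<omega>\<^sub>1 + of_real t * \<omega>\<^sub>2 = 0 \<longrightarrow> s = 0 \<and> t = 0) \<and>
     L = {of_int m * \<omega>\<^sub>1 + of_int n * \<omega>\<^sub>2 | m n. True}"

text \<open>The two embeddings of an imaginary quadratic field are the inclusion and complex
  conjugation, so this is the squared determinant of the embeddings of an integral basis;
  the value does not depend on the basis.\<close>

definition field_discriminant :: "complex set \<Rightarrow> int" where
  "field_discriminant K = (THE D. \<exists>\<omega>\<^sub>1 \<omega>\<^sub>2.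
     lattice_basis (carrier (ring_of_integers K)) \<omega>\<^sub>1 \<omega>\<^sub>2 \<and>
     of_int D = (\<omega>\<^sub>1 * cnj \<omega>\<^sub>2 - \<omega>\<^sub>2 * cnj \<omega>\<^sub>1)\<^sup>2)"


section \<open>Hyperbolic space and Swan's number\<close>

definition hyperbolic_space :: "(complex \<times> real) set" where
  "hyperbolic_space = {(z, t). t > 0}"

definition SL2 :: "complex ring \<Rightarrow> (complex^2^2) monoid" where
  "SL2 R = \<lparr>carrier = {A. (\<forall>i j. A $ i $ j \<in> carrier R) \<and> det A = 1},
            mult = (**), one = mat 1\<rparr>"

definition PSL2 :: "complex ring \<Rightarrow> (complex^2^2) set monoid" where
  "PSL2 R = SL2 R Mod {mat 1, - mat 1}"

definition SL2_act :: "complex^2^2 \<Rightarrow> complex \<times> real \<Rightarrow> complex \<times> real" where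
  "SL2_act A P =
     (let z = fst P; t = snd P; a = A $ 1 $ 1; b = A $ 1 $ 2; c = A $ 2 $ 1; d = A $ 2 $ 2;
          N = (cmod (c * z + d))\<^sup>2 + (cmod c)\<^sup>2 * t\<^sup>2
      in (((a * z + b) * cnj (c * z + d) + a * cnj c * of_real (t\<^sup>2)) / of_real N, t / N))"

text \<open>An element of \<^const>\<open>PSL2\<close> is a coset \<open>{A, -A}\<close>, whose two members act alike.\<close>

definition PSL2_act :: "(complex^2^2) set \<Rightarrow> complex \<times> real \<Rightarrow> complex \<times> real" where
  "PSL2_act g P = the_elem ((\<lambda>A. SL2_act A P) ` g)"

lemma SL2_act_uminus: "SL2_act (- A) P = SL2_act A P"
proof -
  have 1: "cmod (- (c * z) - d) = cmod (c * z + d)" for c z d :: complex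
    by (metis add_uminus_conv_diff minus_add_distrib norm_minus_cancel)
  have 2: "(- (a * z) - b) * (- (cnj c * cnj z) - cnj d) = (a * z + b) * (cnj c * cnj z + cnj d)"
    for a b c d z :: complex
    by (simp add: algebra_simps)
  show ?thesis
    by (simp add: SL2_act_def Let_def 1 2)
qed

lemma matrix_mul_uminus_mat_1: "(- mat 1) ** (A :: complex^2^2) = - A"
  by (simp add: matrix_matrix_mult_def mat_def vec_eq_iff sum_2 forall_2)

lemma PSL2_act_eq:
  assumes "g \<in> carrier (PSL2 R)" "A \<in> g"
  shows "PSL2_act g P = SL2_act A P"
proof -
  from assms(1) obtain B where "g = {B, - B}"
    by (auto simp: PSL2_def FactGroup_def RCOSETS_def r_coset_def SL2_def matrix_mul_uminus_mat_1)
  then have "(\<lambda>A. SL2_act A P) ` g = {SL2_act A P}"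
    using assms(2) by (auto simp: SL2_act_uminus)
  then show ?thesis
    by (simp add: PSL2_act_def)
qed

definition fundamental_parallelogram :: "complex set \<Rightarrow> complex set \<Rightarrow> bool" where
  "fundamental_parallelogram L F \<longleftrightarrow> (\<exists>c \<omega>\<^sub>1 \<omega>\<^sub>2. lattice_basis L \<omega>\<^sub>1 \<omega>\<^sub>2 \<and>
     F = {c + of_real s * \<omega>\<^sub>1 + of_real t * \<omega>\<^sub>2 | s t :: real. 0 \<le> s \<and> s < 1 \<and> 0 \<le> t \<and> t < 1})"

definition bianchi_polyhedron :: "complex ring \<Rightarrow> complex set \<Rightarrow> (complex \<times> real) set" where
  "bianchi_polyhedron R F = {P \<in> hyperbolic_space.
     fst P \<in> closure F \<and> (\<forall>g \<in> carrier (PSL2 R). snd P \<ge> snd (PSL2_act g P))}"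

text \<open>The product metric on \<open>complex \<times> real\<close> is the Euclidean one.\<close>

definition hemisphere :: "complex \<Rightarrow> complex \<Rightarrow> (complex \<times> real) set" where
  "hemisphere lam mu = sphere (lam / mu, 0) (1 / cmod mu) \<inter> hyperbolic_space"

definition swan_number :: "complex ring \<Rightarrow> complex set \<Rightarrow> real" where
  "swan_number R F = Max {cmod mu | mu. mu \<in> carrier R \<and> mu \<noteq> 0 \<and>
     (\<exists>lam \<in> carrier R. Idl\<^bsub>R\<^esub> {lam, mu} = carrier R \<and>
        (\<exists>U. U \<noteq> {} \<and> openin (top_of_set (hemisphere lam mu)) U \<and>
             U \<subseteq> hemisphere lam mu \<inter> bianchi_polyhedron R F))}"


section \<open>The function \<open>j\<close> on ideals and its maxima\<close>

definition ideal_divides :: "('a, 'b) ring_scheme \<Rightarrow> 'a set \<Rightarrow> 'a set \<Rightarrow> bool" where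
  "ideal_divides R I J \<longleftrightarrow> (\<exists>C. ideal C R \<and> J = I \<cdot>\<^bsub>R\<^esub> C)"

definition ideal_norm :: "('a, 'b) ring_scheme \<Rightarrow> 'a set \<Rightarrow> nat" where
  "ideal_norm R I = card (carrier (R Quot I))"

definition splits_in :: "int \<Rightarrow> complex ring \<Rightarrow> bool" where
  "splits_in p R \<longleftrightarrow> (\<exists>P Q. primeideal P R \<and> primeideal Q R \<and> P \<noteq> Q \<and>
     PIdl\<^bsub>R\<^esub> (of_int p) = P \<cdot>\<^bsub>R\<^esub> Q)"

text \<open>A prime ideal of the form \<open>(2, \<alpha>)\<close> contains 2, hence automatically lies above 2.\<close>

definition admissible_shift :: "complex ring \<Rightarrow> complex set \<Rightarrow> complex \<Rightarrow> bool" where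
  "admissible_shift R I \<alpha> \<longleftrightarrow>
     (ideal_divides R (PIdl\<^bsub>R\<^esub> 2) I \<longrightarrow> \<not> (primeideal (Idl\<^bsub>R\<^esub> {2, \<alpha>}) R \<and> splits_in 2 R))"

text \<open>Negative lengths \<open>L\<close> give empty intervals, so they are excluded by \<open>\<alpha> = 0\<close>, which is
  always admissible: \<open>(2)\<close> is not prime when 2 splits.\<close>

definition ideal_j :: "complex ring \<Rightarrow> complex set \<Rightarrow> real" where
  "ideal_j R I = (LEAST L. \<forall>\<alpha> \<in> carrier R. admissible_shift R I \<alpha> \<longrightarrow>
     (\<forall>x. \<exists>j :: int. of_int j \<in> {x..x + L} \<and> Idl\<^bsub>R\<^esub> (insert (\<alpha> + of_int j) I) = carrier R))"

definition max_ideal_j :: "complex ring \<Rightarrow> real \<Rightarrow> real" where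
  "max_ideal_j R x = Max {ideal_j R I | I. ideal I R \<and> I \<noteq> {\<zero>\<^bsub>R\<^esub>} \<and>
     \<not> (\<exists>P. primeideal P R \<and> principalideal P R \<and> ideal_divides R P I) \<and>
     sqrt (real (ideal_norm R I)) < x}"

end

theory Submission
  imports Defs "HOL-Number_Theory.Cong"
begin

text \<open>
  Let \<open>P = (z, t)\<close> lie in the polyhedron and on \<open>S\<^bsub>\<lambda>/\<mu>\<^esub>\<close>, put \<open>M = max(|\<delta>|, J \<surd>|\<Delta>|)\<close>, and suppose
  \<open>|\<mu>| \<ge> 14 J M\<close>, so that \<open>t \<le> 1/|\<mu>|\<close>. Consider the Hermitian form
  \<open>f(a, b) = |b z - a|\<^sup>2 + |b|\<^sup>2 t\<^sup>2\<close>. Membership in the polyhedron says that \<open>f \<ge> 1\<close> on unimodular pairs,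
  while \<open>f(1, 0) = f(\<lambda>, \<mu>) = 1\<close>.

  Let \<open>v\<close> be a minimal vector of \<open>f\<close> and \<open>b\<close> the ideal generated by its entries. The lattice \<open>O\<^sup>2\<close> is
  \<open>b w + b\<^sup>-\<^sup>1 v\<close> for some \<open>w\<close> with \<open>det (v, w) = 1\<close>, and \<open>b\<^sup>-\<^sup>1 = \<int> + \<int> \<tau>\<close> with \<open>\<tau>\<close> reduced. In a row
  \<open>D w + (r \<tau> + j) v\<close>, \<open>j \<in> \<int>\<close>, the hypothesis on \<open>J\<close> provides in every interval of length \<open>J\<close> a
  \<open>j\<close> for which no nonprincipal prime divides both entries, provided \<open>r\<close> avoids certain primes dividing
  both \<open>N = ||b||\<close> and \<open>D\<close>; dividing out a principal common factor only decreases \<open>f\<close>. Each such row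
  therefore yields a lower bound for \<open>f\<close>.

  If \<open>b\<close> is prime to its conjugate take \<open>D = m N\<close>, otherwise \<open>D = m N' \<omega>\<close> with \<open>N' = N / g\<close>, where
  the primes dividing \<open>g\<close> are ramified; this is where \<open>\<delta>\<close> enters, as \<open>|\<Delta>| / q \<le> |\<delta>|\<close> for every prime
  \<open>q\<close> dividing \<open>\<Delta>\<close>. Dirichlet approximation of \<open>(m, r)\<close> contradicts the lower bound unless \<open>P\<close> lies very deep
  in the cusp of \<open>v\<close>. In that case the row \<open>D = N\<close> bounds the coordinates of both \<open>(1, 0)\<close> and
  \<open>(\<lambda>, \<mu>)\<close> with respect to \<open>v, w\<close>, hence also their determinant \<open>\<mu>\<close>.
\<close>

text \<open>The polyhedron controls only unimodular pairs, while rows over a nonprincipal cusp may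
  have common primes, and these contain D b^-1. For D = N this ideal is the conjugate of b, which
  shares with b only primes dividing g; to handle those, r must avoid every prime dividing g, which
  Dirichlet approximation cannot promise. With D = N' \<omega> the ideal D b^-1 is prime to b, so
  coprimality of (m, r) suffices. The price is that |D| Im \<tau> is only bounded in terms of
  |\<Delta>| / g instead of sqrt |\<Delta>|; hence M has to dominate |\<Delta>| / q for the primes q
  dividing g. The exception at a split 2 is met by doubling (m, r) when m is even and N is odd.
  Origin of 14: a minimal vector has f(v) at most 9/4 sqrt |\<Delta>| t, so a window of length J
  costs at most 9/16 J M t. A Dirichlet row at the balance point costs at most (8 + 2) M t, the
  doubling included. Together 1 <= 169/16 J M t, which fails if 14 J M t <= 1. The deep case gives
  |\<mu>| <= 4 J M, well below 14 J M.\<close>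

hide_const (open) Divisibility.prime Module.smult UnivPoly.up_ring.coeff

section \<open>Imaginary quadratic orders and their ideals\<close>

text \<open>Conjugation is the nontrivial automorphism of the field, so \<open>x + cnj x\<close> and
  \<open>x * cnj x\<close> are trace and norm. \<open>R_maximal\<close> is integral closedness: a
  quotient with integral trace and norm is a root of a monic integral quadratic.\<close>

locale imag_quad_order =
  fixes R :: "complex set"
  assumes R_1: "1 \<in> R"
    and R_add: "x \<in> R \<Longrightarrow> y \<in> R \<Longrightarrow> x + y \<in> R"
    and R_uminus: "x \<in> R \<Longrightarrow> - x \<in> R"
    and R_mult: "x \<in> R \<Longrightarrow> y \<in> R \<Longrightarrow> x * y \<in> R"
    and R_nonreal: "\<exists>x\<in>R. Im x \<noteq> 0"
    and R_trace: "x \<in> R \<Longrightarrow> x + cnj x \<in> \<int>"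
    and R_norm: "x \<in> R \<Longrightarrow> x * cnj x \<in> \<int>"
    and R_maximal: "a \<in> R \<Longrightarrow> b \<in> R \<Longrightarrow> b \<noteq> 0 \<Longrightarrow> a / b + cnj (a / b) \<in> \<int> \<Longrightarrow>
        (a / b) * cnj (a / b) \<in> \<int> \<Longrightarrow> a / b \<in> R"
begin

definition ideal_of :: "complex set \<Rightarrow> bool" where
  "ideal_of I \<longleftrightarrow> 0 \<in> I \<and> I \<subseteq> R \<and> (\<forall>x\<in>I. \<forall>y\<in>I. x + y \<in> I) \<and> (\<forall>x\<in>R. \<forall>y\<in>I. x * y \<in> I)"

definition prime_of :: "complex set \<Rightarrow> bool" where
  "prime_of P \<longleftrightarrow> ideal_of P \<and> 1 \<notin> P \<and> (\<forall>x\<in>R. \<forall>y\<in>R. x * y \<in> P \<longrightarrow> x \<in> P \<or> y \<in> P)"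

definition principal_of :: "complex set \<Rightarrow> bool" where
  "principal_of P \<longleftrightarrow> (\<exists>p\<in>R. P = (*) p ` R)"

lemma R_0: "0 \<in> R"
  using R_add[OF R_1 R_uminus[OF R_1]] by simp

lemma R_diff: "x \<in> R \<Longrightarrow> y \<in> R \<Longrightarrow> x - y \<in> R"
  using R_add[of x "-y"] R_uminus by simp

lemma R_of_nat: "of_nat n \<in> R"
  by (induction n) (auto simp: R_0 R_1 R_add)

lemma R_of_int: "of_int n \<in> R"
  by (cases n rule: int_cases2) (auto simp: R_of_nat R_uminus)

lemma R_numeral: "numeral n \<in> R"
  using R_of_nat[of "numeral n"] by simp

lemma Ints_subset_R: "\<int> \<subseteq> R"
  by (auto elim!: Ints_cases simp: R_of_int)

lemma R_cnj: "x \<in> R \<Longrightarrow> cnj x \<in> R"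
  using R_diff[of "x + cnj x" x] R_trace Ints_subset_R by auto

lemmas R_closed = R_0 R_1 R_add R_uminus R_mult R_diff R_of_nat R_of_int R_numeral R_cnj

lemma R_cmod_sq: 
  assumes "x \<in> R"
  obtains n :: nat where "(cmod x)\<^sup>2 = real n" "x * cnj x = of_nat n"
proof -
  obtain k where k: "x * cnj x = of_int k" using R_norm[OF assms] by (auto elim: Ints_cases)
  have "complex_of_real ((cmod x)\<^sup>2) = of_int k" using k by (metis complex_norm_square)
  hence k2: "(cmod x)\<^sup>2 = real_of_int k"
    by (metis of_real_eq_iff of_real_of_int_eq)
  hence "k \<ge> 0" by (metis of_int_0_le_iff zero_le_power2)
  then show ?thesis using that[of "nat k"] k k2 by simp
qed

lemma R_cmod_ge_1: "x \<in> R \<Longrightarrow> x \<noteq> 0 \<Longrightarrow> cmod x \<ge> 1"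
proof -
  assume a: "x \<in> R" "x \<noteq> 0"
  obtain n :: nat where n: "(cmod x)\<^sup>2 = real n" using R_cmod_sq a by metis
  have "n \<noteq> 0" using n a by (intro notI) simp
  hence "(cmod x)\<^sup>2 \<ge> 1\<^sup>2" using n by simp
  thus ?thesis by (rule power2_le_imp_le) simp
qed

lemma R_real_Ints:
  assumes "x \<in> R" "Im x = 0"
  shows "x \<in> \<int>"
proof -
  have xc: "cnj x = x" using assms by (simp add: complex_eq_iff)
  obtain k where k: "2 * x = of_int k" using R_trace[OF assms(1)] xc by (auto elim: Ints_cases)
  obtain n where n: "x * x = of_int n" using R_norm[OF assms(1)] xc by (auto elim: Ints_cases)
  have "(2*x)*(2*x) = 4 * (x * x)" by simp
  hence "(of_int (k * k) :: complex) = of_int (4 * n)" using k n by simp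
  hence kn: "k * k = 4 * n" by (simp only: of_int_eq_iff)
  have "even (k * k)" unfolding kn by simp
  then obtain m where "k = 2 * m" by auto
  hence "x = of_int m" using k by simp
  thus ?thesis by simp
qed

lemma R_unit: 
  assumes "x \<in> R" "cmod x = 1"
  shows "x * cnj x = 1"
  using assms by (metis complex_norm_square of_real_1 one_power2)

lemma R_Im_sq:
  assumes "x \<in> R"
  obtains n :: nat where "4 * (Im x)\<^sup>2 = real n"
proof -
  obtain k where k: "x + cnj x = of_int k" using R_trace[OF assms] by (auto elim: Ints_cases)
  obtain n :: nat where n: "(cmod x)\<^sup>2 = real n" using R_cmod_sq assms by metis
  have "Re (x + cnj x) = real_of_int k" using k by simp
  hence "2 * Re x = real_of_int k" by simp
  hence "(2 * Re x)\<^sup>2 = real_of_int (k\<^sup>2)" by simp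
  hence e: "4 * (Im x)\<^sup>2 = real_of_int (4 * int n - k\<^sup>2)"
    using n by (simp add: cmod_power2 power_mult_distrib algebra_simps)
  hence "real_of_int (4 * int n - k\<^sup>2) \<ge> 0" by (metis e zero_le_mult_iff zero_le_numeral zero_le_power2)
  hence "4 * int n - k\<^sup>2 \<ge> 0" by linarith
  thus ?thesis using that[of "nat (4 * int n - k\<^sup>2)"] e by simp
qed

text \<open>Since \<open>4 * (Im x)^2\<close> is a natural number, some \<open>w\<close> has least
  positive imaginary part. Division with remainder in the imaginary parts leaves a real element,
  which is an integer.\<close>

lemma R_basis:
  obtains w where "w \<in> R" "Im w > 0" "R = {of_int a + of_int b * w | a b. True}"
    "\<And>x. x \<in> R \<Longrightarrow> \<exists>b::int. Im x = of_int b * Im w"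
proof -
  define S where "S = {n::nat. \<exists>x\<in>R. Im x > 0 \<and> 4 * (Im x)\<^sup>2 = real n}"
  obtain x0 where x0: "x0 \<in> R" "Im x0 \<noteq> 0" using R_nonreal by auto
  define x1 where "x1 = (if Im x0 > 0 then x0 else - x0)"
  have x1: "x1 \<in> R" "Im x1 > 0" using x0 by (auto simp: x1_def R_uminus)
  obtain n1 :: nat where "4 * (Im x1)\<^sup>2 = real n1" using R_Im_sq x1(1) by metis
  hence "n1 \<in> S" using x1 by (auto simp: S_def)
  define n where "n = (LEAST n. n \<in> S)"
  have "n \<in> S" unfolding n_def using \<open>n1 \<in> S\<close> by (rule LeastI)
  then obtain w where w: "w \<in> R" "Im w > 0" "4 * (Im w)\<^sup>2 = real n" by (auto simp: S_def)
  have main: "\<exists>a b. x = of_int a + of_int b * w" if x: "x \<in> R" for x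
  proof -
    define q where "q = \<lfloor>Im x / Im w\<rfloor>"
    define y where "y = x - of_int q * w"
    have y: "y \<in> R" using x w by (simp add: y_def R_closed)
    have "of_int q \<le> Im x / Im w" "Im x / Im w < of_int q + 1" by (simp_all add: q_def)
    hence b: "0 \<le> Im y" "Im y < Im w" using w(2) by (simp_all add: y_def field_simps)
    have "Im y = 0"
    proof (rule ccontr)
      assume "Im y \<noteq> 0"
      hence "Im y > 0" using b by simp
      obtain m :: nat where m: "4 * (Im y)\<^sup>2 = real m" using R_Im_sq y by metis
      hence "m \<in> S" using y \<open>Im y > 0\<close> by (auto simp: S_def)
      hence "n \<le> m" unfolding n_def by (rule Least_le)
      moreover have "(Im y)\<^sup>2 < (Im w)\<^sup>2" using b by (intro power_strict_mono) auto
      ultimately show False using m w(3) by linarith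
    qed
    hence "y \<in> \<int>" using R_real_Ints y by blast
    then obtain a where "y = of_int a" by (auto elim: Ints_cases)
    hence "x = of_int a + of_int q * w" by (simp add: y_def algebra_simps)
    thus ?thesis by blast
  qed
  have "R = {of_int a + of_int b * w | a b. True}"
    using main w(1) by (auto intro!: R_closed)
  moreover have "\<exists>b::int. Im x = of_int b * Im w" if "x \<in> R" for x
    using main[OF that] by auto
  ultimately show ?thesis using that w by blast
qed

lemma finite_R_ball: "finite {x \<in> R. cmod x \<le> c}"
proof -
  obtain w where w: "w \<in> R" "Im w > 0" "R = {of_int a + of_int b * w | a b. True}"
    using R_basis by metis
  define k where "k = \<lceil>c / Im w\<rceil>"
  define l where "l = \<lceil>c + of_int \<bar>k\<bar> * cmod w\<rceil>"
  have "{x \<in> R. cmod x \<le> c} \<subseteq> (\<lambda>(a,b). of_int a + of_int b * w) ` ({-l..l} \<times> {-k..k})"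
  proof
    fix x assume x: "x \<in> {x \<in> R. cmod x \<le> c}"
    then obtain a b where ab: "x = of_int a + of_int b * w" using w(3) by auto
    have "\<bar>Im x\<bar> \<le> c" using x abs_Im_le_cmod[of x] by simp
    hence "\<bar>of_int b\<bar> * Im w \<le> c" using ab w(2) by (simp add: abs_mult)
    hence "\<bar>of_int b\<bar> \<le> c / Im w" using w(2) by (simp add: field_simps)
    hence "of_int \<bar>b\<bar> \<le> c / Im w" by simp
    hence b: "\<bar>b\<bar> \<le> k" unfolding k_def by linarith
    have "of_int a = x - of_int b * w" using ab by simp
    hence "cmod (of_int a) \<le> cmod x + cmod (of_int b * w)" by (metis norm_triangle_ineq4)
    hence "\<bar>of_int a\<bar> \<le> c + of_int \<bar>b\<bar> * cmod w" using x by (simp add: norm_mult)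
    also have "\<dots> \<le> c + of_int \<bar>k\<bar> * cmod w"
    proof -
      have "\<bar>b\<bar> \<le> \<bar>k\<bar>" using b by simp
      hence "real_of_int \<bar>b\<bar> \<le> of_int \<bar>k\<bar>" by linarith
      thus ?thesis by (simp add: mult_right_mono)
    qed
    finally have "real_of_int \<bar>a\<bar> \<le> c + of_int \<bar>k\<bar> * cmod w" by simp
    hence "\<bar>a\<bar> \<le> l" unfolding l_def by linarith
    thus "x \<in> (\<lambda>(a,b). of_int a + of_int b * w) ` ({-l..l} \<times> {-k..k})" using b ab 
      by (auto intro!: image_eqI[of _ _ "(a,b)"])
  qed
  thus ?thesis by (rule finite_subset) auto
qed

lemma ideal_of_0: "ideal_of I \<Longrightarrow> 0 \<in> I"
  and ideal_of_R: "ideal_of I \<Longrightarrow> x \<in> I \<Longrightarrow> x \<in> R"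
  and ideal_of_add: "ideal_of I \<Longrightarrow> x \<in> I \<Longrightarrow> y \<in> I \<Longrightarrow> x + y \<in> I"
  and ideal_of_mult: "ideal_of I \<Longrightarrow> x \<in> R \<Longrightarrow> y \<in> I \<Longrightarrow> x * y \<in> I"
  by (auto simp: ideal_of_def)

lemma ideal_of_mult': "ideal_of I \<Longrightarrow> x \<in> R \<Longrightarrow> y \<in> I \<Longrightarrow> y * x \<in> I"
  using ideal_of_mult by (simp add: mult.commute)

lemma ideal_of_uminus: "ideal_of I \<Longrightarrow> x \<in> I \<Longrightarrow> - x \<in> I"
  using ideal_of_mult[of I "-1" x] by (simp add: R_closed)

lemma ideal_of_diff: "ideal_of I \<Longrightarrow> x \<in> I \<Longrightarrow> y \<in> I \<Longrightarrow> x - y \<in> I"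
  using ideal_of_add[of I x "-y"] ideal_of_uminus[of I y] by simp

lemmas ideal_of_closed = ideal_of_0 ideal_of_add ideal_of_mult ideal_of_mult' ideal_of_uminus
  ideal_of_diff

lemma ideal_of_extend:
  assumes I: "ideal_of I" and b: "b \<in> R"
  shows "ideal_of {y + z * b | y z. y \<in> I \<and> z \<in> R}" (is "ideal_of ?Q")
    "I \<subseteq> {y + z * b | y z. y \<in> I \<and> z \<in> R}" "b \<in> {y + z * b | y z. y \<in> I \<and> z \<in> R}"
proof -
  show sub: "I \<subseteq> ?Q"
  proof
    fix y assume "y \<in> I"
    hence "y = y + 0 * b \<and> y \<in> I \<and> 0 \<in> R" using R_0 by simp
    thus "y \<in> ?Q" by blast
  qed
  have "b = 0 + 1 * b \<and> 0 \<in> I \<and> 1 \<in> R" using ideal_of_0[OF I] R_1 by simp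
  thus "b \<in> ?Q" by blast
  show "ideal_of ?Q" unfolding ideal_of_def
  proof (intro conjI ballI)
    show "0 \<in> ?Q" using sub ideal_of_0[OF I] by blast
    show "?Q \<subseteq> R" using b ideal_of_R[OF I] by (auto simp: R_closed)
    fix u v assume "u \<in> ?Q" "v \<in> ?Q"
    then obtain p z q y where *: "u = p + z * b" "v = q + y * b" "p \<in> I" "q \<in> I" "z \<in> R" "y \<in> R"
      by auto
    have "u + v = (p + q) + (z + y) * b" using * by (simp add: algebra_simps)
    thus "u + v \<in> ?Q" using * I ideal_of_add R_add by blast
  next
    fix u v assume u: "u \<in> R" and "v \<in> ?Q"
    then obtain q y where *: "v = q + y * b" "q \<in> I" "y \<in> R" by auto
    have "u * v = u * q + (u * y) * b" using * by (simp add: algebra_simps)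
    thus "u * v \<in> ?Q" using * I ideal_of_mult R_mult u by blast
  qed
qed

lemma prime_of_ideal: "prime_of P \<Longrightarrow> ideal_of P"
  and prime_of_1: "prime_of P \<Longrightarrow> 1 \<notin> P"
  and prime_of_mult: "prime_of P \<Longrightarrow> x * y \<in> P \<Longrightarrow> x \<in> R \<Longrightarrow> y \<in> R \<Longrightarrow> x \<in> P \<or> y \<in> P"
  by (auto simp: prime_of_def)

lemma ideal_of_eq_R: "ideal_of I \<Longrightarrow> 1 \<in> I \<Longrightarrow> I = R"
  using ideal_of_mult[of I _ 1] by (auto simp: ideal_of_def)

lemma ideal_of_has_nat:
  assumes "ideal_of I" "x \<in> I" "x \<noteq> 0"
  obtains n :: nat where "n > 0" "of_nat n \<in> I"
proof -
  have "x \<in> R" using assms ideal_of_R by blast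
  obtain n :: nat where n: "(cmod x)\<^sup>2 = real n" "x * cnj x = of_nat n"
    using R_cmod_sq \<open>x \<in> R\<close> by metis
  have "n > 0" using n(1) assms(3) by (intro gr0I) simp
  moreover have "of_nat n \<in> I" using n(2) ideal_of_mult'[of I "cnj x" x] assms \<open>x \<in> R\<close>
    by (simp add: R_cnj)
  ultimately show ?thesis using that by blast
qed

text \<open>An ideal containing \<open>n\<close> is determined by its intersection with the finite
  residue system \<open>B\<close> modulo \<open>n\<close>. This finiteness takes the place of the
  ascending chain condition below.\<close>

lemma finite_ideals_of_nat:
  assumes "n > 0"
  shows "finite {I. ideal_of I \<and> of_nat n \<in> I}"
proof -
  obtain w where w: "w \<in> R" "Im w > 0" "R = {of_int a + of_int b * w | a b. True}"
    using R_basis by metis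
  define B where "B = (\<lambda>(a,b). of_int a + of_int b * w) ` ({0..<int n} \<times> {0..<int n})"
  have fB: "finite B" by (simp add: B_def)
  have red: "\<exists>y\<in>B. \<exists>z\<in>R. x = y + of_nat n * z" if xR: "x \<in> R" for x
  proof -
    obtain a b where ab: "x = of_int a + of_int b * w" using w(3) xR by auto
    have "x = (of_int (a mod int n) + of_int (b mod int n) * w)
           + of_nat n * (of_int (a div int n) + of_int (b div int n) * w)"
    proof -
      have e: "of_int k = (of_int (k mod int n) + of_nat n * of_int (k div int n) :: complex)" for k
        by (metis mod_mult_div_eq of_int_add of_int_mult of_int_of_nat_eq)
      show ?thesis unfolding ab by (subst e[of a], subst e[of b]) (simp add: algebra_simps)
    qed
    moreover have "of_int (a mod int n) + of_int (b mod int n) * w \<in> B"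
      using assms by (auto simp: B_def intro!: image_eqI[of _ _ "(a mod int n, b mod int n)"])
    moreover have "of_int (a div int n) + of_int (b div int n) * w \<in> R"
      using w(1) by (simp add: R_closed)
    ultimately show ?thesis by blast
  qed
  have "inj_on (\<lambda>I. I \<inter> B) {I. ideal_of I \<and> of_nat n \<in> I}"
  proof (rule inj_onI)
    fix I I' assume I: "I \<in> {I. ideal_of I \<and> of_nat n \<in> I}" "I' \<in> {I. ideal_of I \<and> of_nat n \<in> I}"
      and e: "I \<inter> B = I' \<inter> B"
    have sub: "I1 \<subseteq> I2" if i: "ideal_of I1" "of_nat n \<in> I1" "ideal_of I2" "of_nat n \<in> I2"
      "I1 \<inter> B = I2 \<inter> B" for I1 I2
    proof
      fix x assume x: "x \<in> I1"
      then obtain y z where yz: "y \<in> B" "z \<in> R" "x = y + of_nat n * z"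
        using red i ideal_of_R by meson
      have "x - of_nat n * z \<in> I1" using i x yz(2) ideal_of_diff ideal_of_mult' by blast
      hence "y \<in> I1" using yz by simp
      hence "y \<in> I2" using i yz by auto
      thus "x \<in> I2" using yz i by (simp add: ideal_of_closed)
    qed
    show "I = I'" using sub[of I I'] sub[of I' I] I e by auto
  qed
  moreover have "(\<lambda>I. I \<inter> B) ` {I. ideal_of I \<and> of_nat n \<in> I} \<subseteq> Pow B" by auto
  ultimately show ?thesis using fB by (meson finite_Pow_iff inj_on_finite)
qed

text \<open>The ideals above \<open>I\<close> share a positive integer, hence are finitely many; a
  maximal one among those avoiding 1 is prime.\<close>

lemma prime_of_exists:
  assumes I: "ideal_of I" "1 \<notin> I" and x: "x \<in> I" "x \<noteq> 0"
  obtains P where "prime_of P" "I \<subseteq> P"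
proof -
  obtain n :: nat where n: "n > 0" "of_nat n \<in> I" using ideal_of_has_nat I x by metis
  define \<S> where "\<S> = {Q. ideal_of Q \<and> I \<subseteq> Q \<and> 1 \<notin> Q}"
  have "\<S> \<subseteq> {I. ideal_of I \<and> of_nat n \<in> I}" using n by (auto simp: \<S>_def)
  hence "finite \<S>" using finite_ideals_of_nat n(1) finite_subset by blast
  moreover have "I \<in> \<S>" using I by (auto simp: \<S>_def)
  ultimately obtain P where P: "P \<in> \<S>" "\<And>Q. Q \<in> \<S> \<Longrightarrow> P \<subseteq> Q \<Longrightarrow> P = Q"
    using finite_has_maximal2[of \<S> I] by metis
  have iP: "ideal_of P" "I \<subseteq> P" "1 \<notin> P" using P by (auto simp: \<S>_def)
  have gen: "\<exists>p\<in>P. \<exists>z\<in>R. 1 = p + z * a" if a: "a \<in> R" "a \<notin> P" for a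
  proof (rule ccontr)
    assume c: "\<not> ?thesis"
    define Q where "Q = {p + z * a | p z. p \<in> P \<and> z \<in> R}"
    note Q = ideal_of_extend[OF iP(1) a(1), folded Q_def]
    have "1 \<notin> Q" using c by (auto simp: Q_def)
    hence "P = Q" using P(2)[of Q] Q iP by (auto simp: \<S>_def)
    with Q(3) a show False by simp
  qed
  have "prime_of P" unfolding prime_of_def
  proof (intro conjI ballI impI)
    fix a y assume ay: "a \<in> R" "y \<in> R" "a * y \<in> P"
    show "a \<in> P \<or> y \<in> P"
    proof (rule disjCI, rule ccontr)
      assume "y \<notin> P" "a \<notin> P"
      then obtain p z where pz: "p \<in> P" "z \<in> R" "1 = p + z * a" using gen ay by blast
      have "y = (p + z * a) * y" using pz by simp
      hence "y = y * p + z * (a * y)" by (simp add: algebra_simps)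
      moreover have "y * p + z * (a * y) \<in> P" using iP pz ay by (simp add: ideal_of_closed)
      ultimately show False using \<open>y \<notin> P\<close> by simp
    qed
  qed (use iP in auto)
  thus ?thesis using that iP by blast
qed

text \<open>Pigeonhole on the powers of an element modulo a positive integer contained in the smaller
  prime shows that nonzero primes are maximal.\<close>

lemma prime_of_maximal:
  assumes P: "prime_of P" and Q: "prime_of Q" and sub: "Q \<subseteq> P" and x: "x \<in> Q" "x \<noteq> 0"
  shows "P = Q"
proof (rule ccontr)
  assume "P \<noteq> Q"
  then obtain a where a: "a \<in> P" "a \<notin> Q" using sub by auto
  note iP = prime_of_ideal[OF P] and iQ = prime_of_ideal[OF Q]
  have aR: "a \<in> R" using a ideal_of_R iP by blast
  obtain n :: nat where n: "n > 0" "of_nat n \<in> Q" using ideal_of_has_nat iQ x by metis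
  define I where "I = (\<lambda>k::nat. {q + z * a ^ k | q z. q \<in> Q \<and> z \<in> R})"
  have pow: "a ^ k \<in> R" for k by (induction k) (auto simp: R_closed aR)
  have iI: "ideal_of (I k)" "Q \<subseteq> I k" "a ^ k \<in> I k" for k
    unfolding I_def using ideal_of_extend[OF iQ pow] by blast+
  have "of_nat n \<in> I k" for k using n iI(2) by blast
  hence "I ` UNIV \<subseteq> {I. ideal_of I \<and> of_nat n \<in> I}" using iI(1) by auto
  hence "finite (range I)" using finite_ideals_of_nat n(1) finite_subset by blast
  hence "\<not> inj I" using finite_imageD infinite_UNIV_nat by blast
  then obtain i j where ij: "i < j" "I i = I j"
    unfolding inj_on_def by (metis linorder_neqE_nat)
  have "a ^ i \<in> I i" by (rule iI(3))
  hence "a ^ i \<in> I j" using ij(2) by simp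
  then obtain q z where qz: "a ^ i = q + z * a ^ j" "q \<in> Q" "z \<in> R" unfolding I_def by blast
  define d where "d = j - i - 1"
  have "j = i + Suc d" unfolding d_def using ij(1) by simp
  hence aj: "a ^ j = a ^ i * (a * a ^ d)" by (simp only: power_add power_Suc)
  have "a ^ i * (1 - z * a * a ^ d) = a ^ i - z * a ^ j" unfolding aj by (simp add: algebra_simps)
  also have "\<dots> = q" by (subst qz(1)) simp
  finally have "a ^ i * (1 - z * a * a ^ d) = q" .
  hence "a ^ i * (1 - z * a * a ^ d) \<in> Q" using qz by simp
  moreover have "1 - z * a * a ^ d \<in> R" using qz aR pow by (simp add: R_closed)
  ultimately have "a ^ i \<in> Q \<or> 1 - z * a * a ^ d \<in> Q" using prime_of_mult[OF Q] pow by blast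
  moreover have "a ^ k \<notin> Q" for k
  proof (induction k)
    case 0
    then show ?case using prime_of_1[OF Q] by simp
  next
    case (Suc k)
    then show ?case using prime_of_mult[OF Q _ aR pow, of k] a(2) by auto
  qed
  ultimately have "1 - z * a * a ^ d \<in> P" using sub by blast
  moreover have "z * a * a ^ d \<in> P" using a pow qz iP 
    by (simp add: ideal_of_closed R_closed)
  ultimately have "1 - z * a * a ^ d + z * a * a ^ d \<in> P" using iP ideal_of_add by blast
  thus False using prime_of_1[OF P] by simp
qed

lemma ideal_of_scaled:
  assumes "p \<in> R" shows "ideal_of ((*) p ` R)"
  unfolding ideal_of_def
proof (intro conjI ballI)
  show "0 \<in> (*) p ` R" using R_0 by (auto intro!: image_eqI[of _ _ 0])
  show "(*) p ` R \<subseteq> R" using assms R_mult by auto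
  fix x y assume "x \<in> (*) p ` R" "y \<in> (*) p ` R"
  then obtain u v where "u \<in> R" "v \<in> R" "x + y = p * (u + v)" by (auto simp: distrib_left)
  thus "x + y \<in> (*) p ` R" using R_add by blast
next
  fix x y assume x: "x \<in> R" "y \<in> (*) p ` R"
  then obtain u where "u \<in> R" "x * y = p * (x * u)" by auto
  thus "x * y \<in> (*) p ` R" using x R_mult by blast
qed

end

section \<open>The function \<open>j\<close> on ideals\<close>

context imag_quad_order
begin

section \<open>The ideals of \<open>R\<close> in two descriptions\<close>

abbreviation rr :: "complex ring" where "rr \<equiv> complex_ring\<lparr>carrier := R\<rparr>"

lemma rr_simps [simp]:
  "carrier rr = R" "x \<otimes>\<^bsub>rr\<^esub> y = x * y" "x \<oplus>\<^bsub>rr\<^esub> y = x + y" "\<zero>\<^bsub>rr\<^esub> = 0" "\<one>\<^bsub>rr\<^esub> = 1"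
  "x \<otimes>\<^bsub>complex_ring\<^esub> y = x * y" "x \<oplus>\<^bsub>complex_ring\<^esub> y = x + y"
  "\<zero>\<^bsub>complex_ring\<^esub> = 0" "\<one>\<^bsub>complex_ring\<^esub> = 1"
  by (auto simp: complex_ring_def)

lemma cring_rr: "cring rr"
proof (intro cringI abelian_groupI comm_monoidI)
  fix x assume "x \<in> carrier rr"
  thus "\<exists>y\<in>carrier rr. y \<oplus>\<^bsub>rr\<^esub> x = \<zero>\<^bsub>rr\<^esub>" by (auto intro!: bexI[of _ "-x"] R_closed)
qed (auto simp: R_closed algebra_simps)

interpretation rr: cring rr by (rule cring_rr)

lemma rr_minus: "x \<in> R \<Longrightarrow> \<ominus>\<^bsub>rr\<^esub> x = - x"
  using rr.minus_equality[of "-x" x] by (simp add: R_closed)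

lemma ideal_iff: "ideal I rr \<longleftrightarrow> ideal_of I"
proof
  assume "ideal I rr"
  then interpret ideal I rr .
  show "ideal_of I" unfolding ideal_of_def
    using zero_closed a_subset I_l_closed a_closed by auto
next
  assume I: "ideal_of I"
  show "ideal I rr"
  proof (intro idealI)
    show "ring rr" by (rule rr.ring_axioms)
    show "subgroup I (add_monoid rr)"
    proof (intro subgroup.intro)
      fix x assume x: "x \<in> I"
      have "inv\<^bsub>add_monoid rr\<^esub> x = - x"
        using rr_minus[of x] ideal_of_R[OF I x] by (simp add: a_inv_def)
      thus "inv\<^bsub>add_monoid rr\<^esub> x \<in> I" using ideal_of_uminus[OF I x] by simp
    qed (use I in \<open>auto simp: ideal_of_closed ideal_of_R\<close>)
  qed (use I in \<open>auto simp: ideal_of_closed\<close>)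
qed

lemma primeideal_iff: "primeideal P rr \<longleftrightarrow> prime_of P"
proof
  assume "primeideal P rr"
  then interpret primeideal P rr .
  have "ideal_of P" using ideal_axioms ideal_iff by simp
  moreover have "1 \<notin> P" using ideal_of_eq_R \<open>ideal_of P\<close> I_notcarr by auto
  ultimately show "prime_of P" unfolding prime_of_def using I_prime by auto
next
  assume P: "prime_of P"
  show "primeideal P rr"
    by (intro primeidealI)
      (use P prime_of_1[OF P] R_1 prime_of_mult[OF P] in \<open>auto simp: ideal_iff prime_of_ideal cring_rr\<close>)
qed

lemma genideal_eq:
  assumes I: "ideal_of I" and b: "b \<in> R"
  shows "Idl\<^bsub>rr\<^esub> (insert b I) = {y + z * b | y z. y \<in> I \<and> z \<in> R}" (is "_ = ?Q")
proof
  show "Idl\<^bsub>rr\<^esub> (insert b I) \<subseteq> ?Q"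
    unfolding genideal_def ideal_iff using ideal_of_extend[OF I b] by (intro Inter_lower) simp
  show "?Q \<subseteq> Idl\<^bsub>rr\<^esub> (insert b I)"
    unfolding genideal_def ideal_iff by (auto intro!: ideal_of_add ideal_of_mult)
qed

lemma genideal_insert_carrier:
  assumes "ideal_of I" "b \<in> R"
  shows "Idl\<^bsub>rr\<^esub> (insert b I) = R \<longleftrightarrow> (\<exists>y\<in>I. \<exists>z\<in>R. y + z * b = 1)"
proof -
  have "ideal_of (Idl\<^bsub>rr\<^esub> (insert b I))"
    using rr.genideal_ideal[of "insert b I"] assms ideal_of_R by (simp add: ideal_iff subset_iff)
  hence "Idl\<^bsub>rr\<^esub> (insert b I) = R \<longleftrightarrow> 1 \<in> Idl\<^bsub>rr\<^esub> (insert b I)"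
    using ideal_of_eq_R R_1 by blast
  thus ?thesis unfolding genideal_eq[OF assms] by (auto simp: eq_commute[of 1])
qed

lemma genideal_singleton: 
  assumes "a \<in> R" shows "Idl\<^bsub>rr\<^esub> {a} = (*) a ` R"
proof -
  have "Idl\<^bsub>rr\<^esub> {a} = PIdl\<^bsub>rr\<^esub> a" using rr.cgenideal_eq_genideal[of a] assms by simp
  also have "\<dots> = (*) a ` R" by (auto simp: cgenideal_def mult.commute image_def)
  finally show ?thesis .
qed

lemma PIdl_eq: "PIdl\<^bsub>rr\<^esub> a = (*) a ` R"
  by (auto simp: cgenideal_def mult.commute image_def)

lemma genideal_pair:
  assumes "a \<in> R" "b \<in> R"
  shows "Idl\<^bsub>rr\<^esub> {a, b} = {x * a + y * b | x y. x \<in> R \<and> y \<in> R}"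
proof -
  have iI: "ideal_of (Idl\<^bsub>rr\<^esub> {a})" using ideal_of_scaled genideal_singleton assms by simp
  have "Idl\<^bsub>rr\<^esub> {a, b} = Idl\<^bsub>rr\<^esub> (insert b (Idl\<^bsub>rr\<^esub> {a}))"
  proof
    show "Idl\<^bsub>rr\<^esub> {a, b} \<subseteq> Idl\<^bsub>rr\<^esub> (insert b (Idl\<^bsub>rr\<^esub> {a}))"
    proof (rule rr.genideal_minimal)
      have "insert b (Idl\<^bsub>rr\<^esub> {a}) \<subseteq> R" using assms iI ideal_of_R by blast
      thus "ideal (Idl\<^bsub>rr\<^esub> (insert b (Idl\<^bsub>rr\<^esub> {a}))) rr" using rr.genideal_ideal by simp
      have "insert b (Idl\<^bsub>rr\<^esub> {a}) \<subseteq> Idl\<^bsub>rr\<^esub> (insert b (Idl\<^bsub>rr\<^esub> {a}))"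
        using rr.genideal_self[of "insert b (Idl\<^bsub>rr\<^esub> {a})", unfolded rr_simps] \<open>insert b (Idl\<^bsub>rr\<^esub> {a}) \<subseteq> R\<close> by blast
      moreover have "a \<in> Idl\<^bsub>rr\<^esub> {a}" using rr.genideal_self'[of a] assms by simp
      ultimately show "{a, b} \<subseteq> Idl\<^bsub>rr\<^esub> (insert b (Idl\<^bsub>rr\<^esub> {a}))" by blast
    qed
    show "Idl\<^bsub>rr\<^esub> (insert b (Idl\<^bsub>rr\<^esub> {a})) \<subseteq> Idl\<^bsub>rr\<^esub> {a, b}"
    proof (rule rr.genideal_minimal)
      have ab: "{a, b} \<subseteq> carrier rr" using assms by simp
      show 1: "ideal (Idl\<^bsub>rr\<^esub> {a, b}) rr" using rr.genideal_ideal ab by blast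
      have 2: "{a, b} \<subseteq> Idl\<^bsub>rr\<^esub> {a, b}" using rr.genideal_self ab by blast
      have "Idl\<^bsub>rr\<^esub> {a} \<subseteq> Idl\<^bsub>rr\<^esub> {a, b}" using rr.genideal_minimal[OF 1, of "{a}"] 2 by simp
      thus "insert b (Idl\<^bsub>rr\<^esub> {a}) \<subseteq> Idl\<^bsub>rr\<^esub> {a, b}" using 2 by simp
    qed
  qed
  also have "\<dots> = {x * a + y * b | x y. x \<in> R \<and> y \<in> R}"
  proof -
    have "(*) a ` R = {x * a | x. x \<in> R}" by (simp add: image_def Bex_def mult.commute conj_commute)
    thus ?thesis by (subst genideal_eq[OF iI assms(2)], subst genideal_singleton[OF assms(1)]) auto
  qed
  finally show ?thesis .
qed

lemma genideal_pair_carrier: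
  assumes "a \<in> R" "b \<in> R"
  shows "Idl\<^bsub>rr\<^esub> {a, b} = R \<longleftrightarrow> (\<exists>x\<in>R. \<exists>y\<in>R. x * a + y * b = 1)"
proof -
  have "ideal_of (Idl\<^bsub>rr\<^esub> {a, b})"
    using rr.genideal_ideal[of "{a, b}"] assms by (simp add: ideal_iff)
  hence "Idl\<^bsub>rr\<^esub> {a, b} = R \<longleftrightarrow> 1 \<in> Idl\<^bsub>rr\<^esub> {a, b}"
    using ideal_of_eq_R R_1 by blast
  thus ?thesis unfolding genideal_pair[OF assms] by (auto simp: eq_commute[of 1])
qed

lemma principal_ofI: "principalideal P rr \<Longrightarrow> principal_of P"
proof -
  assume "principalideal P rr"
  then interpret principalideal P rr .
  show ?thesis using generate genideal_singleton by (auto simp: principal_of_def)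
qed

lemma ideal_divides_subset:
  assumes "ideal_divides rr P I" "ideal_of P"
  shows "I \<subseteq> P"
  using assms rr.ideal_prod_inter[of P] by (auto simp: ideal_divides_def ideal_iff)

text \<open>The cofactor is the colon ideal of \<open>I\<close> by \<open>p\<close>, so for a
  principal ideal containment already gives division.\<close>

lemma ideal_divides_scaled:
  assumes I: "ideal_of I" and p: "p \<in> R" and sub: "I \<subseteq> (*) p ` R"
  shows "ideal_divides rr (PIdl\<^bsub>rr\<^esub> p) I"
proof -
  define C where "C = {c \<in> R. p * c \<in> I}"
  have "ideal_of C" unfolding ideal_of_def C_def using I p
    by (auto simp: R_closed ideal_of_0 distrib_left ideal_of_add)
      (metis ideal_of_mult mult.left_commute)
  moreover have "I = (PIdl\<^bsub>rr\<^esub> p) \<cdot>\<^bsub>rr\<^esub> C"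
  proof
    show "I \<subseteq> (PIdl\<^bsub>rr\<^esub> p) \<cdot>\<^bsub>rr\<^esub> C"
    proof
      fix x assume x: "x \<in> I"
      then obtain c where c: "c \<in> R" "x = p * c" using sub by auto
      hence "c \<in> C" using x by (simp add: C_def)
      moreover have "p \<in> PIdl\<^bsub>rr\<^esub> p" unfolding PIdl_eq using R_1 by (auto intro!: image_eqI[of _ _ 1])
      ultimately have "p \<otimes>\<^bsub>rr\<^esub> c \<in> (PIdl\<^bsub>rr\<^esub> p) \<cdot>\<^bsub>rr\<^esub> C" by (intro ideal_prod.prod)
      thus "x \<in> (PIdl\<^bsub>rr\<^esub> p) \<cdot>\<^bsub>rr\<^esub> C" using c by simp
    qed
    show "(PIdl\<^bsub>rr\<^esub> p) \<cdot>\<^bsub>rr\<^esub> C \<subseteq> I"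
    proof
      fix x assume "x \<in> (PIdl\<^bsub>rr\<^esub> p) \<cdot>\<^bsub>rr\<^esub> C"
      thus "x \<in> I"
      proof induction
        case (prod i j)
        then obtain z where z: "i = p * z" "z \<in> R" unfolding PIdl_eq by auto
        have "p * j \<in> I" using prod(2) unfolding C_def by blast
        hence "z * (p * j) \<in> I" using z I ideal_of_mult by blast
        then show ?case using z by (simp add: algebra_simps)
      next
        case (sum s1 s2)
        then show ?case using ideal_of_add I by simp
      qed
    qed
  qed
  ultimately show ?thesis unfolding ideal_divides_def ideal_iff by blast
qed

section \<open>Shifts avoiding the primes above an ideal\<close>

lemma prime_of_int_dvd:
  assumes P: "prime_of P" and q: "prime (q::nat)" "of_nat q \<in> P"
  shows "of_int k \<in> P \<longleftrightarrow> int q dvd k"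
proof
  assume k: "of_int k \<in> P"
  show "int q dvd k"
  proof (rule ccontr)
    assume "\<not> int q dvd k"
    hence "coprime (int q) k" using q(1) by (simp add: prime_imp_coprime)
    then obtain u v where "u * int q + v * k = 1" by (metis bezout_int coprime_iff_gcd_eq_1)
    hence "of_int u * of_nat q + of_int v * of_int k = (1::complex)"
      by (metis of_int_1 of_int_add of_int_mult of_int_of_nat_eq)
    moreover have "of_int u * of_nat q + of_int v * of_int k \<in> P"
      using prime_of_ideal[OF P] q k by (simp add: ideal_of_closed R_closed)
    ultimately show False using prime_of_1[OF P] by simp
  qed
next
  assume "int q dvd k"
  then obtain m where "k = int q * m" by auto
  thus "of_int k \<in> P" using prime_of_ideal[OF P] q by (simp add: ideal_of_closed R_closed)
qed

lemma prime_of_has_prime: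
  assumes P: "prime_of P" and n: "n > 0" "of_nat n \<in> P"
  obtains q where "prime q" "q dvd n" "of_nat q \<in> P"
  using n
proof (induction n arbitrary: thesis rule: less_induct)
  case (less n)
  have "n \<noteq> 1" using less prime_of_1[OF P] by auto
  then obtain q where q: "prime q" "q dvd n" using prime_factor_nat by blast
  then obtain m where m: "n = q * m" by auto
  have "of_nat q * of_nat m \<in> P" using less m by simp
  hence "of_nat q \<in> P \<or> of_nat m \<in> P" using prime_of_mult[OF P] R_of_nat by blast
  thus thesis
  proof
    assume "of_nat q \<in> P" thus thesis using less q by blast
  next
    assume mP: "of_nat m \<in> P"
    have "m < n" "m > 0" using m prime_gt_1_nat[OF q(1)] less.prems(2) by auto
    then obtain q' where "prime q'" "q' dvd m" "of_nat q' \<in> P" using less.IH[of m] mP by blast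
    thus thesis using less.prems(1) m by auto
  qed
qed

text \<open>If both residue classes modulo 2 are forbidden by primes above 2 containing \<open>I\<close>, then 2 splits
  as the product of these primes, which is what admissibility excludes.\<close>

lemma not_both_classes_mod_2:
  assumes I: "ideal_of I" and al: "\<alpha> \<in> R" "admissible_shift rr I \<alpha>"
    and P: "prime_of P" "2 \<in> P" "\<alpha> \<in> P" "I \<subseteq> P"
    and Q: "prime_of Q" "2 \<in> Q" "\<alpha> + 1 \<in> Q" "I \<subseteq> Q"
  shows False
proof -
  note iP = prime_of_ideal[OF P(1)] and iQ = prime_of_ideal[OF Q(1)]
  obtain T where T: "\<alpha> + cnj \<alpha> = of_int T" using R_trace[OF al(1)] by (auto elim: Ints_cases)
  obtain N where N: "\<alpha> * cnj \<alpha> = of_int N" using R_norm[OF al(1)] by (auto elim: Ints_cases)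
  have evP: "of_int k \<in> P \<longleftrightarrow> even k" for k using prime_of_int_dvd[OF P(1), of 2 k] P(2) by simp
  have evQ: "of_int k \<in> Q \<longleftrightarrow> even k" for k using prime_of_int_dvd[OF Q(1), of 2 k] Q(2) by simp
  have "of_int N \<in> P" unfolding N[symmetric] using iP P(3) al by (simp add: ideal_of_closed R_closed)
  hence evN: "even N" using evP by simp
  \<comment> \<open>The norm of \<alpha> lies in \<open>P\<close> and that of
    \<open>\<alpha> + 1\<close> in \<open>Q\<close>; both are even, which makes the trace
    \<open>T\<close> odd.\<close>
  have "(\<alpha> + 1) * (cnj \<alpha> + 1) \<in> Q" using iQ Q(3) al by (simp add: ideal_of_closed R_closed)
  moreover have "(\<alpha> + 1) * (cnj \<alpha> + 1) = of_int (N + T + 1)" using N T by (simp add: algebra_simps)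
  ultimately have "of_int (N + T + 1) \<in> Q" by (simp only:)
  hence "even (N + T + 1)" by (simp only: evQ)
  hence oddT: "odd T" using evN by simp
  obtain w where w: "w \<in> R" "R = {of_int a + of_int b * w | a b. True}"
    using R_basis by metis
  obtain a0 b0 where ab: "\<alpha> = of_int a0 + of_int b0 * w" using w(2) al(1) by auto
  obtain tw where tw: "w + cnj w = of_int tw" using R_trace[OF w(1)] by (auto elim: Ints_cases)
  have "of_int T = 2 * of_int a0 + of_int b0 * (w + cnj w)" using T ab by (simp add: algebra_simps)
  hence "(of_int T :: complex) = of_int (2 * a0 + b0 * tw)" using tw by simp
  hence "T = 2 * a0 + b0 * tw" by (simp only: of_int_eq_iff)
  hence "odd b0" using oddT by auto
  then obtain c where c: "b0 = 2 * c + 1" by (auto elim: oddE)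
  \<comment> \<open>With \<open>b0\<close> odd, 1 and \<alpha> span \<open>R\<close> modulo 2. Hence
    \<open>P\<close> is determined by \<alpha>, and \<open>P\<close> and \<open>Q\<close> meet only
    in multiples of 2.\<close>
  have red: "\<exists>i l. \<exists>y\<in>R. x = of_int i + of_int l * \<alpha> + 2 * y" if xR: "x \<in> R" for x
  proof -
    obtain a b where x: "x = of_int a + of_int b * w" using xR unfolding w(2) by auto
    have "x = of_int (a - b * a0) + of_int b * \<alpha> + 2 * (- of_int (b * c) * w)"
      unfolding x ab c by (simp add: algebra_simps)
    moreover have "- of_int (b * c) * w \<in> R" using w(1) by (intro R_closed)
    ultimately show ?thesis by blast
  qed
  have PP: "P = Idl\<^bsub>rr\<^esub> {2, \<alpha>}" unfolding genideal_pair[OF R_numeral al(1)]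
  proof
    show "{x * 2 + y * \<alpha> |x y. x \<in> R \<and> y \<in> R} \<subseteq> P"
      using iP P by (auto intro!: ideal_of_add ideal_of_mult)
    show "P \<subseteq> {x * 2 + y * \<alpha> |x y. x \<in> R \<and> y \<in> R}"
    proof
      fix x assume x: "x \<in> P"
      then obtain i l y where ily: "y \<in> R" "x = of_int i + of_int l * \<alpha> + 2 * y"
        using red ideal_of_R[OF iP] by blast
      have "x - of_int l * \<alpha> - 2 * y \<in> P" using x iP P ily(1) by (simp add: ideal_of_closed R_closed)
      moreover have "x - of_int l * \<alpha> - 2 * y = of_int i" using ily by (simp add: algebra_simps)
      ultimately have "even i" using evP[of i] by (simp only:)
      then obtain m where "i = 2 * m" by auto
      hence "x = (of_int m + y) * 2 + of_int l * \<alpha> \<and> of_int m + y \<in> R \<and> of_int l \<in> R"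
        using ily by (simp add: R_closed)
      thus "x \<in> {x * 2 + y * \<alpha> |x y. x \<in> R \<and> y \<in> R}" by blast
    qed
  qed
  have inter: "x \<in> (*) 2 ` R" if x: "x \<in> P" "x \<in> Q" for x
  proof -
    obtain i l y where ily: "y \<in> R" "x = of_int i + of_int l * \<alpha> + 2 * y"
      using red ideal_of_R[OF iP] x by blast
    have "x - of_int l * \<alpha> - 2 * y \<in> P" using x iP P ily(1) by (simp add: ideal_of_closed R_closed)
    moreover have "x - of_int l * \<alpha> - 2 * y = of_int i" using ily by (simp add: algebra_simps)
    ultimately have "even i" using evP[of i] by (simp only:)
    have "x - of_int l * (\<alpha> + 1) - 2 * y \<in> Q" using x iQ Q ily(1) by (simp add: ideal_of_closed R_closed)
    moreover have "x - of_int l * (\<alpha> + 1) - 2 * y = of_int (i - l)" using ily by (simp add: algebra_simps)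
    ultimately have "even (i - l)" using evQ[of "i - l"] by (simp only:)
    with \<open>even i\<close> obtain m n where "i = 2 * m" "l = 2 * n" by (auto elim!: evenE)
    hence "x = 2 * (of_int m + of_int n * \<alpha> + y)" using ily by (simp add: algebra_simps)
    moreover have "of_int m + of_int n * \<alpha> + y \<in> R" using ily al by (simp add: R_closed)
    ultimately show ?thesis by blast
  qed
  have PQne: "P \<noteq> Q"
  proof
    assume "P = Q"
    hence "\<alpha> + 1 - \<alpha> \<in> P" using P Q ideal_of_diff[OF iP] by blast
    thus False using prime_of_1[OF P(1)] by simp
  qed
  have "PIdl\<^bsub>rr\<^esub> 2 = P \<cdot>\<^bsub>rr\<^esub> Q"
  proof
    have i: "ideal_of (P \<cdot>\<^bsub>rr\<^esub> Q)" using rr.ideal_prod_is_ideal iP iQ by (simp add: ideal_iff)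
    have "2 * (\<alpha> + 1) \<in> P \<cdot>\<^bsub>rr\<^esub> Q" "\<alpha> * 2 \<in> P \<cdot>\<^bsub>rr\<^esub> Q"
      using ideal_prod.prod[OF P(2) Q(3), of rr] ideal_prod.prod[OF P(3) Q(2), of rr] by simp_all
    hence "2 * (\<alpha> + 1) - \<alpha> * 2 \<in> P \<cdot>\<^bsub>rr\<^esub> Q" using ideal_of_diff[OF i] by blast
    hence "2 \<in> P \<cdot>\<^bsub>rr\<^esub> Q" by (simp add: algebra_simps)
    thus "PIdl\<^bsub>rr\<^esub> 2 \<subseteq> P \<cdot>\<^bsub>rr\<^esub> Q" unfolding PIdl_eq using i by (auto intro: ideal_of_mult')
    have "P \<cdot>\<^bsub>rr\<^esub> Q \<subseteq> P \<inter> Q" using rr.ideal_prod_inter iP iQ by (simp add: ideal_iff)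
    thus "P \<cdot>\<^bsub>rr\<^esub> Q \<subseteq> PIdl\<^bsub>rr\<^esub> 2" unfolding PIdl_eq using inter by blast
  qed
  hence "splits_in 2 rr" unfolding splits_in_def using P Q PQne by (auto simp: primeideal_iff)
  moreover have "primeideal (Idl\<^bsub>rr\<^esub> {2, \<alpha>}) rr" using P(1) PP by (simp add: primeideal_iff)
  moreover have "ideal_divides rr (PIdl\<^bsub>rr\<^esub> 2) I"
    using ideal_divides_scaled[OF I R_numeral] inter P Q by blast
  ultimately show False using al(2) unfolding admissible_shift_def by blast
qed

definition coprime_shift :: "complex set \<Rightarrow> complex \<Rightarrow> int \<Rightarrow> bool" where
  "coprime_shift I \<alpha> j \<longleftrightarrow> (\<exists>y\<in>I. \<exists>z\<in>R. y + z * (\<alpha> + of_int j) = 1)"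

text \<open>By the Chinese remainder theorem it is enough to find, for each prime number
  \<open>q\<close> dividing \<open>n\<close>, one residue that avoids all primes above
  \<open>q\<close> containing \<open>I\<close>. For \<open>q > 2\<close> the norm of
  \<open>\<alpha> + j\<close> is a monic quadratic in \<open>j\<close>, with at most two roots
  modulo \<open>q\<close>; for \<open>q = 2\<close> admissibility prevents both classes from being
  blocked.\<close>

lemma coprime_shift_exists:
  assumes I: "ideal_of I" and n: "n > 0" "of_nat n \<in> I" and al: "\<alpha> \<in> R" "admissible_shift rr I \<alpha>"
  shows "\<exists>j. coprime_shift I \<alpha> j"
proof -
  obtain T where T: "\<alpha> + cnj \<alpha> = of_int T" using R_trace[OF al(1)] by (auto elim: Ints_cases)
  obtain N where N: "\<alpha> * cnj \<alpha> = of_int N" using R_norm[OF al(1)] by (auto elim: Ints_cases)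
  have "\<exists>r::nat. \<forall>P. prime_of P \<longrightarrow> I \<subseteq> P \<longrightarrow> of_nat q \<in> P \<longrightarrow> \<alpha> + of_nat r \<notin> P"
    if q: "prime q" for q :: nat
  proof (cases "q = 2")
    case True
    show ?thesis
    proof (rule ccontr)
      assume c: "\<not> ?thesis"
      obtain P where P: "prime_of P" "I \<subseteq> P" "2 \<in> P" "\<alpha> \<in> P"
        using c[simplified, rule_format, of 0] True by auto
      obtain Q where Q: "prime_of Q" "I \<subseteq> Q" "2 \<in> Q" "\<alpha> + 1 \<in> Q"
        using c[simplified, rule_format, of 1] True by auto
      show False using not_both_classes_mod_2 I al P Q by blast
    qed
  next
    case False
    hence q3: "q > 2" using q prime_ge_2_nat[of q] by simp
    define p where "p = (\<lambda>j::int. j^2 + T * j + N)"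
    have "\<exists>r\<in>{0,1,2::nat}. \<not> int q dvd p (int r)"
    proof (rule ccontr)
      assume "\<not> ?thesis"
      hence "int q dvd p 0" "int q dvd p 1" "int q dvd p 2" by auto
      \<comment> \<open>The second difference of a monic quadratic is 2.\<close>
      hence "int q dvd p 2 - p 1 - (p 1 - p 0)" by (intro dvd_diff)
      hence "int q dvd 2" by (simp add: p_def)
      hence "int q \<le> 2" by (rule zdvd_imp_le) simp
      thus False using q3 by simp
    qed
    then obtain r :: nat where r: "\<not> int q dvd p (int r)" by blast
    have "\<alpha> + of_nat r \<notin> P" if P: "prime_of P" "of_nat q \<in> P" for P
    proof
      assume a: "\<alpha> + of_nat r \<in> P"
      have "(cnj \<alpha> + of_nat r) * (\<alpha> + of_nat r) \<in> P"
        using prime_of_ideal[OF P(1)] a al by (intro ideal_of_mult R_closed)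
      moreover have "(cnj \<alpha> + of_nat r) * (\<alpha> + of_nat r) = of_int (p (int r))"
      proof -
        have "(cnj \<alpha> + of_nat r) * (\<alpha> + of_nat r) = (of_nat r)^2 + (\<alpha> + cnj \<alpha>) * of_nat r + \<alpha> * cnj \<alpha>"
          by (simp add: algebra_simps power2_eq_square)
        thus ?thesis unfolding T N p_def by simp
      qed
      ultimately show False using prime_of_int_dvd[OF P(1) q P(2), of "p (int r)"] r by (simp only:)
    qed
    thus ?thesis by blast
  qed
  then obtain r :: "nat \<Rightarrow> nat" where r: "\<And>q P. prime q \<Longrightarrow> prime_of P \<Longrightarrow> I \<subseteq> P \<Longrightarrow> of_nat q \<in> P \<Longrightarrow>
     \<alpha> + of_nat (r q) \<notin> P" by metis
  define S where "S = {q. prime q \<and> q dvd n}"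
  have "finite S" using n unfolding S_def by (intro finite_subset[OF _ finite_divisors_nat[of n]]) auto
  moreover have "\<forall>i\<in>S. \<forall>j\<in>S. i \<noteq> j \<longrightarrow> coprime i j" by (auto simp: S_def primes_coprime)
  ultimately obtain x where x: "\<And>q. q \<in> S \<Longrightarrow> [x = r q] (mod q)"
    using chinese_remainder_nat[of S "\<lambda>q. q" r] by blast
  have "coprime_shift I \<alpha> (int x)"
  proof (rule ccontr)
    assume c: "\<not> ?thesis"
    define A where "A = Idl\<^bsub>rr\<^esub> (insert (\<alpha> + of_nat x) I)"
    have sub: "insert (\<alpha> + of_nat x) I \<subseteq> R" using ideal_of_R[OF I] al by (auto simp: R_closed)
    have iA: "ideal_of A" unfolding A_def using rr.genideal_ideal sub by (simp add: ideal_iff)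
    have subA: "insert (\<alpha> + of_nat x) I \<subseteq> A" unfolding A_def
      using rr.genideal_self[of "insert (\<alpha> + of_nat x) I", unfolded rr_simps] sub by blast
    have "1 \<notin> A" using c genideal_insert_carrier[OF I, of "\<alpha> + of_nat x"] al ideal_of_eq_R[OF iA]
      by (auto simp: coprime_shift_def A_def R_closed)
    moreover have "of_nat n \<in> A" using subA n by auto
    ultimately obtain P where P: "prime_of P" "A \<subseteq> P"
      using prime_of_exists[OF iA _ \<open>of_nat n \<in> A\<close>] n by auto
    have "of_nat n \<in> P" using \<open>of_nat n \<in> A\<close> P by auto
    then obtain q where q: "prime q" "q dvd n" "of_nat q \<in> P"
      using prime_of_has_prime[OF P(1) n(1)] by blast
    have "[int x = int (r q)] (mod int q)" using x[of q] q by (simp add: S_def cong_int_iff)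
    then obtain m where m: "int (r q) = int x + int q * m" by (metis cong_iff_lin)
    have "of_nat (r q) = (of_int (int x + int q * m) :: complex)" using m by (metis of_int_of_nat_eq)
    hence "\<alpha> + of_nat (r q) = (\<alpha> + of_nat x) + of_int m * of_nat q" by (simp add: algebra_simps)
    moreover have "(\<alpha> + of_nat x) + of_int m * of_nat q \<in> P"
    proof (rule ideal_of_add[OF prime_of_ideal[OF P(1)]])
      show "\<alpha> + of_nat x \<in> P" using subA P by blast
      show "of_int m * of_nat q \<in> P" using ideal_of_mult[OF prime_of_ideal[OF P(1)] R_of_int] q by blast
    qed
    moreover have "I \<subseteq> P" using subA P by auto
    ultimately show False using r[OF q(1) P(1) _ q(3)] by metis
  qed
  thus ?thesis by blast
qed

text \<open>A \<open>LEAST\<close> over the reals is meaningful only if it is attained. The valid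
  lengths include \<open>n\<close>, by periodicity modulo \<open>n\<close>, are bounded below by 0,
  and contain their infimum because an interval matters only through the integers in it.\<close>

lemma ideal_j_works:
  assumes I: "ideal_of I" "x0 \<in> I" "x0 \<noteq> 0" and al: "\<alpha> \<in> R" "admissible_shift rr I \<alpha>"
  shows "\<exists>j::int. x \<le> of_int j \<and> of_int j \<le> x + ideal_j rr I \<and> coprime_shift I \<alpha> j"
proof -
  obtain n :: nat where n: "n > 0" "of_nat n \<in> I" using ideal_of_has_nat I by metis
  define G :: "real \<Rightarrow> bool" where "G = (\<lambda>L. \<forall>\<alpha> \<in> carrier rr. admissible_shift rr I \<alpha> \<longrightarrow>
     (\<forall>x. \<exists>j :: int. of_int j \<in> {x..x + L} \<and> Idl\<^bsub>rr\<^esub> (insert (\<alpha> + of_int j) I) = carrier rr))"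
  have G: "G L \<longleftrightarrow> (\<forall>\<alpha>\<in>R. admissible_shift rr I \<alpha> \<longrightarrow>
      (\<forall>x. \<exists>j::int. x \<le> of_int j \<and> of_int j \<le> x + L \<and> coprime_shift I \<alpha> j))" for L
    unfolding G_def coprime_shift_def
    by (auto simp: genideal_insert_carrier[OF I(1)] R_closed)
  have Gn: "G (real n)" unfolding G
  proof (intro ballI impI allI)
    fix \<alpha> x assume al: "\<alpha> \<in> R" "admissible_shift rr I \<alpha>"
    obtain j where "coprime_shift I \<alpha> j" using coprime_shift_exists[OF I(1) n al] by blast
    then obtain y z where yz: "y \<in> I" "z \<in> R" "y + z * (\<alpha> + of_int j) = 1"
      by (auto simp: coprime_shift_def)
    define k where "k = \<lceil>(x - of_int j) / real n\<rceil>"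
    define j' where "j' = j + int n * k"
    have "(x - of_int j) / real n \<le> of_int k" "of_int k < (x - of_int j) / real n + 1"
      unfolding k_def by linarith+
    hence "x \<le> of_int j'" "of_int j' \<le> x + real n" using n(1) by (auto simp: j'_def field_simps)
    moreover have "coprime_shift I \<alpha> j'"
    proof -
      have "y - z * of_int k * of_nat n \<in> I" using yz I n by (intro ideal_of_diff ideal_of_mult R_closed)
      moreover have "(y - z * of_int k * of_nat n) + z * (\<alpha> + of_int j') = 1"
        using yz(3) by (simp add: j'_def algebra_simps)
      ultimately show ?thesis unfolding coprime_shift_def using yz(2) by blast
    qed
    ultimately show "\<exists>j::int. x \<le> of_int j \<and> of_int j \<le> x + real n \<and> coprime_shift I \<alpha> j" by blast
  qed
  \<comment> \<open>\<open>(2, 1)\<close> is the unit ideal, so the shift 1 is admissible for every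
    \<open>I\<close>. Hence some interval has to contain an integer, which excludes negative
    lengths.\<close>
  have adm1: "admissible_shift rr I 1"
  proof -
    have "ideal_of (Idl\<^bsub>rr\<^esub> {2, 1})" using rr.genideal_ideal[of "{2, 1}"] by (simp add: ideal_iff R_closed)
    have "Idl\<^bsub>rr\<^esub> {2, 1} = R"
      unfolding genideal_pair_carrier[OF R_numeral R_1]
      by (intro bexI[of _ 0] bexI[of _ 1]) (auto simp: R_closed)
    hence "\<not> primeideal (Idl\<^bsub>rr\<^esub> {2, 1}) rr" using R_1 by (simp add: primeideal_iff prime_of_def)
    thus ?thesis by (simp add: admissible_shift_def)
  qed
  have pos: "L \<ge> 0" if "G L" for L
  proof -
    have "\<exists>j::int. 0 \<le> real_of_int j \<and> of_int j \<le> 0 + L \<and> coprime_shift I 1 j"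
      using that[unfolded G] adm1 R_1 by blast
    thus ?thesis by auto
  qed
  define L0 where "L0 = Inf {L. G L}"
  have bdd: "bdd_below {L. G L}" using pos by (auto intro!: bdd_belowI[of _ 0])
  have GL0: "G L0" unfolding G
  proof (intro ballI impI allI)
    fix \<alpha> x assume al: "\<alpha> \<in> R" "admissible_shift rr I \<alpha>"
    \<comment> \<open>A valid length this close to \<open>L0\<close> gives an interval that ends
      before the first integer beyond \<open>x + L0\<close>.\<close>
    have "L0 < real_of_int (\<lfloor>x + L0\<rfloor> + 1) - x" by linarith
    then obtain L where L: "G L" "L < real_of_int (\<lfloor>x + L0\<rfloor> + 1) - x"
      using cInf_lessD[of "{L. G L}" "real_of_int (\<lfloor>x + L0\<rfloor> + 1) - x"] Gn unfolding L0_def by blast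
    obtain j :: int where j: "x \<le> of_int j" "of_int j \<le> x + L" "coprime_shift I \<alpha> j"
      using L(1)[unfolded G] al by blast
    have "real_of_int j < real_of_int (\<lfloor>x + L0\<rfloor> + 1)" using j L by linarith
    hence "j \<le> \<lfloor>x + L0\<rfloor>" by linarith
    hence "of_int j \<le> x + L0" by linarith
    thus "\<exists>j::int. x \<le> of_int j \<and> of_int j \<le> x + L0 \<and> coprime_shift I \<alpha> j" using j by blast
  qed
  have "ideal_j rr I = (LEAST L. G L)" by (simp add: ideal_j_def G_def)
  also have "\<dots> = L0"
  proof (rule Least_equality)
    show "G L0" by (rule GL0)
    show "L0 \<le> y" if "G y" for y unfolding L0_def using bdd that by (intro cInf_lower) auto
  qed
  finally have "ideal_j rr I = L0" .
  thus ?thesis using GL0[unfolded G] al by blast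
qed

section \<open>Norms of ideals and finiteness\<close>

lemma carrier_Quot: "carrier (rr Quot I) = (\<lambda>a. I +>\<^bsub>rr\<^esub> a) ` R"
  by (auto simp: FactRing_def A_RCOSETS_def RCOSETS_def a_r_coset_def)

lemma coset_eq: "I +>\<^bsub>rr\<^esub> a = {y + a | y. y \<in> I}"
  by (auto simp: a_r_coset_def r_coset_def)

lemma coset_eq_iff:
  assumes "ideal_of I" "a \<in> R" "b \<in> R"
  shows "I +>\<^bsub>rr\<^esub> a = I +>\<^bsub>rr\<^esub> b \<longleftrightarrow> a - b \<in> I"
proof
  assume e: "I +>\<^bsub>rr\<^esub> a = I +>\<^bsub>rr\<^esub> b"
  have "a = 0 + a \<and> 0 \<in> I" using ideal_of_0 assms by simp
  hence "a \<in> I +>\<^bsub>rr\<^esub> a" unfolding coset_eq by blast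
  then obtain y where "y \<in> I" "a = y + b" using e unfolding coset_eq by blast
  thus "a - b \<in> I" by simp
next
  have sub: "I +>\<^bsub>rr\<^esub> a \<subseteq> I +>\<^bsub>rr\<^esub> b" if "a - b \<in> I" for a b
  proof
    fix x assume "x \<in> I +>\<^bsub>rr\<^esub> a"
    then obtain y where y: "y \<in> I" "x = y + a" by (auto simp: coset_eq)
    hence "x = (y + (a - b)) + b \<and> y + (a - b) \<in> I" using that assms ideal_of_add by simp
    thus "x \<in> I +>\<^bsub>rr\<^esub> b" unfolding coset_eq by blast
  qed
  assume "a - b \<in> I"
  moreover from this have "b - a \<in> I" using ideal_of_uminus[OF assms(1), of "a - b"] by simp
  ultimately show "I +>\<^bsub>rr\<^esub> a = I +>\<^bsub>rr\<^esub> b" using sub by blast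
qed

lemma ideal_norm_le_card:
  assumes I: "ideal_of I" and B: "finite B" "B \<subseteq> R" and red: "\<And>x. x \<in> R \<Longrightarrow> \<exists>y\<in>B. x - y \<in> I"
  shows "finite (carrier (rr Quot I))" "ideal_norm rr I \<le> card B"
proof -
  have sub: "carrier (rr Quot I) \<subseteq> (\<lambda>a. I +>\<^bsub>rr\<^esub> a) ` B"
  proof
    fix X assume "X \<in> carrier (rr Quot I)"
    then obtain x where x: "x \<in> R" "X = I +>\<^bsub>rr\<^esub> x" unfolding carrier_Quot by blast
    obtain y where "y \<in> B" "x - y \<in> I" using red x by blast
    thus "X \<in> (\<lambda>a. I +>\<^bsub>rr\<^esub> a) ` B" using x B coset_eq_iff[OF I, of x y] by blast
  qed
  show "finite (carrier (rr Quot I))" using sub B finite_subset by blast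
  have "card (carrier (rr Quot I)) \<le> card ((\<lambda>a. I +>\<^bsub>rr\<^esub> a) ` B)"
    by (intro card_mono sub finite_imageI B(1))
  also have "\<dots> \<le> card B" by (intro card_image_le B(1))
  finally show "ideal_norm rr I \<le> card B" by (simp add: ideal_norm_def)
qed

text \<open>The two given elements of \<open>I\<close> are in triangular form with respect to 1 and
  \<open>w\<close>, so the lattice they span has index \<open>A * E\<close>.\<close>

lemma ideal_norm_le_triangular:
  assumes I: "ideal_of I" and w: "w \<in> R" "R = {of_int a + of_int b * w | a b. True}"
    and A: "A > 0" "of_int A + of_int x * w \<in> I" and E: "E > 0" "of_int E * w \<in> I"
  shows "finite (carrier (rr Quot I))" "ideal_norm rr I \<le> nat (A * E)"
proof -
  define B where "B = (\<lambda>(a,b). of_int a + of_int b * w) ` ({0..<A} \<times> {0..<E})"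
  have fB: "finite B" "B \<subseteq> R" using w(1) by (auto simp: B_def intro!: R_closed)
  have red: "\<exists>y\<in>B. v - y \<in> I" if v: "v \<in> R" for v
  proof -
    obtain a b where ab: "v = of_int a + of_int b * w" using v unfolding w(2) by auto
    define b' where "b' = b - (a div A) * x"
    define y where "y = of_int (a mod A) + of_int (b' mod E) * w"
    have "y \<in> B" unfolding B_def y_def using A E
      by (auto intro!: image_eqI[of _ _ "(a mod A, b' mod E)"])
    have "v - y = of_int (a div A) * (of_int A + of_int x * w) + of_int (b' div E) * (of_int E * w)"
    proof -
      have "(of_int a :: complex) = of_int A * of_int (a div A) + of_int (a mod A)"
        by (metis mult_div_mod_eq of_int_add of_int_mult)
      moreover have "(of_int b' :: complex) = of_int E * of_int (b' div E) + of_int (b' mod E)"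
        by (metis mult_div_mod_eq of_int_add of_int_mult)
      moreover have "(of_int b :: complex) = of_int b' + of_int (a div A) * of_int x"
        by (simp add: b'_def)
      moreover have "A' * qa + ra + (E' * qb + rb + qa * x') * w - (ra + rb * w) = qa * (A' + x' * w) + qb * (E' * w)"
        for A' E' qa qb ra rb x' :: complex by (simp add: algebra_simps)
      ultimately show ?thesis unfolding y_def ab by (simp only:)
    qed
    moreover have "of_int (a div A) * (of_int A + of_int x * w) + of_int (b' div E) * (of_int E * w) \<in> I"
      using ideal_of_add[OF I] ideal_of_mult[OF I R_of_int A(2)] ideal_of_mult[OF I R_of_int E(2)] by blast
    ultimately have "v - y \<in> I" by simp
    thus ?thesis using \<open>y \<in> B\<close> by blast
  qed
  have "card B \<le> card ({0..<A} \<times> {0..<E})" unfolding B_def by (intro card_image_le) simp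
  also have "\<dots> = nat (A * E)" using A by (simp add: card_cartesian_product nat_mult_distrib)
  finally have "card B \<le> nat (A * E)" .
  thus "finite (carrier (rr Quot I))" "ideal_norm rr I \<le> nat (A * E)"
    using ideal_norm_le_card[OF I fB red] by auto
qed

lemma finite_Quot:
  assumes I: "ideal_of I" "x0 \<in> I" "x0 \<noteq> 0"
  shows "finite (carrier (rr Quot I))"
proof -
  obtain w where w: "w \<in> R" "R = {of_int a + of_int b * w | a b. True}"
    using R_basis by metis
  obtain n :: nat where n: "n > 0" "of_nat n \<in> I" using ideal_of_has_nat I by metis
  show ?thesis
    by (rule ideal_norm_le_triangular(1)[OF I(1) w, of "int n" 0 "int n"])
      (use n I(1) ideal_of_mult'[OF I(1) w(1) n(2)] in auto)
qed

text \<open>Pigeonhole on the classes of the integers from 0 to the norm.\<close>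

lemma ideal_norm_multiple:
  assumes I: "ideal_of I" "x0 \<in> I" "x0 \<noteq> 0"
  obtains k where "1 \<le> k" "k \<le> ideal_norm rr I" "of_nat k \<in> I"
proof -
  define f where "f = (\<lambda>k::nat. I +>\<^bsub>rr\<^esub> of_nat k)"
  have "f ` {0..ideal_norm rr I} \<subseteq> carrier (rr Quot I)"
    unfolding carrier_Quot f_def by (auto simp: R_closed)
  hence "card (f ` {0..ideal_norm rr I}) \<le> ideal_norm rr I"
    unfolding ideal_norm_def using finite_Quot[OF I] by (intro card_mono) auto
  hence "\<not> inj_on f {0..ideal_norm rr I}" by (auto dest: card_image)
  then obtain i j where ij: "i < j" "j \<le> ideal_norm rr I" "f i = f j"
    unfolding inj_on_def by (metis atLeastAtMost_iff linorder_neqE_nat)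
  have "of_nat j - of_nat i \<in> I" using ij(3) coset_eq_iff[OF I(1)] R_of_nat unfolding f_def by metis
  hence "of_nat (j - i) \<in> I" using ij by (simp add: of_nat_diff)
  thus ?thesis using ij by (intro that[of "j - i"]) auto
qed

text \<open>Some positive integer up to the norm lies in \<open>I\<close>, hence so does
  \<open>fact m\<close>. Finiteness is what gives the \<open>Max\<close> in
  \<open>max_ideal_j\<close> its meaning.\<close>

lemma finite_ideals_norm_less: "finite {I. ideal_of I \<and> I \<noteq> {0} \<and> sqrt (real (ideal_norm rr I)) < x}"
proof -
  define m where "m = nat \<lceil>x\<^sup>2\<rceil>"
  have "{I. ideal_of I \<and> I \<noteq> {0} \<and> sqrt (real (ideal_norm rr I)) < x} \<subseteq> {I. ideal_of I \<and> of_nat (fact m) \<in> I}"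
  proof
    fix I assume "I \<in> {I. ideal_of I \<and> I \<noteq> {0} \<and> sqrt (real (ideal_norm rr I)) < x}"
    hence I: "ideal_of I" "I \<noteq> {0}" "sqrt (real (ideal_norm rr I)) < x" by auto
    obtain x0 where x0: "x0 \<in> I" "x0 \<noteq> 0" using I ideal_of_0 by blast
    obtain k where k: "1 \<le> k" "k \<le> ideal_norm rr I" "of_nat k \<in> I" using ideal_norm_multiple I(1) x0 by metis
    have "(sqrt (real (ideal_norm rr I)))\<^sup>2 \<le> x\<^sup>2" using I(3) by (intro power_mono) auto
    hence "real (ideal_norm rr I) \<le> x\<^sup>2" by simp
    hence "ideal_norm rr I \<le> m" unfolding m_def by linarith
    hence "k dvd fact m" using k by (intro dvd_fact) auto
    then obtain l where "fact m = k * l" by auto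
    hence "(of_nat (fact m) :: complex) = of_nat l * of_nat k" by (metis mult.commute of_nat_mult)
    thus "I \<in> {I. ideal_of I \<and> of_nat (fact m) \<in> I}" using I k by (simp add: ideal_of_mult R_closed del: of_nat_fact)
  qed
  thus ?thesis using finite_ideals_of_nat[of "fact m"] finite_subset by (simp del: of_nat_fact) blast
qed

lemma max_ideal_j_works:
  assumes le: "max_ideal_j rr X \<le> J"
    and I: "ideal_of I" "x0 \<in> I" "x0 \<noteq> 0" and n: "sqrt (real (ideal_norm rr I)) < X"
    and np: "\<And>P. prime_of P \<Longrightarrow> principal_of P \<Longrightarrow> \<not> I \<subseteq> P"
    and al: "\<alpha> \<in> R" "admissible_shift rr I \<alpha>"
  shows "\<exists>j::int. x \<le> of_int j \<and> of_int j \<le> x + J \<and> coprime_shift I \<alpha> j"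
proof -
  define S where "S = {ideal_j rr I | I. ideal I rr \<and> I \<noteq> {\<zero>\<^bsub>rr\<^esub>} \<and>
     \<not> (\<exists>P. primeideal P rr \<and> principalideal P rr \<and> ideal_divides rr P I) \<and>
     sqrt (real (ideal_norm rr I)) < X}"
  have "S \<subseteq> ideal_j rr ` {I. ideal_of I \<and> I \<noteq> {0} \<and> sqrt (real (ideal_norm rr I)) < X}"
    unfolding S_def ideal_iff rr_simps by blast
  hence "finite S" using finite_ideals_norm_less finite_subset by blast
  have "\<not> (primeideal P rr \<and> principalideal P rr \<and> ideal_divides rr P I)" for P
    using np[of P] principal_ofI[of P] ideal_divides_subset[of P I] prime_of_ideal[of P]
    by (auto simp: primeideal_iff)
  hence "ideal_j rr I \<in> S" unfolding S_def ideal_iff rr_simps using I n by blast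
  hence "ideal_j rr I \<le> Max S" using \<open>finite S\<close> by simp
  also have "\<dots> \<le> J" using le by (simp add: max_ideal_j_def S_def)
  finally show ?thesis using ideal_j_works[OF I al, of x] by force
qed

end

section \<open>Lattice bases at a cusp\<close>

text \<open>\<open>N\<close> is the index of \<open>R\<close> in the inverse of the cusp ideal,
  hence the norm of the cusp ideal. The polynomial \<open>N X^2 - B X + C\<close> of
  \<open>tau\<close> has the discriminant of \<open>R\<close>, and the conditions on
  \<open>tau\<close> say that it is reduced. \<open>inverse_min\<close> reflects minimality of the
  cusp vector: its nonzero integral multiples by field elements are not shorter.\<close>

locale reduced_cusp = imag_quad_order +
  fixes a0 b0 tau w1 w2 :: complex and N B C :: int
  assumes cusp_in: "a0 \<in> R" "b0 \<in> R"
    and inverse_iff: "x * a0 \<in> R \<and> x * b0 \<in> R \<longleftrightarrow> (\<exists>p q. x = of_int p + of_int q * tau)"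
    and tau_Im: "Im tau > 0"
    and tau_Re: "\<bar>Re tau\<bar> \<le> 1 / 2"
    and tau_cmod: "cmod tau \<ge> 1"
    and inverse_min: "x * a0 \<in> R \<Longrightarrow> x * b0 \<in> R \<Longrightarrow> x \<noteq> 0 \<Longrightarrow> cmod x \<ge> 1"
    and w_in: "w1 * a0 \<in> R" "w1 * b0 \<in> R" "w2 * a0 \<in> R" "w2 * b0 \<in> R"
    and w_det: "a0 * w2 - b0 * w1 = 1"
    and N_pos: "N > 0"
    and tau_eq: "of_int N * tau\<^sup>2 = of_int B * tau - of_int C"
    and R_eq: "R = {of_int p + of_int q * (of_int N * tau) | p q. True}"

context imag_quad_order
begin

text \<open>Hurwitz: the products of \<open>a, b\<close> with their conjugates, divided by the content of the norm form
  of \<open>(a, b)\<close>, have integral trace and norm.\<close>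

lemma inverse_ideal_unimodular:
  assumes ab: "a \<in> R" "b \<in> R" "a \<noteq> 0 \<or> b \<noteq> 0"
  obtains x y where "x * a \<in> R" "x * b \<in> R" "y * a \<in> R" "y * b \<in> R" "a * y - b * x = 1"
proof -
  obtain A1 where A1: "a * cnj a = of_int A1" using R_norm[OF ab(1)] by (auto elim: Ints_cases)
  obtain A3 where A3: "b * cnj b = of_int A3" using R_norm[OF ab(2)] by (auto elim: Ints_cases)
  obtain A2 where A2: "a * cnj b + cnj (a * cnj b) = of_int A2"
    using R_trace[of "a * cnj b"] ab by (auto elim: Ints_cases simp: R_closed)
  define n where "n = gcd A1 (gcd A2 A3)"
  have "A1 \<noteq> 0 \<or> A3 \<noteq> 0" using A1 A3 ab(3) by auto
  hence n0: "n \<noteq> 0" by (auto simp: n_def)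
  have dvd: "n dvd A1" "n dvd A2" "n dvd A3" by (auto simp: n_def intro: dvd_trans[OF gcd_dvd2])
  obtain u v where uv: "u * A1 + v * gcd A2 A3 = n" using bezout_int unfolding n_def by metis
  obtain u' v' where uv': "u' * A2 + v' * A3 = gcd A2 A3" using bezout_int by metis
  define X Y Z where "X = u" "Y = v * u'" "Z = v * v'"
  have "X * A1 + Y * A2 + Z * A3 = n" using uv uv'[symmetric] by (simp add: X_Y_Z_def algebra_simps)
  hence bez: "of_int X * (a * cnj a) + of_int Y * (a * cnj b + cnj a * b) + of_int Z * (b * cnj b) = (of_int n :: complex)"
    unfolding A1 A3 using A2 by (metis complex_cnj_mult complex_cnj_cnj of_int_add of_int_mult)
  have dI: "of_int k / of_int n \<in> (\<int> :: complex set)" if dk: "n dvd k" for k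
  proof -
    obtain m where "k = n * m" using dk by auto
    thus ?thesis using n0 by simp
  qed
  have e1: "a * cnj a / of_int n \<in> R" "b * cnj b / of_int n \<in> R"
    using dI[of A1] dI[of A3] dvd Ints_subset_R by (auto simp: A1 A3)
  have e2: "a * cnj b / of_int n \<in> R"
  proof (rule R_maximal)
    have "a * cnj b / of_int n + cnj (a * cnj b / of_int n) = (a * cnj b + cnj (a * cnj b)) / of_int n"
      by (simp add: add_divide_distrib)
    thus "a * cnj b / of_int n + cnj (a * cnj b / of_int n) \<in> \<int>" using dI[of A2] dvd by (simp only: A2)
    have "a * cnj b / of_int n * cnj (a * cnj b / of_int n) = ((a * cnj a) / of_int n) * ((b * cnj b) / of_int n)"
      by (simp add: mult_ac)
    also have "\<dots> \<in> \<int>" unfolding A1 A3 using dI dvd by (intro Ints_mult) auto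
    finally show "a * cnj b / of_int n * cnj (a * cnj b / of_int n) \<in> \<int>" .
  qed (use ab n0 in \<open>auto intro!: R_closed\<close>)
  have e3: "cnj a * b / of_int n \<in> R" using R_cnj[OF e2] by simp
  define y where "y = (of_int X * cnj a + of_int Y * cnj b) / of_int n"
  define x where "x = - (of_int Y * cnj a + of_int Z * cnj b) / of_int n"
  have "y * a = of_int X * (a * cnj a / of_int n) + of_int Y * (a * cnj b / of_int n)"
    by (simp add: y_def add_divide_distrib algebra_simps)
  hence 1: "y * a \<in> R" using e1 e2 by (simp only: R_closed)
  have "y * b = of_int X * (cnj a * b / of_int n) + of_int Y * (b * cnj b / of_int n)"
    by (simp add: y_def add_divide_distrib algebra_simps)
  hence 2: "y * b \<in> R" using e1 e3 by (simp only: R_closed)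
  have "x * a = - (of_int Y * (a * cnj a / of_int n) + of_int Z * (a * cnj b / of_int n))"
    by (simp add: x_def add_divide_distrib diff_divide_distrib algebra_simps)
  hence 3: "x * a \<in> R" using e1 e2 by (simp only: R_closed)
  have "x * b = - (of_int Y * (cnj a * b / of_int n) + of_int Z * (b * cnj b / of_int n))"
    by (simp add: x_def add_divide_distrib diff_divide_distrib algebra_simps)
  hence 4: "x * b \<in> R" using e1 e3 by (simp only: R_closed)
  have "a * y - b * x = (of_int X * (a * cnj a) + of_int Y * (a * cnj b + cnj a * b) + of_int Z * (b * cnj b)) / of_int n"
    by (simp add: x_def y_def add_divide_distrib diff_divide_distrib algebra_simps)
  also have "\<dots> = 1" unfolding bez using n0 by simp
  finally show ?thesis using that 1 2 3 4 by blast
qed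

text \<open>An element of the inverse ideal with least positive imaginary part, translated by an
  integer, serves as \<open>tau\<close>. It forms a basis with 1, because a real element of the
  inverse ideal has a fractional part of modulus below 1, which \<open>min\<close> forces to be 0.
  Expanding \<open>w * tau\<close> in this basis gives the quadratic equation.\<close>

lemma reduced_cusp_exists:
  assumes ab: "a \<in> R" "b \<in> R" "a \<noteq> 0 \<or> b \<noteq> 0"
    and min: "\<And>x. x * a \<in> R \<Longrightarrow> x * b \<in> R \<Longrightarrow> x \<noteq> 0 \<Longrightarrow> cmod x \<ge> 1"
  shows "\<exists>tau w1 w2 N B C. reduced_cusp R a b tau w1 w2 N B C"
proof -
  define I where "I = {x. x * a \<in> R \<and> x * b \<in> R}"
  have Iadd: "x \<in> I \<Longrightarrow> y \<in> I \<Longrightarrow> x + y \<in> I" and Imult: "z \<in> R \<Longrightarrow> x \<in> I \<Longrightarrow> z * x \<in> I"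
    and RI: "z \<in> R \<Longrightarrow> z \<in> I" for x y z
    by (auto simp: I_def distrib_right mult.assoc R_closed ab)
  have Idiff: "x \<in> I \<Longrightarrow> y \<in> I \<Longrightarrow> x - y \<in> I" for x y
    using Iadd[of x "-y"] Imult[of "-1" y] by (simp add: R_closed)
  obtain w0 where w0: "w0 \<in> R" "Im w0 > 0" "R = {of_int a + of_int b * w0 | a b. True}"
    "\<And>x. x \<in> R \<Longrightarrow> \<exists>b::int. Im x = of_int b * Im w0" by (rule R_basis) blast
  define c where "c = (if a \<noteq> 0 then a else b)"
  have c: "c \<in> R" "c \<noteq> 0" "\<And>x. x \<in> I \<Longrightarrow> x * c \<in> R" using ab by (auto simp: c_def I_def)
  obtain n :: nat where n: "(cmod c)\<^sup>2 = real n" "c * cnj c = of_nat n" using R_cmod_sq c(1) by metis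
  have n0: "n > 0" using n(1) c(2) by (intro gr0I) simp
  \<comment> \<open>Multiplication by \<open>n = |c|^2\<close> maps the inverse ideal into
    \<open>R\<close>, so its imaginary parts are discrete.\<close>
  have nI: "\<exists>k::int. real n * Im x = of_int k * Im w0" if "x \<in> I" for x
  proof -
    have "(x * c) * cnj c \<in> R" using c(1) c(3)[OF that] by (rule_tac R_mult[OF _ R_cnj])
    moreover have "(x * c) * cnj c = of_nat n * x" using n(2) by (simp add: mult_ac)
    ultimately show ?thesis using w0(4)[of "of_nat n * x"] by simp
  qed
  define S where "S = {k::nat. k > 0 \<and> (\<exists>x\<in>I. real n * Im x = real k * Im w0)}"
  have "n \<in> S" using n0 RI[OF w0(1)] by (auto simp: S_def)
  define k0 where "k0 = (LEAST k. k \<in> S)"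
  have "k0 \<in> S" unfolding k0_def using \<open>n \<in> S\<close> by (rule LeastI)
  then obtain x0 where x0: "k0 > 0" "x0 \<in> I" "real n * Im x0 = real k0 * Im w0" by (auto simp: S_def)
  define tau where "tau = x0 - of_int (round (Re x0))"
  have tauI: "tau \<in> I" using x0 RI[OF R_of_int] Idiff by (simp add: tau_def)
  have tauIm: "real n * Im tau = real k0 * Im w0" using x0 by (simp add: tau_def)
  have tau_pos: "Im tau > 0"
  proof -
    have "real n * Im tau > 0" using tauIm x0 w0 by simp
    thus ?thesis using n0 by (simp add: zero_less_mult_iff)
  qed
  have tau_Re: "\<bar>Re tau\<bar> \<le> 1/2" using of_int_round_abs_le[of "Re x0"] by (simp add: tau_def abs_minus_commute)
  have min': "cmod x \<ge> 1" if "x \<in> I" "x \<noteq> 0" for x using min that by (auto simp: I_def)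
  have "tau \<noteq> 0" using tau_pos by auto
  hence tau_cmod: "cmod tau \<ge> 1" using min'[OF tauI] by blast
  have Ireal: "\<exists>p. x = of_int p" if x: "x \<in> I" "Im x = 0" for x
  proof -
    define y where "y = x - of_int \<lfloor>Re x\<rfloor>"
    have yI: "y \<in> I" unfolding y_def using x RI[OF R_of_int] Idiff by simp
    have "y = complex_of_real (Re x - of_int \<lfloor>Re x\<rfloor>)" using x by (simp add: y_def complex_eq_iff)
    hence "cmod y = \<bar>Re x - of_int \<lfloor>Re x\<rfloor>\<bar>" by (metis norm_of_real real_norm_def)
    hence "cmod y < 1" by linarith
    hence "y = 0" using min'[OF yI] by auto
    thus ?thesis by (auto simp: y_def)
  qed
  have Imain: "\<exists>p q. x = of_int p + of_int q * tau" if x: "x \<in> I" for x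
  proof -
    obtain k where k: "real n * Im x = of_int k * Im w0" using nI x by blast
    define q where "q = k div int k0"
    define y where "y = x - of_int q * tau"
    have yI: "y \<in> I" unfolding y_def using x tauI Imult[OF R_of_int] Idiff by simp
    have "real n * Im y = of_int (k - q * int k0) * Im w0"
      using k tauIm by (simp add: y_def algebra_simps)
    hence yIm: "real n * Im y = of_int (k mod int k0) * Im w0"
      by (simp add: q_def minus_div_mult_eq_mod)
    have "k mod int k0 = 0"
    proof (rule ccontr)
      assume "k mod int k0 \<noteq> 0"
      moreover have "k mod int k0 \<ge> 0" using x0(1) by simp
      ultimately have pos: "k mod int k0 > 0" by linarith
      hence "nat (k mod int k0) \<in> S" using yI yIm by (auto simp: S_def)
      hence "k0 \<le> nat (k mod int k0)" unfolding k0_def by (rule Least_le)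
      moreover have "k mod int k0 < int k0" using x0(1) by simp
      ultimately show False using pos by linarith
    qed
    hence "Im y = 0" using yIm n0 by simp
    then obtain p where "y = of_int p" using Ireal yI by blast
    hence "x = of_int p + of_int q * tau" by (simp add: y_def algebra_simps)
    thus ?thesis by blast
  qed
  have I_iff: "x \<in> I \<longleftrightarrow> (\<exists>p q. x = of_int p + of_int q * tau)" for x
    using Imain Iadd[OF RI[OF R_of_int] Imult[OF R_of_int tauI]] by blast
  \<comment> \<open>\<open>w0\<close> lies in the inverse ideal, and its coordinate at
    \<open>tau\<close> is the index of \<open>R\<close> there.\<close>
  obtain p0 N where pN: "w0 = of_int p0 + of_int N * tau" using Imain[OF RI[OF w0(1)]] by blast
  have "Im w0 = of_int N * Im tau" using pN by simp
  hence Npos: "N > 0" using w0(2) tau_pos by (simp add: zero_less_mult_iff)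
  define w where "w = of_int N * tau"
  have wR: "w \<in> R" using pN w0(1) R_diff[OF w0(1) R_of_int, of p0] by (simp add: w_def)
  have Req: "R = {of_int p + of_int q * (of_int N * tau) | p q. True}"
  proof
    show "R \<subseteq> {of_int p + of_int q * (of_int N * tau) | p q. True}"
    proof
      fix x assume "x \<in> R"
      then obtain p q where "x = of_int p + of_int q * w0" using w0(3) by auto
      hence "x = of_int (p + q * p0) + of_int q * (of_int N * tau)" using pN by (simp add: algebra_simps)
      thus "x \<in> {of_int p + of_int q * (of_int N * tau) | p q. True}" by blast
    qed
    show "{of_int p + of_int q * (of_int N * tau) | p q. True} \<subseteq> R"
      using wR by (auto simp: w_def intro!: R_closed)
  qed
  obtain B where B: "w + cnj w = of_int B" using R_trace[OF wR] by (auto elim: Ints_cases)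
  obtain E where E: "w * cnj w = of_int E" using R_norm[OF wR] by (auto elim: Ints_cases)
  have w2: "w * w = of_int B * w - of_int E" unfolding B[symmetric] E[symmetric] by (simp add: algebra_simps)
  obtain p q where pq: "w * tau = of_int p + of_int q * tau" using Imain Imult[OF wR tauI] by blast
  have "of_int N * (of_int p + of_int q * tau) = w * w" unfolding pq[symmetric] by (simp add: w_def mult_ac)
  hence eq: "of_int N * (of_int p + of_int q * tau) = of_int B * w - of_int E"
    by (simp only: w2)
  have "of_int N * (of_int q * Im tau) = of_int B * (of_int N * Im tau)"
    using arg_cong[OF eq, of Im] by (simp add: w_def)
  hence qB: "q = B" using Npos tau_pos by simp
  have "of_int N * tau\<^sup>2 = of_int B * tau - of_int (- p)"
  proof -
    have "of_int N * tau\<^sup>2 = w * tau" by (simp add: w_def power2_eq_square mult_ac)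
    thus ?thesis unfolding pq qB by simp
  qed
  moreover obtain w1 w2 where "w1 * a \<in> R" "w1 * b \<in> R" "w2 * a \<in> R" "w2 * b \<in> R" "a * w2 - b * w1 = 1"
    by (rule inverse_ideal_unimodular[OF ab]) blast
  moreover have I_iff': "x * a \<in> R \<and> x * b \<in> R \<longleftrightarrow> (\<exists>p q. x = of_int p + of_int q * tau)" for x
    using I_iff[of x] unfolding I_def by (simp only: mem_Collect_eq)
  ultimately have "reduced_cusp R a b tau w1 w2 N B (-p)"
    by (intro reduced_cusp.intro reduced_cusp_axioms.intro imag_quad_order_axioms ab(1,2) I_iff' tau_pos
        tau_Re tau_cmod min Npos Req)
  thus ?thesis by blast
qed

end

context reduced_cusp
begin

section \<open>The reduced form with coefficients \<open>N\<close>, \<open>B\<close>,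
  \<open>C\<close>\<close>

definition om :: complex where "om = of_int N * tau"

lemma om_R: "om \<in> R"
proof -
  have "om = of_int 0 + of_int 1 * (of_int N * tau)" by (simp add: om_def)
  thus ?thesis unfolding R_eq by blast
qed

lemma R_eq_om: "R = {of_int p + of_int q * om | p q. True}"
  using R_eq by (simp add: om_def)

lemma om_sq: "om * om = of_int B * om - of_int (N * C)"
proof -
  have "om * om = of_int N * (of_int N * tau\<^sup>2)" by (simp add: om_def power2_eq_square)
  thus ?thesis unfolding tau_eq by (simp add: om_def algebra_simps)
qed

lemma om_tau: "om * tau = of_int B * tau - of_int C"
  using tau_eq by (simp add: om_def power2_eq_square mult_ac)

lemma om_Im: "Im om = of_int N * Im tau" "Im om > 0"
  using N_pos tau_Im by (simp_all add: om_def)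

lemma om_trace: "om + cnj om = of_int B"
  and om_norm: "om * cnj om = of_int (N * C)"
proof -
  obtain x where x: "om + cnj om = of_int x" using R_trace[OF om_R] by (auto elim: Ints_cases)
  obtain y where y: "om * cnj om = of_int y" using R_norm[OF om_R] by (auto elim: Ints_cases)
  have "om * om = (om + cnj om) * om - om * cnj om" by (simp add: algebra_simps)
  hence eq: "of_int B * om - of_int (N * C) = of_int x * om - of_int y" using om_sq x y by simp
  have "of_int B * Im om = of_int x * Im om" using arg_cong[OF eq, of Im] by simp
  hence "B = x" using om_Im(2) by simp
  moreover from this have "(of_int (N * C) :: complex) = of_int y" using eq by simp
  hence "N * C = y" by (simp only: of_int_eq_iff)
  ultimately show "om + cnj om = of_int B" "om * cnj om = of_int (N * C)" using x y by auto
qed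

lemma cnj_om: "cnj om = of_int B - om"
  using om_trace by (simp add: algebra_simps)

lemma om_basis_unique:
  assumes "of_int p + of_int q * om = of_int p' + of_int q' * om"
  shows "p = p'" "q = q'"
proof -
  have "of_int q * Im om = of_int q' * Im om" using arg_cong[OF assms, of Im] by simp
  thus "q = q'" using om_Im(2) by simp
  thus "p = p'" using assms by simp
qed

lemma om_cmod: "(cmod om)\<^sup>2 = of_int (N * C)"
proof -
  have "complex_of_real ((cmod om)\<^sup>2) = complex_of_real (of_int (N * C))"
    using om_norm by (metis complex_norm_square of_real_of_int_eq)
  thus ?thesis by (simp only: of_real_eq_iff)
qed

lemma tau_cmod_sq: "of_int N * (cmod tau)\<^sup>2 = of_int C"
proof -
  have "of_int N * (of_int N * (cmod tau)\<^sup>2) = real_of_int N * of_int C"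
    using om_cmod N_pos by (simp add: om_def norm_mult power_mult_distrib power2_eq_square mult_ac)
  thus ?thesis using N_pos by simp
qed

lemma N_le_C: "N \<le> C"
proof -
  have "(cmod tau)\<^sup>2 \<ge> 1\<^sup>2" using tau_cmod by (intro power_mono) auto
  hence "of_int N * (cmod tau)\<^sup>2 \<ge> of_int N * 1" using N_pos by (intro mult_left_mono) auto
  thus ?thesis using tau_cmod_sq by simp
qed

lemma C_pos: "C > 0" using N_le_C N_pos by simp

lemma B_le_N: "\<bar>B\<bar> \<le> N"
proof -
  have "2 * Re om = of_int B" using arg_cong[OF om_trace, of Re] by simp
  hence "of_int \<bar>B\<bar> = \<bar>2 * Re om\<bar>" by simp
  also have "\<dots> = 2 * (of_int N * \<bar>Re tau\<bar>)" using N_pos by (simp add: om_def abs_mult)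
  also have "\<dots> \<le> 2 * (of_int N * (1 / 2))" using tau_Re N_pos by (intro mult_left_mono) auto
  finally have "real_of_int \<bar>B\<bar> \<le> of_int N" by simp
  thus ?thesis by linarith
qed

text \<open>The square root of the absolute discriminant, see \<open>s_sq\<close>.\<close>

definition s :: real where "s = 2 * Im om"

lemma s_pos: "s > 0" using om_Im by (simp add: s_def)

lemma s_sq: "s\<^sup>2 = of_int (4 * (N * C) - B\<^sup>2)"
proof -
  have "2 * Re om = of_int B" using arg_cong[OF om_trace, of Re] by simp
  hence "of_int (B\<^sup>2) = (2 * Re om)\<^sup>2" by simp
  hence "of_int (B\<^sup>2) = 4 * (Re om)\<^sup>2" by (simp only: power_mult_distrib) simp
  moreover have "(Re om)\<^sup>2 + (Im om)\<^sup>2 = of_int (N * C)" using om_cmod by (simp add: cmod_power2)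
  ultimately show ?thesis by (simp add: s_def power_mult_distrib)
qed

text \<open>Reducedness gives \<open>B^2 \<le> N^2 \<le> N * C\<close>; this is the usual bound of
  the outer coefficients by the discriminant.\<close>

lemma NC_le: "3 * (N * C) \<le> 4 * (N * C) - B\<^sup>2"
proof -
  have "B\<^sup>2 \<le> N\<^sup>2" using abs_le_square_iff[of B N] B_le_N N_pos by simp
  also have "\<dots> \<le> N * C" using N_le_C N_pos by (simp add: power2_eq_square)
  finally show ?thesis by linarith
qed

lemma div_om_in_R:
  assumes "q > 0" "int q dvd B" "(int q)\<^sup>2 dvd N * C"
  shows "om / of_nat q \<in> R"
proof (rule R_maximal[OF om_R R_of_nat])
  show "(of_nat q :: complex) \<noteq> 0" using assms by simp
  obtain b where b: "B = int q * b" using assms by auto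
  obtain c where c: "N * C = (int q)\<^sup>2 * c" using assms by auto
  have "om / of_nat q + cnj (om / of_nat q) = (om + cnj om) / of_nat q" by (simp add: add_divide_distrib)
  also have "\<dots> = of_int b" unfolding om_trace b using assms by simp
  finally show "om / of_nat q + cnj (om / of_nat q) \<in> \<int>" by simp
  have "om / of_nat q * cnj (om / of_nat q) = (om * cnj om) / (of_nat q)\<^sup>2" by (simp add: power2_eq_square)
  also have "\<dots> = of_int c" unfolding om_norm c using assms by simp
  finally show "om / of_nat q * cnj (om / of_nat q) \<in> \<int>" by simp
qed

text \<open>This is maximality of \<open>R\<close>: under these divisibilities \<open>om / q\<close>
  would be integral, but its coordinate at \<open>om\<close> is \<open>1 / q\<close>.\<close>

lemma not_square_dvd:
  assumes "prime q" "int q dvd B" "(int q)\<^sup>2 dvd N * C"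
  shows False
proof -
  have q: "q > 1" using assms prime_gt_1_nat by blast
  obtain p k where pk: "om / of_nat q = of_int p + of_int k * om"
    using div_om_in_R[OF _ assms(2,3)] q R_eq_om by auto
  have "Im om / of_nat q = of_int k * Im om" using arg_cong[OF pk, of Im] by simp
  hence "of_int (k * int q) * Im om = 1 * Im om" using q by (simp add: field_simps)
  hence "of_int (k * int q) = (1::real)" using om_Im(2) by (simp only: mult_right_cancel[OF less_imp_neq[OF om_Im(2), symmetric]])
  hence "k * int q = 1" by (simp only: of_int_eq_1_iff)
  hence "int q dvd 1" by (metis dvd_triv_right)
  thus False using q by simp
qed

lemma prime_not_dvd_NBC:
  assumes "prime q" "int q dvd N" "int q dvd B" "int q dvd C"
  shows False
  using not_square_dvd[of q] assms by (auto simp: power2_eq_square intro: mult_dvd_mono)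

text \<open>The primes dividing \<open>g\<close> divide the discriminant; at them the cusp ideal
  fails to be prime to its conjugate. By \<open>not_square_dvd\<close> they do not divide
  \<open>N'\<close>.\<close>

definition g :: int where "g = gcd N B"
definition N' :: int where "N' = N div g"
definition B' :: int where "B' = B div g"

lemma g_pos: "g > 0" using N_pos by (simp add: g_def)
lemma N_eq: "N = g * N'" by (simp add: N'_def g_def)
lemma B_eq: "B = g * B'" by (simp add: B'_def g_def)
lemma N'_pos: "N' > 0" by (rule zero_less_mult_pos[of g]) (use N_pos N_eq g_pos in simp_all)

lemma coprime_N'_B': "coprime N' B'"
  using div_gcd_coprime[of N B] N_pos by (simp add: N'_def B'_def g_def)

lemma prime_dvd_N'_g:
  assumes "prime q" "int q dvd N'" "int q dvd g"
  shows False
proof -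
  have "g dvd B" by (simp add: g_def)
  hence "int q dvd B" using assms(3) dvd_trans by blast
  moreover have "int q * int q dvd g * N'" using mult_dvd_mono[OF assms(3,2)] .
  hence "int q * int q dvd N" using N_eq by metis
  hence "(int q)\<^sup>2 dvd N * C" by (simp add: power2_eq_square)
  ultimately show False using not_square_dvd assms(1) by blast
qed

lemma prime_dvd_N'_B:
  assumes "prime q" "int q dvd N'" "int q dvd B"
  shows False
proof -
  have "int q dvd N" using dvd_mult[OF assms(2), of g] N_eq by metis
  hence "int q dvd g" using assms by (simp add: g_def)
  thus False using prime_dvd_N'_g assms by blast
qed

lemma coprimeI_prime_nat:
  assumes "\<And>q::nat. prime q \<Longrightarrow> int q dvd x \<Longrightarrow> int q dvd y \<Longrightarrow> False"
  shows "coprime x (y::int)"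
proof (rule ccontr)
  assume "\<not> coprime x y"
  hence "gcd x y \<noteq> 1" by (simp add: coprime_iff_gcd_eq_1)
  hence "nat (gcd x y) \<noteq> 1" by (metis gcd_ge_0_int nat_eq_iff of_nat_1 zero_neq_one)
  then obtain q where q: "prime q" "q dvd nat (gcd x y)" using prime_factor_nat by blast
  hence "int q dvd gcd x y" by (metis gcd_ge_0_int int_dvd_int_iff int_nat_eq)
  thus False using assms q by auto
qed

lemma coprime_N'_B: "coprime N' B"
  by (rule coprimeI_prime_nat) (use prime_dvd_N'_B in blast)

lemma g_dvd_disc: "g dvd 4 * (N * C) - B\<^sup>2"
  by (simp add: g_def power2_eq_square dvd_diff dvd_mult dvd_mult2)

end

section \<open>Rows of lattice points over a cusp\<close>

definition hform :: "complex \<Rightarrow> real \<Rightarrow> complex \<Rightarrow> complex \<Rightarrow> real" where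
  "hform z t a b = (cmod (b * z - a))\<^sup>2 + (cmod b)\<^sup>2 * t\<^sup>2"

lemma hform_nonneg: "hform z t a b \<ge> 0"
  by (simp add: hform_def)

lemma hform_scale: "hform z t (c * a) (c * b) = (cmod c)\<^sup>2 * hform z t a b"
proof -
  have "c * b * z - c * a = c * (b * z - a)" by (simp add: algebra_simps)
  hence "cmod (c * b * z - c * a) = cmod c * cmod (b * z - a)" by (simp only: norm_mult)
  thus ?thesis unfolding hform_def by (simp only: norm_mult power_mult_distrib distrib_left mult.assoc)
qed

text \<open>Cauchy-Schwarz with its defect, for the inner product with weights 1 and
  \<open>t^2\<close>. It will split \<open>hform\<close> orthogonally along the cusp vector.\<close>

lemma lagrange_identity:
  fixes p q u v :: complex and t :: real
  shows "((cmod p)\<^sup>2 + (cmod u)\<^sup>2 * t\<^sup>2) * ((cmod q)\<^sup>2 + (cmod v)\<^sup>2 * t\<^sup>2)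
    = (cmod (p * cnj q + u * cnj v * of_real (t\<^sup>2)))\<^sup>2 + t\<^sup>2 * (cmod (p * v - u * q))\<^sup>2"
proof -
  have "complex_of_real (((cmod p)\<^sup>2 + (cmod u)\<^sup>2 * t\<^sup>2) * ((cmod q)\<^sup>2 + (cmod v)\<^sup>2 * t\<^sup>2))
    = complex_of_real ((cmod (p * cnj q + u * cnj v * of_real (t\<^sup>2)))\<^sup>2 + t\<^sup>2 * (cmod (p * v - u * q))\<^sup>2)"
    unfolding of_real_add of_real_mult complex_norm_square
    by (simp add: algebra_simps power2_eq_square)
  thus ?thesis by (simp only: of_real_eq_iff)
qed

context imag_quad_order
begin

lemma cmod_prime_generator:
  assumes "p \<in> R" "prime_of ((*) p ` R)" "x \<in> (*) p ` R" "x \<noteq> 0"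
  shows "cmod p > 1"
proof -
  have "p \<noteq> 0" using assms by auto
  hence "cmod p \<ge> 1" using R_cmod_ge_1 assms by blast
  moreover have "cmod p \<noteq> 1"
  proof
    assume "cmod p = 1"
    hence "1 = p * cnj p" using R_unit assms by simp
    hence "1 \<in> (*) p ` R" using R_cnj assms by blast
    thus False using prime_of_1 assms by blast
  qed
  ultimately show ?thesis by simp
qed

text \<open>\<open>max_ideal_j\<close> speaks only of ideals without principal prime divisors. Take
  \<open>c\<close> of maximal modulus among the elements that divide \<open>d\<close> and lie in
  principal primes only; if a principal prime \<open>(p)\<close> still contained \<open>a\<close>,
  then \<open>c * p\<close> would be larger. Nonprincipal primes containing \<open>d\<close> also
  contain \<open>a\<close>.\<close>

lemma remove_principal_primes:
  assumes d: "ideal_of d" "y0 \<in> d" "y0 \<noteq> 0"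
  obtains c a where "c \<in> R" "c \<noteq> 0" "\<And>P. prime_of P \<Longrightarrow> c \<in> P \<Longrightarrow> principal_of P"
    "ideal_of a" "d = (*) c ` a" "\<And>P. prime_of P \<Longrightarrow> principal_of P \<Longrightarrow> \<not> a \<subseteq> P"
proof -
  define G where "G = {c \<in> R. c \<noteq> 0 \<and> (\<forall>P. prime_of P \<longrightarrow> c \<in> P \<longrightarrow> principal_of P) \<and> d \<subseteq> (*) c ` R}"
  have "d \<subseteq> (*) 1 ` R" using d ideal_of_R by (auto simp: image_iff)
  hence "1 \<in> G" using prime_of_1 by (auto simp: G_def R_1)
  have "G \<subseteq> {c \<in> R. cmod c \<le> cmod y0}"
  proof
    fix c assume c: "c \<in> G"
    then obtain b where b: "b \<in> R" "y0 = c * b" using d by (auto simp: G_def)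
    hence "cmod b \<ge> 1" using R_cmod_ge_1 d by auto
    hence "cmod c * 1 \<le> cmod c * cmod b" by (intro mult_left_mono) auto
    thus "c \<in> {c \<in> R. cmod c \<le> cmod y0}" using c b by (simp add: G_def norm_mult)
  qed
  hence "finite G" using finite_R_ball finite_subset by blast
  hence "finite (cmod ` G)" "cmod ` G \<noteq> {}" using \<open>1 \<in> G\<close> by auto
  from Max_in[OF this] obtain c where c: "c \<in> G" "cmod c = Max (cmod ` G)" by auto
  have max: "cmod c' \<le> cmod c" if "c' \<in> G" for c'
    using that c(2) \<open>finite (cmod ` G)\<close> by simp
  define a where "a = {y \<in> R. c * y \<in> d}"
  have cG: "c \<in> R" "c \<noteq> 0" "\<And>P. prime_of P \<Longrightarrow> c \<in> P \<Longrightarrow> principal_of P" "d \<subseteq> (*) c ` R"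
    using c(1) by (auto simp: G_def)
  have ia: "ideal_of a" unfolding ideal_of_def
  proof (intro conjI ballI)
    show "0 \<in> a" using ideal_of_0 d by (simp add: a_def R_0)
    show "a \<subseteq> R" by (auto simp: a_def)
    show "x + y \<in> a" if "x \<in> a" "y \<in> a" for x y
      using that ideal_of_add[OF d(1), of "c * x" "c * y"] by (simp add: a_def R_add distrib_left)
    show "x * y \<in> a" if "x \<in> R" "y \<in> a" for x y
      using that ideal_of_mult[OF d(1), of x "c * y"] by (simp add: a_def R_mult mult.left_commute)
  qed
  have da: "d = (*) c ` a" using cG(4) by (auto simp: a_def)
  have "\<not> a \<subseteq> P" if P: "prime_of P" "principal_of P" for P
  proof
    assume aP: "a \<subseteq> P"
    obtain p where p: "p \<in> R" "P = (*) p ` R" using P by (auto simp: principal_of_def)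
    obtain y1 where y1: "y1 \<in> a" "y0 = c * y1" using da d by blast
    have y1': "y1 \<in> P" "y1 \<noteq> 0" using y1 aP d by auto
    have p0: "p \<noteq> 0" using y1' p by auto
    have "c * p \<in> G" unfolding G_def
    proof (intro CollectI conjI allI impI)
      show "c * p \<in> R" using cG p R_mult by blast
      show "c * p \<noteq> 0" using cG p0 by simp
      show "d \<subseteq> (*) (c * p) ` R"
      proof
        fix y assume "y \<in> d"
        then obtain y' where "y' \<in> a" "y = c * y'" using da by blast
        moreover from this obtain r where "r \<in> R" "y' = p * r" using aP p by blast
        ultimately show "y \<in> (*) (c * p) ` R" by (auto simp: mult.assoc)
      qed
      fix Q assume Q: "prime_of Q" "c * p \<in> Q"
      then consider "c \<in> Q" | "p \<in> Q" using prime_of_mult cG(1) p(1) by blast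
      thus "principal_of Q"
      proof cases
        case 1
        thus ?thesis using cG(3) Q by blast
      next
        case 2
        hence "P \<subseteq> Q" using p ideal_of_mult'[OF prime_of_ideal[OF Q(1)]] by auto
        hence "Q = P" using prime_of_maximal Q(1) P(1) y1' by blast
        thus ?thesis using P by simp
      qed
    qed
    hence "cmod (c * p) \<le> cmod c" by (rule max)
    moreover have "cmod p > 1" using cmod_prime_generator[of p y1] p P y1' by simp
    ultimately show False using cG(2) by (simp add: norm_mult)
  qed
  thus ?thesis using that[OF cG(1-3) ia da] by blast
qed

lemma not_splits_if_prime_2:
  assumes "prime_of ((*) 2 ` R)"
  shows "\<not> splits_in 2 rr"
proof
  assume "splits_in 2 rr"
  then obtain P Q where PQ: "prime_of P" "prime_of Q" "P \<noteq> Q" "(*) 2 ` R = P \<cdot>\<^bsub>rr\<^esub> Q"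
    by (auto simp: splits_in_def primeideal_iff PIdl_eq)
  have "(*) 2 ` R \<subseteq> P \<inter> Q"
    unfolding PQ(4) using ring.ideal_prod_inter[OF cring.axioms(1)[OF cring_rr]] PQ prime_of_ideal
    by (simp add: ideal_iff)
  moreover have "2 \<in> (*) 2 ` R" using R_1 by (auto intro!: image_eqI[of _ _ 1])
  ultimately have "P = (*) 2 ` R" "Q = (*) 2 ` R"
    using prime_of_maximal[OF PQ(1) assms, of 2] prime_of_maximal[OF PQ(2) assms, of 2] by auto
  thus False using PQ(3) by simp
qed

text \<open>If 2 divides \<alpha>, then \<open>(2, \<alpha>) = (2)\<close>, which is not prime when
  2 splits. Making \<alpha> even whenever \<open>I\<close> is even is how the rows below meet the
  exception at 2.\<close>

lemma admissible_shiftI: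
  assumes I: "ideal_of I" and al: "\<alpha> \<in> R" and ev: "I \<subseteq> (*) 2 ` R \<Longrightarrow> \<alpha> \<in> (*) 2 ` R"
  shows "admissible_shift rr I \<alpha>"
  unfolding admissible_shift_def
proof (intro impI notI)
  assume dv: "ideal_divides rr (PIdl\<^bsub>rr\<^esub> 2) I"
    and "primeideal (Idl\<^bsub>rr\<^esub> {2, \<alpha>}) rr \<and> splits_in 2 rr"
  hence pr: "prime_of (Idl\<^bsub>rr\<^esub> {2, \<alpha>})" and sp: "splits_in 2 rr" by (auto simp: primeideal_iff)
  have "I \<subseteq> (*) 2 ` R" using ideal_divides_subset[OF dv] ideal_of_scaled[OF R_numeral] by (simp add: PIdl_eq)
  hence a2: "\<alpha> \<in> (*) 2 ` R" by (rule ev)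
  have "Idl\<^bsub>rr\<^esub> {2, \<alpha>} = (*) 2 ` R"
  proof
    show "Idl\<^bsub>rr\<^esub> {2, \<alpha>} \<subseteq> (*) 2 ` R" unfolding genideal_pair[OF R_numeral al]
    proof
      fix u assume "u \<in> {x * 2 + y * \<alpha> |x y. x \<in> R \<and> y \<in> R}"
      then obtain x y where xy: "u = x * 2 + y * \<alpha>" "x \<in> R" "y \<in> R" by blast
      obtain c where c: "c \<in> R" "\<alpha> = 2 * c" using a2 by blast
      have "u = 2 * (x + y * c)" using xy c by (simp add: algebra_simps)
      moreover have "x + y * c \<in> R" using xy c by (intro R_add R_mult)
      ultimately show "u \<in> (*) 2 ` R" by blast
    qed
    show "(*) 2 ` R \<subseteq> Idl\<^bsub>rr\<^esub> {2, \<alpha>}" unfolding genideal_pair[OF R_numeral al]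
    proof
      fix u assume "u \<in> (*) 2 ` R"
      then obtain x where "x \<in> R" "u = x * 2 + 0 * \<alpha>" by (auto simp: mult.commute)
      thus "u \<in> {x * 2 + y * \<alpha> |x y. x \<in> R \<and> y \<in> R}" using R_0 by blast
    qed
  qed
  thus False using not_splits_if_prime_2 pr sp by simp
qed

text \<open>Choose a common factor \<open>c\<close> of maximal modulus: the generator of a principal
  prime dividing both remaining entries could be moved into \<open>c\<close>.\<close>

lemma primitive_part:
  assumes u: "u1 \<in> R" "u2 \<in> R" "u1 \<noteq> 0 \<or> u2 \<noteq> 0"
  obtains c v1 v2 where "c \<in> R" "c \<noteq> 0" "v1 \<in> R" "v2 \<in> R" "u1 = c * v1" "u2 = c * v2"
    "\<And>P. prime_of P \<Longrightarrow> v1 \<in> P \<Longrightarrow> v2 \<in> P \<Longrightarrow> \<not> principal_of P"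
proof -
  define G where "G = {c \<in> R. \<exists>v1\<in>R. \<exists>v2\<in>R. u1 = c * v1 \<and> u2 = c * v2}"
  have "1 \<in> G" using u by (auto simp: G_def R_1)
  have "G \<subseteq> {c \<in> R. cmod c \<le> cmod u1 + cmod u2}"
  proof
    fix c assume c: "c \<in> G"
    then obtain v1 v2 where v: "v1 \<in> R" "v2 \<in> R" "u1 = c * v1" "u2 = c * v2" by (auto simp: G_def)
    have b: "cmod c \<le> cmod (c * v)" if "v \<in> R" "c * v \<noteq> 0" for v
    proof -
      have "cmod v \<ge> 1" using that R_cmod_ge_1 by auto
      hence "cmod c * 1 \<le> cmod c * cmod v" by (intro mult_left_mono) auto
      thus ?thesis by (simp add: norm_mult)
    qed
    have "cmod c \<le> cmod u1 + cmod u2"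
    proof (cases "u1 = 0")
      case True
      hence "cmod c \<le> cmod u2" using u(3) v b[of v2] by simp
      thus ?thesis using norm_ge_zero[of u1] by linarith
    next
      case False
      hence "cmod c \<le> cmod u1" using v b[of v1] by simp
      thus ?thesis using norm_ge_zero[of u2] by linarith
    qed
    thus "c \<in> {c \<in> R. cmod c \<le> cmod u1 + cmod u2}" using c by (simp add: G_def)
  qed
  hence "finite G" using finite_R_ball finite_subset by blast
  hence "finite (cmod ` G)" "cmod ` G \<noteq> {}" using \<open>1 \<in> G\<close> by auto
  from Max_in[OF this] obtain c where c: "c \<in> G" "cmod c = Max (cmod ` G)" by auto
  have max: "cmod c' \<le> cmod c" if "c' \<in> G" for c'
    using that c(2) \<open>finite (cmod ` G)\<close> by simp
  obtain v1 v2 where v: "v1 \<in> R" "v2 \<in> R" "u1 = c * v1" "u2 = c * v2" using c by (auto simp: G_def)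
  have c0: "c \<noteq> 0" using u v by auto
  have "\<not> principal_of P" if P: "prime_of P" "v1 \<in> P" "v2 \<in> P" for P
  proof
    assume "principal_of P"
    then obtain p where p: "p \<in> R" "P = (*) p ` R" by (auto simp: principal_of_def)
    obtain x1 where x1: "x1 \<in> R" "v1 = p * x1" using P p by blast
    obtain x2 where x2: "x2 \<in> R" "v2 = p * x2" using P p by blast
    have "u1 = (c * p) * x1" "u2 = (c * p) * x2" using v x1 x2 by (simp_all add: mult.assoc)
    moreover have "c * p \<in> R" using c p by (auto simp: G_def R_mult)
    ultimately have "c * p \<in> G" using x1 x2 unfolding G_def by blast
    hence "cmod (c * p) \<le> cmod c" by (rule max)
    moreover have "v1 \<noteq> 0 \<or> v2 \<noteq> 0" using u v by auto
    hence "cmod p > 1" using cmod_prime_generator[of p v1] cmod_prime_generator[of p v2] p P by auto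
    ultimately show False using c0 by (simp add: norm_mult)
  qed
  moreover have "c \<in> R" using c by (simp add: G_def)
  ultimately show ?thesis using that c0 v by blast
qed

end

locale cusp_point = reduced_cusp +
  fixes z :: complex and t M :: real and J :: int
  assumes t_pos: "t > 0"
    and covered: "a \<in> R \<Longrightarrow> b \<in> R \<Longrightarrow> x \<in> R \<Longrightarrow> y \<in> R \<Longrightarrow> x * a + y * b = 1 \<Longrightarrow> 1 \<le> hform z t a b"
    and J_works: "ideal_of I \<Longrightarrow> x0 \<in> I \<Longrightarrow> x0 \<noteq> 0 \<Longrightarrow> sqrt (real (ideal_norm (complex_ring\<lparr>carrier := R\<rparr>) I)) < 2 * M \<Longrightarrow>
      (\<And>P. prime_of P \<Longrightarrow> principal_of P \<Longrightarrow> \<not> I \<subseteq> P) \<Longrightarrow> \<alpha> \<in> R \<Longrightarrow>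
      admissible_shift (complex_ring\<lparr>carrier := R\<rparr>) I \<alpha> \<Longrightarrow>
      \<exists>j::int. (X::real) \<le> of_int j \<and> of_int j \<le> X + of_int J \<and> coprime_shift I \<alpha> j"
begin

section \<open>Coordinates adapted to the cusp vector\<close>

definition phi :: real where "phi = hform z t a0 b0"

text \<open>The Hermitian inner product belonging to \<open>hform\<close>, of
  \<open>(u1, u2)\<close> with the cusp vector.\<close>

definition herm :: "complex \<Rightarrow> complex \<Rightarrow> complex" where
  "herm u1 u2 = (u1 - u2 * z) * cnj (a0 - b0 * z) + u2 * cnj b0 * of_real (t\<^sup>2)"

text \<open>The coordinate of the orthogonal projection to the line of the cusp vector.\<close>

definition kap :: "complex \<Rightarrow> complex \<Rightarrow> complex" where
  "kap u1 u2 = herm u1 u2 / of_real phi"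

text \<open>Once the cusp vector is moved to infinity, the point lies over \<open>z0\<close> at
  height \<open>t / phi\<close>; \<open>hform_comb\<close> is the form in these coordinates.\<close>

definition z0 :: complex where "z0 = kap w1 w2"

lemma phi_pos: "phi > 0"
proof -
  have "a0 \<noteq> 0 \<or> b0 \<noteq> 0" using w_det by auto
  thus ?thesis using t_pos unfolding phi_def hform_def
    by (cases "b0 = 0") (auto intro: add_nonneg_pos)
qed

text \<open>The Lagrange identity divided by \<open>phi\<close>: the determinant with the cusp
  vector measures the part orthogonal to it.\<close>

lemma hform_decomp:
  "hform z t u1 u2 = phi * (cmod (kap u1 u2))\<^sup>2 + t\<^sup>2 * (cmod (a0 * u2 - b0 * u1))\<^sup>2 / phi"
proof -
  have e: "hform z t x y = (cmod (x - y * z))\<^sup>2 + (cmod y)\<^sup>2 * t\<^sup>2" for x y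
    by (simp add: hform_def norm_minus_commute)
  have "(u1 - u2 * z) * b0 - u2 * (a0 - b0 * z) = - (a0 * u2 - b0 * u1)" by (simp add: algebra_simps)
  hence "cmod ((u1 - u2 * z) * b0 - u2 * (a0 - b0 * z)) = cmod (a0 * u2 - b0 * u1)"
    by (simp only: norm_minus_cancel)
  hence "hform z t u1 u2 * phi = (cmod (herm u1 u2))\<^sup>2 + t\<^sup>2 * (cmod (a0 * u2 - b0 * u1))\<^sup>2"
    using lagrange_identity[of "u1 - u2 * z" u2 t "a0 - b0 * z" b0]
    unfolding phi_def e herm_def by simp
  moreover have "phi * (cmod (kap u1 u2))\<^sup>2 = (cmod (herm u1 u2))\<^sup>2 / phi"
    using phi_pos by (simp add: kap_def norm_divide power2_eq_square field_simps)
  ultimately show ?thesis using phi_pos by (simp add: field_simps)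
qed

lemma herm_self: "herm a0 b0 = of_real phi"
proof -
  have "complex_of_real ((cmod (a0 - b0 * z))\<^sup>2 + (cmod b0)\<^sup>2 * t\<^sup>2) = herm a0 b0"
    unfolding herm_def of_real_add of_real_mult complex_norm_square by simp
  thus ?thesis by (simp add: phi_def hform_def norm_minus_commute)
qed

lemma kap_comb: "kap (D * w1 + k * a0) (D * w2 + k * b0) = D * z0 + k"
proof -
  have "herm (D * w1 + k * a0) (D * w2 + k * b0) = D * herm w1 w2 + k * herm a0 b0"
    by (simp add: herm_def algebra_simps)
  thus ?thesis using phi_pos unfolding herm_self z0_def kap_def by (simp add: field_simps)
qed

lemma det_comb: "a0 * (D * w2 + k * b0) - b0 * (D * w1 + k * a0) = D"
proof -
  have "a0 * (D * w2 + k * b0) - b0 * (D * w1 + k * a0) = D * (a0 * w2 - b0 * w1)"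
    by (simp add: algebra_simps)
  thus ?thesis using w_det by simp
qed

lemma hform_comb:
  "hform z t (D * w1 + k * a0) (D * w2 + k * b0) = phi * (cmod (D * z0 + k))\<^sup>2 + t\<^sup>2 * (cmod D)\<^sup>2 / phi"
  unfolding hform_decomp kap_comb det_comb ..

text \<open>\<open>y \<in> R\<close> and \<open>y * tau \<in> R\<close> say that \<open>y\<close>
  times the inverse ideal is integral, i.e. that \<open>y\<close> lies in the cusp ideal. Membership
  in the cusp ideal is expressed this way throughout.\<close>

lemma ideal_mult_inverse:
  assumes "y \<in> R" "y * tau \<in> R" "x * a0 \<in> R" "x * b0 \<in> R"
  shows "x * y \<in> R"
proof -
  obtain p q where "x = of_int p + of_int q * tau" using inverse_iff assms by blast
  hence "x * y = of_int p * y + of_int q * (y * tau)" by (simp add: algebra_simps)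
  thus ?thesis using assms by (simp add: R_closed)
qed

text \<open>If the row with the chosen \<open>j\<close> had \<open>hform\<close> below 1, removing a
  common factor would leave a nonprincipal prime \<open>P\<close> containing both entries.
  \<open>P\<close> contains \<open>D\<close>, \<open>D * tau\<close> and the products of
  \<open>k\<close> with the cusp ideal, so \<open>cov\<close> gives \<open>d \<subseteq> P\<close>.
  As \<open>n0\<close> lies in the cusp ideal and is 1 modulo \<open>d\<close>, the fractional
  \<open>k\<close> becomes \<open>\<alpha> + j\<close>, which then lies in \<open>P\<close>; but
  \<open>j\<close> was chosen so that it is prime to \<open>a\<close>.\<close>

lemma good_row:
  fixes r :: int
  assumes D: "D \<in> R" "D * tau \<in> R" "D \<noteq> 0"
    and d: "ideal_of d" and AE: "A > 0" "E > 0" "of_int A + of_int x * om \<in> d" "of_int E * om \<in> d"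
      "sqrt (real_of_int (A * E)) < 2 * M"
    and n0: "n0 \<in> R" "n0 * tau \<in> R" "1 - n0 \<in> d"
    and cov: "\<And>P j. prime_of P \<Longrightarrow> D \<in> P \<Longrightarrow> D * tau \<in> P \<Longrightarrow>
       (\<And>y. y \<in> R \<Longrightarrow> y * tau \<in> R \<Longrightarrow> (of_int r * tau + of_int j) * y \<in> P) \<Longrightarrow> d \<subseteq> P"
    and ev: "d \<subseteq> (*) 2 ` R \<Longrightarrow> even r"
  shows "1 \<le> phi * ((Im (D * z0 + of_int r * tau))\<^sup>2 + (of_int J / 2)\<^sup>2) + t\<^sup>2 * (cmod D)\<^sup>2 / phi"
proof -
  have Eom: "of_int E * om \<noteq> 0" using AE om_Im by auto
  obtain c a where ca: "c \<in> R" "c \<noteq> 0" "\<And>P. prime_of P \<Longrightarrow> c \<in> P \<Longrightarrow> principal_of P"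
    "ideal_of a" "d = (*) c ` a" "\<And>P. prime_of P \<Longrightarrow> principal_of P \<Longrightarrow> \<not> a \<subseteq> P"
    using remove_principal_primes[OF d AE(4) Eom] by blast
  have da: "d \<subseteq> a" using ca ideal_of_mult by auto
  have "ideal_norm rr a \<le> nat (A * E)"
    using ideal_norm_le_triangular(2)[OF ca(4) om_R R_eq_om AE(1) _ AE(2)] AE da by blast
  hence "int (ideal_norm rr a) \<le> A * E" using AE by (subst (asm) le_nat_iff) auto
  hence "real_of_int (int (ideal_norm rr a)) \<le> real_of_int (A * E)" by (simp only: of_int_le_iff)
  hence "real (ideal_norm rr a) \<le> real_of_int (A * E)" by (simp only: of_int_of_nat_eq)
  hence "sqrt (real (ideal_norm rr a)) \<le> sqrt (real_of_int (A * E))" by simp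
  hence na: "sqrt (real (ideal_norm rr a)) < 2 * M" using AE(5) by linarith
  define \<alpha> where "\<alpha> = of_int r * (n0 * tau)"
  have aR: "\<alpha> \<in> R" unfolding \<alpha>_def by (rule R_mult[OF R_of_int n0(2)])
  have adm: "admissible_shift rr a \<alpha>"
  proof (rule admissible_shiftI[OF ca(4) aR])
    assume "a \<subseteq> (*) 2 ` R"
    hence "even r" using ev da by blast
    then obtain m where "r = 2 * m" by auto
    hence "\<alpha> = 2 * (of_int m * (n0 * tau))" by (simp add: \<alpha>_def)
    thus "\<alpha> \<in> (*) 2 ` R" using n0 R_mult R_of_int by blast
  qed
  \<comment> \<open>The window for \<open>j\<close> is centred so that the real part of
    \<open>D * z0 + k\<close> is at most \<open>J / 2\<close> in modulus.\<close>
  define X where "X = - Re (D * z0 + of_int r * tau) - of_int J / 2"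
  have "\<exists>j::int. X \<le> of_int j \<and> of_int j \<le> X + of_int J \<and> coprime_shift a \<alpha> j"
  proof (rule J_works[OF ca(4) _ Eom na _ aR adm])
    show "of_int E * om \<in> a" using AE(4) da by blast
    show "\<not> a \<subseteq> P" if "prime_of P" "principal_of P" for P using ca(6) that by blast
  qed
  then obtain j :: int where j: "X \<le> of_int j" "of_int j \<le> X + of_int J" "coprime_shift a \<alpha> j"
    by blast
  define k where "k = of_int r * tau + of_int j"
  define u1 u2 where "u1 = D * w1 + k * a0" "u2 = D * w2 + k * b0"
  have kI: "k * a0 \<in> R" "k * b0 \<in> R"
    using inverse_iff[of k] by (auto simp: k_def add.commute)
  have uR: "u1 \<in> R" "u2 \<in> R"
    unfolding u1_u2_def using ideal_mult_inverse[OF D(1,2)] w_in kI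
    by (auto intro!: R_add simp: mult.commute[of D])
  have det: "a0 * u2 - b0 * u1 = D" unfolding u1_u2_def by (rule det_comb)
  have "1 \<le> hform z t u1 u2"
  proof (rule ccontr)
    assume "\<not> 1 \<le> hform z t u1 u2"
    hence lt: "hform z t u1 u2 < 1" by simp
    have "u1 \<noteq> 0 \<or> u2 \<noteq> 0" using det D by auto
    then obtain e v1 v2 where v: "e \<in> R" "e \<noteq> 0" "v1 \<in> R" "v2 \<in> R" "u1 = e * v1" "u2 = e * v2"
      "\<And>P. prime_of P \<Longrightarrow> v1 \<in> P \<Longrightarrow> v2 \<in> P \<Longrightarrow> \<not> principal_of P"
      using primitive_part[OF uR] by metis
    have "1\<^sup>2 \<le> (cmod e)\<^sup>2" using R_cmod_ge_1[OF v(1,2)] by (intro power_mono) auto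
    hence "1 * hform z t v1 v2 \<le> (cmod e)\<^sup>2 * hform z t v1 v2"
      by (intro mult_right_mono hform_nonneg) simp
    hence lt': "hform z t v1 v2 < 1" using lt unfolding v(5,6) hform_scale by simp
    have iV: "ideal_of (Idl\<^bsub>rr\<^esub> {v1, v2})"
      using ring.genideal_ideal[OF cring.axioms(1)[OF cring_rr], of "{v1, v2}"] v by (simp add: ideal_iff)
    have "Idl\<^bsub>rr\<^esub> {v1, v2} \<noteq> R"
    proof
      assume "Idl\<^bsub>rr\<^esub> {v1, v2} = R"
      then obtain x y where "x \<in> R" "y \<in> R" "x * v1 + y * v2 = 1"
        using genideal_pair_carrier[OF v(3,4)] by blast
      thus False using covered[OF v(3,4)] lt' by force
    qed
    hence n1: "1 \<notin> Idl\<^bsub>rr\<^esub> {v1, v2}" using ideal_of_eq_R[OF iV] by blast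
    have vI: "v1 \<in> Idl\<^bsub>rr\<^esub> {v1, v2}" "v2 \<in> Idl\<^bsub>rr\<^esub> {v1, v2}"
      using ring.genideal_self[OF cring.axioms(1)[OF cring_rr], of "{v1, v2}"] v by auto
    have "v1 \<noteq> 0 \<or> v2 \<noteq> 0" using \<open>u1 \<noteq> 0 \<or> u2 \<noteq> 0\<close> v by auto
    then obtain P where P: "prime_of P" "Idl\<^bsub>rr\<^esub> {v1, v2} \<subseteq> P"
      using prime_of_exists[OF iV n1] vI by metis
    note iP = prime_of_ideal[OF P(1)]
    have vP: "v1 \<in> P" "v2 \<in> P" using vI P by auto
    hence uP: "u1 \<in> P" "u2 \<in> P" using v ideal_of_mult[OF iP] by auto
    have np: "\<not> principal_of P" using v(7) P vP by blast
    have bP: "(x * u2 - y * u1) \<in> P" if "x \<in> R" "y \<in> R" for x y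
      using uP that iP by (intro ideal_of_diff ideal_of_mult)
    have DP: "D \<in> P" using bP[OF cusp_in] det by simp
    have "a0 * tau \<in> R" "b0 * tau \<in> R" using inverse_iff[of tau] by (auto simp: mult.commute intro: exI[of _ 0] exI[of _ 1])
    hence "(a0 * tau) * u2 - (b0 * tau) * u1 \<in> P" by (rule bP)
    moreover have "(a0 * tau) * u2 - (b0 * tau) * u1 = D * tau" unfolding det[symmetric] by (simp add: algebra_simps)
    ultimately have DtP: "D * tau \<in> P" by simp
    \<comment> \<open>Up to sign, \<open>k\<close> is the determinant of the row with
      \<open>(w1, w2)\<close>, just as \<open>D\<close> is its determinant with the cusp
      vector.\<close>
    have kP: "k * y \<in> P" if y: "y \<in> R" "y * tau \<in> R" for y
    proof -
      have "w2 * y \<in> R" "w1 * y \<in> R" using ideal_mult_inverse[OF y] w_in by auto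
      hence "(w2 * y) * u1 - (w1 * y) * u2 \<in> P" using ideal_of_diff[OF iP ideal_of_mult[OF iP _ uP(1)] ideal_of_mult[OF iP _ uP(2)]] by blast
      moreover have "(w2 * y) * u1 - (w1 * y) * u2 = k * y * (a0 * w2 - b0 * w1)"
        unfolding u1_u2_def by (simp add: algebra_simps)
      ultimately show ?thesis using w_det by simp
    qed
    have dP: "d \<subseteq> P" using cov[OF P(1) DP DtP, of j] kP unfolding k_def by blast
    have "k * n0 \<in> P" using kP n0 by blast
    moreover have "of_int j * (1 - n0) \<in> P" using dP n0(3) by (intro ideal_of_mult[OF iP R_of_int]) auto
    moreover have "\<alpha> + of_int j = k * n0 + of_int j * (1 - n0)" by (simp add: \<alpha>_def k_def algebra_simps)
    ultimately have ajP: "\<alpha> + of_int j \<in> P" using ideal_of_add[OF iP] by simp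
    have "c \<notin> P" using ca(3) P np by blast
    have aP: "a \<subseteq> P"
    proof
      fix y assume y: "y \<in> a"
      hence "c * y \<in> P" using ca(5) dP by blast
      thus "y \<in> P" using \<open>c \<notin> P\<close> prime_of_mult[OF P(1)] ca(1) ideal_of_R[OF ca(4) y] by blast
    qed
    obtain y x where "y \<in> a" "x \<in> R" "y + x * (\<alpha> + of_int j) = 1"
      using j(3) by (auto simp: coprime_shift_def)
    moreover from this have "y + x * (\<alpha> + of_int j) \<in> P"
      using aP ideal_of_add[OF iP _ ideal_of_mult[OF iP _ ajP]] by blast
    ultimately show False using prime_of_1[OF P(1)] by simp
  qed
  hence h: "1 \<le> phi * (cmod (D * z0 + k))\<^sup>2 + t\<^sup>2 * (cmod D)\<^sup>2 / phi"
    unfolding u1_u2_def hform_comb .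
  have re: "Re (D * z0 + k) = of_int j - X - of_int J / 2" by (simp add: X_def k_def)
  have "\<bar>Re (D * z0 + k)\<bar> \<le> of_int J / 2" unfolding re using j by (intro abs_leI) linarith+
  hence "\<bar>Re (D * z0 + k)\<bar>\<^sup>2 \<le> (of_int J / 2)\<^sup>2" by (intro power_mono) auto
  moreover have "Im (D * z0 + k) = Im (D * z0 + of_int r * tau)" by (simp add: k_def)
  ultimately have "(cmod (D * z0 + k))\<^sup>2 \<le> (Im (D * z0 + of_int r * tau))\<^sup>2 + (of_int J / 2)\<^sup>2"
    unfolding cmod_power2 by simp
  hence "phi * (cmod (D * z0 + k))\<^sup>2 \<le> phi * ((Im (D * z0 + of_int r * tau))\<^sup>2 + (of_int J / 2)\<^sup>2)"
    using phi_pos by (intro mult_left_mono) auto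
  thus ?thesis using h by linarith
qed

end

section \<open>Two families of admissible rows\<close>

lemma prime_int_dvd_mult:
  assumes "prime (q::nat)" "int q dvd x * y"
  shows "int q dvd x \<or> int q dvd y"
  using assms by (simp add: prime_dvd_mult_iff)

text \<open>Take the largest divisor of \<open>m\<close> prime to \<open>n\<close>; a missing prime
  of \<open>m\<close> could be multiplied in.\<close>

lemma coprime_part:
  fixes m n :: int
  assumes m: "m > 0"
  obtains k where "k > 0" "k dvd m" "coprime k n"
    "\<And>q::nat. prime q \<Longrightarrow> int q dvd m \<Longrightarrow> int q dvd n \<or> int q dvd k"
proof -
  define S where "S = {k. k > 0 \<and> k dvd m \<and> coprime k n}"
  have "S \<subseteq> {1..m}" using m zdvd_imp_le by (auto simp: S_def)
  hence fS: "finite S" using finite_subset by blast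
  have "1 \<in> S" by (simp add: S_def)
  define k where "k = Max S"
  have kS: "k \<in> S" unfolding k_def using fS \<open>1 \<in> S\<close> by (intro Max_in) auto
  have "int q dvd n \<or> int q dvd k" if q: "prime q" "int q dvd m" for q :: nat
  proof (rule ccontr)
    assume c: "\<not> (int q dvd n \<or> int q dvd k)"
    obtain e where e: "m = k * e" using kS by (auto simp: S_def)
    hence "int q dvd e" using prime_int_dvd_mult[of q k e] q c by auto
    hence "k * int q dvd m" using e by simp
    moreover have "coprime (int q) n" using q c by (intro prime_imp_coprime) auto
    ultimately have "k * int q \<in> S" using kS prime_gt_0_nat[OF q(1)] by (simp add: S_def)
    hence "k * int q \<le> k * 1" unfolding k_def using fS by simp
    moreover have "k > 0" using kS by (simp add: S_def)
    ultimately have "int q \<le> 1" by (simp only: mult_le_cancel_left_pos)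
    thus False using prime_gt_1_nat[OF q(1)] by simp
  qed
  moreover have "k > 0" "k dvd m" "coprime k n" using kS by (simp_all add: S_def)
  ultimately show ?thesis by (intro that)
qed

context cusp_point
begin

definition row_ok :: "complex \<Rightarrow> int \<Rightarrow> bool" where
  "row_ok D r \<longleftrightarrow>
     1 \<le> phi * ((Im (D * z0 + of_int r * tau))\<^sup>2 + (of_int J / 2)\<^sup>2) + t\<^sup>2 * (cmod D)\<^sup>2 / phi"

lemma N_tau: "of_int N * tau = om" by (simp add: om_def)

lemma cnj_om_tau: "cnj om * tau = of_int C"
proof -
  have "of_int N * (cnj om * tau) = of_int N * of_int C"
    using om_norm by (simp add: N_tau[symmetric] mult_ac)
  thus ?thesis using N_pos by simp
qed

lemma N'B_eq: "N' * B = N * B'"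
  using N_eq B_eq by (metis mult.assoc mult.commute)

lemma lattice_ideal:
  assumes uv: "u \<in> R" "v \<in> R" and d: "d = {of_int p * u + of_int q * v | p q. True}"
    and ou: "om * u = of_int a1 * u + of_int a2 * v" and ov: "om * v = of_int a3 * u + of_int a4 * v"
  shows "ideal_of d"
  unfolding ideal_of_def
proof (intro conjI ballI)
  have "0 = of_int 0 * u + of_int 0 * v" by simp
  thus "0 \<in> d" unfolding d by blast
  show "d \<subseteq> R" unfolding d using uv by (auto intro!: R_add R_mult R_of_int)
  fix x y assume "x \<in> d" "y \<in> d"
  then obtain p q p' q' where "x = of_int p * u + of_int q * v" "y = of_int p' * u + of_int q' * v"
    unfolding d by blast
  hence "x + y = of_int (p + p') * u + of_int (q + q') * v" by (simp add: algebra_simps)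
  thus "x + y \<in> d" unfolding d by blast
next
  fix x y assume x: "x \<in> R" and "y \<in> d"
  then obtain p q where y: "y = of_int p * u + of_int q * v" unfolding d by blast
  obtain e f where x: "x = of_int e + of_int f * om" using x R_eq_om by auto
  have "x * y = of_int e * y + of_int f * (of_int p * (om * u) + of_int q * (om * v))"
    unfolding x y by (simp add: algebra_simps)
  also have "\<dots> = of_int (e * p + f * (p * a1 + q * a3)) * u + of_int (e * q + f * (p * a2 + q * a4)) * v"
    unfolding ou ov y by (simp add: algebra_simps)
  finally show "x * y \<in> d" unfolding d by blast
qed

lemma even_coeffs:
  assumes "of_int p + of_int q * om \<in> (*) 2 ` R"
  shows "even p" "even q"
proof -
  obtain x where x: "x \<in> R" "of_int p + of_int q * om = 2 * x" using assms by blast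
  then obtain a b where "x = of_int a + of_int b * om" using R_eq_om by auto
  hence "of_int p + of_int q * om = of_int (2 * a) + of_int (2 * b) * om" using x by (simp add: algebra_simps)
  from om_basis_unique[OF this] show "even p" "even q" by auto
qed

text \<open>The two elements of \<open>P\<close> assumed here are the row \<open>r \<tau> + j\<close> times the generators \<open>N\<close> and
  \<open>cnj om\<close> of the cusp ideal.\<close>

lemma row_prime:
  assumes P: "prime_of P" and q: "prime q" "of_nat q \<in> P" "int q dvd N" "\<not> int q dvd r"
    and row: "of_int r * om + of_int j * of_int N \<in> P" "of_int r * of_int C + of_int j * (of_int B - om) \<in> P"
  shows "om \<in> P" "int q dvd N'"
proof -
  note iP = prime_of_ideal[OF P]
  have NP: "of_int N \<in> P" using prime_of_int_dvd[OF P q(1,2)] q by simp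
  have rP: "of_int r \<notin> P" using prime_of_int_dvd[OF P q(1,2)] q by simp
  have "of_int r * om + of_int j * of_int N - of_int j * of_int N \<in> P"
    using ideal_of_diff[OF iP row(1) ideal_of_mult[OF iP R_of_int NP]] .
  hence "of_int r * om \<in> P" by simp
  thus omP: "om \<in> P" using rP prime_of_mult[OF P _ R_of_int om_R] by blast
  \<comment> \<open>At a prime dividing \<open>g\<close>, both \<open>B\<close> and
    \<open>om\<close> lie in \<open>P\<close>. The second element of the row then leaves
    \<open>r * C \<in> P\<close>, and \<open>q\<close> would divide \<open>N\<close>,
    \<open>B\<close> and \<open>C\<close>.\<close>
  have "\<not> int q dvd g"
  proof
    assume qg: "int q dvd g"
    hence qB: "int q dvd B" unfolding g_def by (meson dvd_trans gcd_dvd2)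
    hence BP: "of_int B \<in> P" using prime_of_int_dvd[OF P q(1,2)] by simp
    have "of_int j * (of_int B - om) \<in> P" using ideal_of_mult[OF iP R_of_int ideal_of_diff[OF iP BP omP]] .
    from ideal_of_diff[OF iP row(2) this] have "of_int r * of_int C \<in> P" by simp
    hence "of_int C \<in> P" using rP prime_of_mult[OF P _ R_of_int R_of_int] by blast
    hence "int q dvd C" using prime_of_int_dvd[OF P q(1,2)] by simp
    thus False using prime_not_dvd_NBC q qB by blast
  qed
  moreover have "int q dvd g * N'" using q(3) N_eq by metis
  ultimately show "int q dvd N'" using prime_int_dvd_mult[OF q(1)] by blast
qed

lemma row_elements:
  assumes "\<And>y. y \<in> R \<Longrightarrow> y * tau \<in> R \<Longrightarrow> (of_int r * tau + of_int j) * y \<in> P"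
  shows "of_int r * om + of_int j * of_int N \<in> P" "of_int r * of_int C + of_int j * (of_int B - om) \<in> P"
proof -
  have "(of_int r * tau + of_int j) * of_int N \<in> P"
    using assms[of "of_int N"] om_R by (simp add: R_of_int N_tau)
  moreover have "(of_int r * tau + of_int j) * of_int N = of_int r * om + of_int j * of_int N"
    by (simp add: om_def algebra_simps)
  ultimately show "of_int r * om + of_int j * of_int N \<in> P" by simp
  have "(of_int r * tau + of_int j) * cnj om \<in> P"
    using assms[of "cnj om"] R_cnj[OF om_R] by (simp add: R_of_int cnj_om_tau)
  moreover have "(of_int r * tau + of_int j) * cnj om = of_int r * (cnj om * tau) + of_int j * cnj om"
    by (simp add: algebra_simps)
  ultimately show "of_int r * of_int C + of_int j * (of_int B - om) \<in> P"
    unfolding cnj_om_tau unfolding cnj_om by simp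
qed

lemma sqrt_less_2M:
  assumes "x < 4 * M\<^sup>2" "M > 0" shows "sqrt x < 2 * M"
proof -
  have "sqrt x < sqrt ((2 * M)\<^sup>2)" using assms by (subst real_sqrt_less_iff) (simp add: power_mult_distrib)
  moreover have "sqrt ((2 * M)\<^sup>2) = 2 * M" using assms by (intro real_sqrt_unique) auto
  ultimately show ?thesis by linarith
qed

lemma int_prime_in_prime:
  assumes P: "prime_of P" and m: "m > 0" "of_int m \<in> P"
  obtains q :: nat where "prime q" "of_nat q \<in> P" "int q dvd m"
proof -
  have "of_nat (nat m) \<in> P" "nat m > 0" using m by simp_all
  then obtain q where "prime q" "q dvd nat m" "of_nat q \<in> P" using prime_of_has_prime[OF P] by metis
  thus ?thesis using that[of q] m by (simp add: int_dvd_int_iff[symmetric])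
qed

text \<open>\<open>N\<close> times the inverse of the cusp ideal is its conjugate
  \<open>(N, om)\<close>, and \<open>(N', om)\<close> is the part of it prime to the cusp ideal.
  \<open>d\<close> is this part times \<open>k\<close>, the part of \<open>m\<close> prime to
  \<open>N\<close>. By \<open>row_prime\<close> the conditions on \<open>r\<close> ensure that every
  common prime of the row contains \<open>d\<close>, whose norm is at most
  \<open>k^2 * N'\<close>.\<close>

lemma row_ok_N:
  assumes m: "m > 0" and M: "M > 0" and size: "of_int (m\<^sup>2 * N) < 4 * M\<^sup>2"
    and rg: "\<And>q::nat. prime q \<Longrightarrow> int q dvd g \<Longrightarrow> \<not> int q dvd r"
    and rm: "\<And>q::nat. prime q \<Longrightarrow> int q dvd m \<Longrightarrow> int q dvd N \<Longrightarrow> \<not> int q dvd r"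
    and par: "even m \<Longrightarrow> odd N \<Longrightarrow> even r"
  shows "row_ok (of_int (m * N)) r"
proof -
  obtain k where k: "k > 0" "k dvd m" "coprime k N"
    "\<And>q::nat. prime q \<Longrightarrow> int q dvd m \<Longrightarrow> int q dvd N \<or> int q dvd k"
    using coprime_part[OF m, of N] by blast
  define u v where "u = (of_int (k * N') :: complex)" "v = of_int k * om"
  define d where "d = {of_int p * u + of_int q * v | p q. True}"
  have uvR: "u \<in> R" "v \<in> R" by (auto simp: u_v_def om_R intro!: R_of_int R_mult)
  have ouv: "om * u = of_int 0 * u + of_int N' * v" by (simp add: u_v_def)
  have "om * v = of_int k * (om * om)" by (simp add: u_v_def)
  also have "\<dots> = of_int (- (g * C)) * u + of_int B * v"
  proof -
    have eN: "(of_int N :: complex) = of_int g * of_int N'" using N_eq by (metis of_int_mult)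
    show ?thesis unfolding om_sq by (simp add: u_v_def algebra_simps eN)
  qed
  finally have id: "ideal_of d" using lattice_ideal[OF uvR d_def ouv] by blast
  have ud: "u \<in> d"
  proof -
    have "u = of_int 1 * u + of_int 0 * v" by simp
    thus ?thesis unfolding d_def by blast
  qed
  have vd: "v \<in> d"
  proof -
    have "v = of_int 0 * u + of_int 1 * v" by simp
    thus ?thesis unfolding d_def by blast
  qed
  have dP: "d \<subseteq> P" if "ideal_of P" "u \<in> P" "v \<in> P" for P
    unfolding d_def using that by (auto intro!: ideal_of_add ideal_of_mult[OF _ R_of_int])
  obtain x y where xy: "x * N' + y * B = 1" using coprime_N'_B by (metis bezout_int coprime_iff_gcd_eq_1)
  obtain x' y' where xy': "x' * N + y' * k = 1" using k(3) by (metis bezout_int coprime_iff_gcd_eq_1 gcd.commute)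
  \<comment> \<open>Bezout for \<open>N\<close> and \<open>k\<close>, then for \<open>N'\<close> and
    \<open>B = om + cnj om\<close>; both \<open>N\<close> and \<open>cnj om\<close> lie in the cusp
    ideal.\<close>
  define n0 where "n0 = of_int x' * of_int N + of_int (y' * k * y) * cnj om"
  have "1 \<le> phi * ((Im (of_int (m * N) * z0 + of_int r * tau))\<^sup>2 + (of_int J / 2)\<^sup>2)
     + t\<^sup>2 * (cmod (of_int (m * N)))\<^sup>2 / phi"
  proof (rule good_row[where d = d and A = "k * N'" and x = 0 and E = k and ?n0.0 = n0])
    show "of_int (m * N) \<in> R" by (rule R_of_int)
    have mN: "of_int (m * N) * tau = of_int m * om" by (simp add: om_def)
    show "of_int (m * N) * tau \<in> R" unfolding mN using om_R by (intro R_mult R_of_int)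
    show "(of_int (m * N) :: complex) \<noteq> 0" using m N_pos by simp
    show "ideal_of d" by (rule id)
    show "k * N' > 0" "k > 0" using k N'_pos by auto
    show "of_int (k * N') + of_int 0 * om \<in> d" using ud by (simp add: u_v_def)
    show "of_int k * om \<in> d" using vd by (simp add: u_v_def)
    have "k \<le> m" using k m by (intro zdvd_imp_le) auto
    moreover have "N' \<le> N" using dvd_imp_le_int[of N N'] N_eq N_pos by (metis dvd_triv_right zdvd_imp_le)
    ultimately have "(k * k) * N' \<le> (m * m) * N" using k N'_pos by (intro mult_mono) auto
    hence "real_of_int (k * N' * k) \<le> of_int (m\<^sup>2 * N)" unfolding of_int_le_iff
      by (simp add: power2_eq_square mult_ac)
    thus "sqrt (real_of_int (k * N' * k)) < 2 * M" using size M by (intro sqrt_less_2M) auto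
    show "n0 \<in> R" unfolding n0_def using R_cnj[OF om_R] by (intro R_add R_mult R_of_int)
    have "n0 * tau = of_int x' * (of_int N * tau) + of_int (y' * k * y) * (cnj om * tau)"
      by (simp add: n0_def algebra_simps)
    also have "\<dots> \<in> R" unfolding N_tau cnj_om_tau using om_R by (intro R_add R_mult R_of_int)
    finally show "n0 * tau \<in> R" .
    have "(1::complex) = of_int (x' * N + y' * k)" "(1::complex) = of_int (x * N' + y * B)" using xy xy' by simp_all
    hence b1: "(1::complex) = of_int x' * of_int N + of_int y' * of_int k"
      and b2: "of_int y * of_int B = (1::complex) - of_int x * of_int N'"
      by (simp_all add: eq_diff_eq add.commute)
    have "1 - n0 = of_int y' * of_int k - of_int y' * of_int k * (of_int y * of_int B - of_int y * om)"
      unfolding n0_def cnj_om by (subst b1) (simp add: algebra_simps)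
    also have "\<dots> = of_int (y' * x) * u + of_int (y' * y) * v"
      unfolding b2 by (simp add: u_v_def algebra_simps)
    finally show "1 - n0 \<in> d" unfolding d_def by blast
    show "even r" if "d \<subseteq> (*) 2 ` R"
    proof -
      have "of_int 0 + of_int k * om \<in> (*) 2 ` R" using vd that by (auto simp: u_v_def)
      hence "even k" by (rule even_coeffs)
      hence "even m" "odd N" using k by (auto dest: coprime_common_divisor[of _ _ 2])
      thus ?thesis using par by blast
    qed
    fix P j assume P: "prime_of P" and DP: "of_int (m * N) \<in> P" "of_int (m * N) * tau \<in> P"
      and row: "\<And>y. y \<in> R \<Longrightarrow> y * tau \<in> R \<Longrightarrow> (of_int r * tau + of_int j) * y \<in> P"
    note iP = prime_of_ideal[OF P] and rel = row_elements[OF row]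
    have okN: "d \<subseteq> P" if "of_int N' \<in> P" "om \<in> P"
      using that iP by (intro dP) (auto simp: u_v_def intro!: ideal_of_mult R_of_int)
    have okk: "d \<subseteq> P" if "of_int k \<in> P"
      using that iP by (intro dP) (auto simp: u_v_def intro!: ideal_of_mult' R_of_int om_R)
    show "d \<subseteq> P"
    proof (cases "of_int m \<in> P")
      case True
      then obtain q where q: "prime q" "of_nat q \<in> P" "int q dvd m" using int_prime_in_prime[OF P m] by blast
      show ?thesis
      proof (cases "int q dvd k")
        case True
        thus ?thesis using okk prime_of_int_dvd[OF P q(1,2)] by simp
      next
        case False
        hence "int q dvd N" using k(4) q by blast
        from row_prime[OF P q(1,2) this rm[OF q(1,3) this] rel] show ?thesis
          using okN prime_of_int_dvd[OF P q(1,2)] by simp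
      qed
    next
      case False
      have "of_int m * of_int N \<in> P" "of_int m * om \<in> P" using DP unfolding mN by simp_all
      hence NP: "of_int N \<in> P" and omP: "om \<in> P"
        using False prime_of_mult[OF P] R_of_int om_R by blast+
      obtain q where q: "prime q" "of_nat q \<in> P" "int q dvd N" using int_prime_in_prime[OF P N_pos NP] by blast
      have "int q dvd N'"
      proof (cases "int q dvd g")
        case True
        from row_prime[OF P q rg[OF q(1) this] rel] show ?thesis by blast
      next
        case False
        moreover have "int q dvd g * N'" using q N_eq by metis
        ultimately show ?thesis using prime_int_dvd_mult[OF q(1)] by blast
      qed
      thus ?thesis using okN omP prime_of_int_dvd[OF P q(1,2)] by simp
    qed
  qed
  thus ?thesis unfolding row_ok_def .
qed

text \<open>With \<open>D0 = N' * om\<close>, the ideal \<open>(D0, D0 * tau)\<close> is prime to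
  the cusp ideal, so \<open>r\<close> is constrained only at primes dividing \<open>m\<close>. The
  norm of that ideal is at most \<open>N'^2 * C\<close>.\<close>

lemma row_ok_N'om:
  assumes m: "m > 0" and M: "M > 0" and size: "of_int (m\<^sup>2 * (N'\<^sup>2 * C)) < 4 * M\<^sup>2"
    and rm: "\<And>q::nat. prime q \<Longrightarrow> int q dvd m \<Longrightarrow> int q dvd N \<Longrightarrow> \<not> int q dvd r"
    and par: "even m \<Longrightarrow> odd N \<Longrightarrow> even r"
  shows "row_ok (of_int m * (of_int N' * om)) r"
proof -
  obtain k where k: "k > 0" "k dvd m" "coprime k N"
    "\<And>q::nat. prime q \<Longrightarrow> int q dvd m \<Longrightarrow> int q dvd N \<or> int q dvd k"
    using coprime_part[OF m, of N] by blast
  define v0 where "v0 = of_int B' * om - of_int (N' * C)"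
  have D0tau: "of_int N' * om * tau = v0"
  proof -
    have "of_int N' * om * tau = of_int N' * (om * tau)" by simp
    also have "\<dots> = of_int (N' * B) * tau - of_int (N' * C)"
      unfolding om_tau by (simp add: algebra_simps)
    also have "of_int (N' * B) * tau = of_int B' * om" unfolding N'B_eq by (simp add: om_def)
    finally show ?thesis by (simp add: v0_def)
  qed
  have v0R: "v0 \<in> R" unfolding v0_def using om_R by (intro R_diff R_mult R_of_int)
  define u v where "u = of_int k * (of_int N' * om)" "v = of_int k * v0"
  define d where "d = {of_int p * u + of_int q * v | p q. True}"
  have uvR: "u \<in> R" "v \<in> R" using om_R v0R by (auto simp: u_v_def intro!: R_of_int R_mult)
  have ut: "v = u * tau" by (simp add: u_v_def D0tau[symmetric])
  have ou: "om * u = of_int 0 * u + of_int N * v" unfolding ut by (simp add: N_tau[symmetric])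
  have "om * v = u * (om * tau)" by (simp add: ut)
  also have "\<dots> = of_int (- C) * u + of_int B * v" unfolding om_tau ut by (simp add: algebra_simps)
  finally have id: "ideal_of d" using lattice_ideal[OF uvR d_def ou] by blast
  have ud: "u \<in> d"
  proof -
    have "u = of_int 1 * u + of_int 0 * v" by simp
    thus ?thesis unfolding d_def by blast
  qed
  have vd: "v \<in> d"
  proof -
    have "v = of_int 0 * u + of_int 1 * v" by simp
    thus ?thesis unfolding d_def by blast
  qed
  have dP: "d \<subseteq> P" if "ideal_of P" "u \<in> P" "v \<in> P" for P
    unfolding d_def using that by (auto intro!: ideal_of_add ideal_of_mult[OF _ R_of_int])
  \<comment> \<open>\<open>h = v0 + B' * cnj om\<close> is the sum of an element of
    \<open>(D0, v0)\<close> and one of the cusp ideal. The latter also contains \<open>N\<close>, so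
    \<open>coprime N h\<close> makes the two ideals comaximal.\<close>
  define h where "h = B' * B - N' * C"
  have "coprime N h"
  proof (rule coprimeI_prime_nat)
    fix q :: nat assume q: "prime q" "int q dvd N" "int q dvd h"
    have "int q dvd g * N'" using q N_eq by metis
    then consider "int q dvd N'" | "int q dvd g" using prime_int_dvd_mult[OF q(1)] by blast
    thus False
    proof cases
      case 1
      hence "int q dvd B' * B" using q(3) unfolding h_def by (metis dvd_diff_right_iff dvd_mult2 dvd_diffD1 dvd_diff_left_iff)
      hence "int q dvd B' \<or> int q dvd B" using prime_int_dvd_mult[OF q(1)] by blast
      hence "int q dvd B" using B_eq by (metis dvd_mult)
      thus False using prime_dvd_N'_B q 1 by blast
    next
      case 2
      hence qB: "int q dvd B" unfolding g_def by (meson dvd_trans gcd_dvd2)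
      hence "int q dvd B' * B - h" using q(3) by (intro dvd_diff dvd_mult)
      hence "int q dvd N' * C" by (simp add: h_def)
      hence "int q dvd N' \<or> int q dvd C" using prime_int_dvd_mult[OF q(1)] by blast
      thus False using prime_dvd_N'_g[OF q(1) _ 2] prime_not_dvd_NBC[OF q(1,2) qB] by blast
    qed
  qed
  then obtain x y where xy: "x * N + y * h = 1" by (metis bezout_int coprime_iff_gcd_eq_1)
  obtain x' y' where xy': "x' * N + y' * k = 1" using k(3) by (metis bezout_int coprime_iff_gcd_eq_1 gcd.commute)
  define n0 where "n0 = of_int (x' + y' * k * x) * of_int N + of_int (y' * k * y * B') * cnj om"
  have "1 \<le> phi * ((Im (of_int m * (of_int N' * om) * z0 + of_int r * tau))\<^sup>2 + (of_int J / 2)\<^sup>2)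
     + t\<^sup>2 * (cmod (of_int m * (of_int N' * om)))\<^sup>2 / phi"
  proof (rule good_row[where d = d and A = "k * N' * C" and x = "- (k * B')" and E = "k * N'" and ?n0.0 = n0])
    show "of_int m * (of_int N' * om) \<in> R" using om_R by (intro R_mult R_of_int)
    have Dt: "of_int m * (of_int N' * om) * tau = of_int m * v0" by (simp add: D0tau[symmetric])
    show "of_int m * (of_int N' * om) * tau \<in> R" unfolding Dt using v0R by (intro R_mult R_of_int)
    show "of_int m * (of_int N' * om) \<noteq> 0" using m N'_pos om_Im(2) by auto
    show "ideal_of d" by (rule id)
    show "k * N' * C > 0" "k * N' > 0" using k N'_pos C_pos by auto
    have "- v \<in> d" using ideal_of_uminus[OF id vd] .
    thus "of_int (k * N' * C) + of_int (- (k * B')) * om \<in> d" by (simp add: u_v_def v0_def algebra_simps)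
    show "of_int (k * N') * om \<in> d" using ud by (simp add: u_v_def mult.assoc)
    have "k \<le> m" using k m by (intro zdvd_imp_le) auto
    hence "(k * k) * (N'\<^sup>2 * C) \<le> (m * m) * (N'\<^sup>2 * C)" using k C_pos by (intro mult_right_mono mult_mono) auto
    hence "real_of_int (k * N' * C * (k * N')) \<le> of_int (m\<^sup>2 * (N'\<^sup>2 * C))" unfolding of_int_le_iff
      by (simp add: power2_eq_square mult_ac)
    thus "sqrt (real_of_int (k * N' * C * (k * N'))) < 2 * M" using size M by (intro sqrt_less_2M) auto
    show "n0 \<in> R" unfolding n0_def using R_cnj[OF om_R] by (intro R_add R_mult R_of_int)
    have "n0 * tau = of_int (x' + y' * k * x) * (of_int N * tau) + of_int (y' * k * y * B') * (cnj om * tau)"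
      by (simp add: n0_def algebra_simps)
    also have "\<dots> \<in> R" unfolding N_tau cnj_om_tau using om_R by (intro R_add R_mult R_of_int)
    finally show "n0 * tau \<in> R" .
    have "(1::complex) = of_int (x' * N + y' * k)" "(1::complex) = of_int (x * N + y * h)" using xy xy' by simp_all
    hence b1: "(1::complex) = of_int x' * of_int N + of_int y' * of_int k"
      and b2: "of_int x * of_int N = (1::complex) - of_int y * of_int h"
      by (simp_all add: eq_diff_eq add.commute)
    have "1 - n0 = of_int y' * of_int k - of_int y' * of_int k * (of_int x * of_int N)
        - of_int (y' * k * y * B') * (of_int B - om)"
      unfolding n0_def cnj_om by (subst b1) (simp add: algebra_simps)
    also have "\<dots> = of_int (y' * y) * v"
      unfolding b2 by (simp add: u_v_def v0_def h_def algebra_simps)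
    also have "\<dots> \<in> d" by (rule ideal_of_mult[OF id R_of_int vd])
    finally show "1 - n0 \<in> d" .
    show "even r" if d2: "d \<subseteq> (*) 2 ` R"
    proof -
      have "of_int 0 + of_int (k * N') * om \<in> (*) 2 ` R" using ud d2 by (auto simp: u_v_def mult.assoc)
      hence 1: "even (k * N')" by (rule even_coeffs)
      have "of_int (- (k * N' * C)) + of_int (k * B') * om \<in> (*) 2 ` R"
        using vd d2 by (auto simp: u_v_def v0_def algebra_simps)
      hence 2: "even (k * B')" by (rule even_coeffs)
      have "even k"
      proof (rule ccontr)
        assume "odd k"
        hence "even N'" "even B'" using 1 2 by auto
        thus False using coprime_N'_B' by (auto dest: coprime_common_divisor[of _ _ 2])
      qed
      hence "even m" "odd N" using k by (auto dest: coprime_common_divisor[of _ _ 2])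
      thus ?thesis using par by blast
    qed
    fix P j assume P: "prime_of P" and DP: "of_int m * (of_int N' * om) \<in> P" "of_int m * (of_int N' * om) * tau \<in> P"
      and row: "\<And>y. y \<in> R \<Longrightarrow> y * tau \<in> R \<Longrightarrow> (of_int r * tau + of_int j) * y \<in> P"
    note iP = prime_of_ideal[OF P] and rel = row_elements[OF row]
    have ok: "d \<subseteq> P" if "of_int N' * om \<in> P" "v0 \<in> P"
      using that iP by (intro dP) (auto simp: u_v_def intro!: ideal_of_mult[OF iP R_of_int])
    have okk: "d \<subseteq> P" if kP: "of_int k \<in> P"
    proof (intro dP iP)
      show "u \<in> P" unfolding u_v_def using om_R by (intro ideal_of_mult'[OF iP _ kP] R_mult R_of_int)
      show "v \<in> P" unfolding u_v_def by (intro ideal_of_mult'[OF iP _ kP] v0R)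
    qed
    show "d \<subseteq> P"
    proof (cases "of_int m \<in> P")
      case True
      then obtain q where q: "prime q" "of_nat q \<in> P" "int q dvd m" using int_prime_in_prime[OF P m] by blast
      show ?thesis
      proof (cases "int q dvd k")
        case True
        thus ?thesis using okk prime_of_int_dvd[OF P q(1,2)] by simp
      next
        case False
        hence "int q dvd N" using k(4) q by blast
        from row_prime[OF P q(1,2) this rm[OF q(1,3) this] rel]
        have omP: "om \<in> P" and "int q dvd N'" by auto
        hence N'P: "of_int N' \<in> P" using prime_of_int_dvd[OF P q(1,2)] by simp
        have "of_int B' * om - of_int C * of_int N' \<in> P"
          by (intro ideal_of_diff[OF iP] ideal_of_mult[OF iP R_of_int] omP N'P)
        hence "v0 \<in> P" by (simp add: v0_def mult.commute)
        thus ?thesis using ok ideal_of_mult[OF iP R_of_int omP] by blast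
      qed
    next
      case False
      have "of_int N' * om \<in> R" using om_R by (intro R_mult R_of_int)
      hence "of_int N' * om \<in> P" "v0 \<in> P"
        using DP[unfolded Dt] False prime_of_mult[OF P] R_of_int v0R by blast+
      thus ?thesis using ok by blast
    qed
  qed
  thus ?thesis unfolding row_ok_def .
qed

end

section \<open>Hemispheres touching a point of the polyhedron\<close>

context reduced_cusp
begin

text \<open>29/50 is a rational upper bound for \<open>1 / sqrt 3\<close>; both estimates come from
  \<open>3 * N * C \<le> s^2\<close>.\<close>

lemma N_le_s: "of_int N \<le> 29 / 50 * s" and om_le_s: "cmod om \<le> 29 / 50 * s"
proof -
  have b: "3 * of_int (N * C) \<le> s\<^sup>2" unfolding s_sq using NC_le by linarith
  have "(29 / 50 * s)\<^sup>2 = 841 / 2500 * s\<^sup>2" by (simp add: power2_eq_square)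
  hence 1: "(cmod om)\<^sup>2 \<le> (29 / 50 * s)\<^sup>2" unfolding om_cmod using b zero_le_power2[of s] by linarith
  show "cmod om \<le> 29 / 50 * s" using 1 s_pos by (intro power2_le_imp_le[OF 1]) auto
  have "N * N \<le> N * C" using N_le_C N_pos by simp
  hence "(of_int N)\<^sup>2 \<le> real_of_int (N * C)" by (simp add: power2_eq_square flip: of_int_mult)
  hence 2: "(of_int N)\<^sup>2 \<le> (29 / 50 * s)\<^sup>2" using 1 unfolding om_cmod by linarith
  show "of_int N \<le> 29 / 50 * s" using s_pos by (intro power2_le_imp_le[OF 2]) auto
qed

lemma s_eq: "s = 2 * of_int N * Im tau"
  by (simp add: s_def om_Im)

text \<open>The conjugate of an element of the cusp ideal is \<open>N\<close> times an element of
  the inverse ideal, whose nonzero elements have modulus at least 1.\<close>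

lemma inverse_ideal_norm:
  assumes D: "D \<in> R" "D * tau \<in> R" "D \<noteq> 0"
  shows "cmod D \<ge> of_int N"
proof -
  obtain p q where pq: "D = of_int p + of_int q * om" using D(1) R_eq_om by auto
  obtain e f where ef: "D * tau = of_int e + of_int f * om" using D(2) R_eq_om by auto
  have "D * tau = of_int p * tau + of_int q * (om * tau)" by (simp add: pq algebra_simps)
  hence eq: "of_int (p + q * B) * tau - of_int (q * C) = of_int e + of_int (f * N) * tau"
    unfolding ef om_tau by (simp add: om_def algebra_simps)
  have "of_int (p + q * B) * Im tau = of_int (f * N) * Im tau" using arg_cong[OF eq, of Im] by simp
  hence "real_of_int (p + q * B) = of_int (f * N)" using tau_Im by simp
  hence pf: "p + q * B = f * N" by (simp only: of_int_eq_iff)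
  have "cnj D = of_int (p + q * B) - of_int q * om" by (simp add: pq cnj_om algebra_simps)
  also have "\<dots> = of_int N * (of_int f + of_int (- q) * tau)" unfolding pf by (simp add: om_def algebra_simps)
  finally have c: "cnj D = of_int N * (of_int f + of_int (- q) * tau)" .
  hence "cmod D = of_int N * cmod (of_int f + of_int (- q) * tau)"
    using N_pos by (metis complex_mod_cnj norm_mult norm_of_int abs_of_pos of_int_0_less_iff)
  moreover have "of_int f + of_int (- q) * tau \<noteq> 0"
  proof
    assume "of_int f + of_int (- q) * tau = 0"
    hence "cnj D = 0" using c by simp
    thus False using D by simp
  qed
  hence "cmod (of_int f + of_int (- q) * tau) \<ge> 1"
    using inverse_min[of "of_int f + of_int (- q) * tau"] inverse_iff[of "of_int f + of_int (- q) * tau"] by blast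
  ultimately show ?thesis using N_pos by simp
qed

text \<open>\<open>g\<close> is squarefree, so \<open>q\<close> does not divide
  \<open>G = g / q\<close>. Every integer that is 1 modulo \<open>G\<close> is prime to
  \<open>G\<close>, and of two consecutive ones at most one is divisible by
  \<open>q\<close>.\<close>

lemma coprime_g_approx:
  assumes q: "prime (q::nat)" "int q dvd g"
  shows "\<exists>r::int. \<bar>of_int r - x\<bar> \<le> of_int g / real q \<and> (\<forall>p::nat. prime p \<longrightarrow> int p dvd g \<longrightarrow> \<not> int p dvd r)"
proof -
  obtain G where G: "g = int q * G" using q by auto
  have q1: "q > 1" using q prime_gt_1_nat by blast
  have Gpos: "G > 0" using g_pos G q1 by (metis of_nat_0_le_iff zero_less_mult_pos2 zero_less_mult_iff not_less)
  have qG: "\<not> int q dvd G"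
  proof
    assume "int q dvd G"
    hence "int q * int q dvd g" unfolding G by simp
    hence "int q * int q dvd N" unfolding g_def by simp
    moreover have "int q dvd B" using q(2) unfolding g_def by simp
    ultimately show False using not_square_dvd[OF q(1)] by (simp add: power2_eq_square)
  qed
  define k where "k = \<lfloor>(x - 1) / of_int G\<rfloor>"
  have "of_int k \<le> (x - 1) / of_int G" "(x - 1) / of_int G < of_int k + 1" unfolding k_def by linarith+
  hence b: "1 + of_int (G * k) \<le> x" "x < 1 + of_int (G * k) + of_int G" using Gpos by (simp_all add: field_simps)
  define r where "r = (if int q dvd 1 + G * k then 1 + G * k + G else 1 + G * k)"
  have "\<bar>of_int r - x\<bar> \<le> of_int G" using b Gpos unfolding r_def by (auto simp: abs_if)
  moreover have "of_int G = of_int g / real q" using q1 by (simp add: G)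
  moreover have "\<not> int p dvd r" if p: "prime p" "int p dvd g" for p :: nat
  proof (cases "int p dvd G")
    case True
    show ?thesis
    proof
      assume a: "int p dvd r"
      have b: "int p dvd r - 1" using True by (auto simp: r_def)
      have "int p dvd r - (r - 1)" using dvd_diff[OF a b] .
      thus False using prime_gt_1_nat[OF p(1)] by simp
    qed
  next
    case False
    moreover have "int p dvd int q * G" using p(2) G by simp
    ultimately have "int p dvd int q" using prime_int_dvd_mult[OF p(1)] by blast
    hence pq: "p = q" using p(1) q(1) by (simp add: primes_dvd_imp_eq)
    show ?thesis unfolding pq r_def
    proof (cases "int q dvd 1 + G * k")
      case True
      thus "\<not> int q dvd (if int q dvd 1 + G * k then 1 + G * k + G else 1 + G * k)"
        using qG dvd_add_right_iff[OF True, of G] by simp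
    qed simp
  qed
  ultimately show ?thesis by auto
qed

end

context cusp_point
begin

lemma comb_in_R:
  assumes D: "D \<in> R" "D * tau \<in> R"
  shows "D * w1 + (of_int r * tau + of_int j) * a0 \<in> R" "D * w2 + (of_int r * tau + of_int j) * b0 \<in> R"
proof -
  have "(of_int r * tau + of_int j) * a0 \<in> R \<and> (of_int r * tau + of_int j) * b0 \<in> R"
    unfolding inverse_iff by (intro exI[of _ j] exI[of _ r]) simp
  moreover have "w1 * D \<in> R" "w2 * D \<in> R" using ideal_mult_inverse[OF D] w_in by auto
  ultimately show "D * w1 + (of_int r * tau + of_int j) * a0 \<in> R" "D * w2 + (of_int r * tau + of_int j) * b0 \<in> R"
    by (simp_all add: mult.commute[of D] R_add)
qed

text \<open>A determinant in terms of \<open>kap\<close> and the determinants with the cusp vector.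
  Applied to \<open>(1, 0)\<close> and \<open>(\<lambda>, \<mu>)\<close> it will bound
  \<mu>.\<close>

lemma det_kap:
  "u1 * v2 - u2 * v1 = kap u1 u2 * (a0 * v2 - b0 * v1) - kap v1 v2 * (a0 * u2 - b0 * u1)"
proof -
  have "herm u1 u2 * (a0 * v2 - b0 * v1) - herm v1 v2 * (a0 * u2 - b0 * u1)
      = herm a0 b0 * (u1 * v2 - u2 * v1)"
    unfolding herm_def by (simp add: algebra_simps)
  hence "(herm u1 u2 * (a0 * v2 - b0 * v1) - herm v1 v2 * (a0 * u2 - b0 * u1)) / of_real phi
      = u1 * v2 - u2 * v1"
    using phi_pos by (simp add: herm_self)
  thus ?thesis unfolding kap_def by (simp only: diff_divide_distrib times_divide_eq_left)
qed

text \<open>\<open>- Im (D * z0) / Im tau\<close> is the real value of the coefficient of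
  \<open>tau\<close> at which the row over \<open>D\<close> becomes real.\<close>

lemma Im_row_bound:
  fixes k h Q :: int
  assumes "Q > 0" "\<bar>of_int k * (- Im (D * z0) / Im tau) - of_int h\<bar> \<le> e"
  shows "\<bar>Im (of_int k * D * z0 + of_int h * tau)\<bar> \<le> e * Im tau"
proof -
  have "Im (of_int k * D * z0 + of_int h * tau) = of_int k * Im (D * z0) + of_int h * Im tau"
    by (simp add: mult.assoc)
  also have "\<dots> = - (of_int k * (- Im (D * z0) / Im tau) - of_int h) * Im tau"
    using tau_Im by (simp add: field_simps)
  finally have eq: "Im (of_int k * D * z0 + of_int h * tau)
     = - (of_int k * (- Im (D * z0) / Im tau) - of_int h) * Im tau" .
  have "\<bar>Im tau\<bar> = Im tau" using tau_Im by simp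
  thus ?thesis unfolding eq abs_mult abs_minus_cancel using assms(2) tau_Im by (simp only: mult_right_mono less_imp_le)
qed

section \<open>Estimates at a minimal vector\<close>

context
  assumes minimal: "\<And>a b. a \<in> R \<Longrightarrow> b \<in> R \<Longrightarrow> a \<noteq> 0 \<or> b \<noteq> 0 \<Longrightarrow> phi \<le> hform z t a b"
begin

text \<open>Dirichlet with denominators up to about \<open>2 * Im tau\<close>, followed by rounding,
  gives a row with \<open>|D * z0 + K|^2 \<le> 1/2\<close>. Minimality of the cusp vector turns this
  into \<open>phi^2 \<le> 2 * t^2 * |D|^2\<close> with
  \<open>|D| \<le> s + N \<le> 79/50 * s\<close>, and \<open>sqrt 2 * 79/50 < 9/4\<close>.\<close>

lemma phi_le: "phi \<le> 9/4 * s * t"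
proof -
  define Q where "Q = nat \<lceil>2 * Im tau\<rceil>"
  have Q: "Q > 0" "2 * Im tau \<le> real Q" "real Q < 2 * Im tau + 1"
    using tau_Im unfolding Q_def by linarith+
  obtain h k where hk: "0 < k" "k \<le> int Q"
    "\<bar>of_int k * (- Im (of_int N * z0) / Im tau) - of_int h\<bar> < 1 / real Q"
    using Dirichlet_approx[OF Q(1)] by metis
  define D where "D = (of_int (k * N) :: complex)"
  have DR: "D \<in> R" "D * tau \<in> R" "D \<noteq> 0"
    using om_R hk N_pos by (auto simp: D_def mult.assoc N_tau intro!: R_of_int R_mult)
  define y where "y = Re (D * z0 + of_int h * tau)"
  define j where "j = - round y"
  define K where "K = of_int h * tau + of_int j"
  have "\<bar>Im (of_int k * of_int N * z0 + of_int h * tau)\<bar> \<le> 1 / real Q * Im tau"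
    using hk by (intro Im_row_bound[of 1]) auto
  also have "\<dots> \<le> 1 / 2" using Q by (simp add: field_simps)
  finally have im: "\<bar>Im (D * z0 + K)\<bar> \<le> 1 / 2" by (simp add: D_def K_def)
  have "Re (D * z0 + K) = y + of_int j" by (simp add: K_def y_def)
  hence "\<bar>Re (D * z0 + K)\<bar> \<le> 1 / 2"
    using of_int_round_abs_le[of y] by (simp add: j_def abs_minus_commute)
  hence "\<bar>Re (D * z0 + K)\<bar>\<^sup>2 \<le> (1/2)\<^sup>2" by (intro power_mono) auto
  moreover have "\<bar>Im (D * z0 + K)\<bar>\<^sup>2 \<le> (1/2)\<^sup>2" using im by (intro power_mono) auto
  ultimately have "(cmod (D * z0 + K))\<^sup>2 \<le> 1 / 2" unfolding cmod_power2 by (simp add: power2_eq_square)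
  hence le: "phi * (cmod (D * z0 + K))\<^sup>2 \<le> phi * (1 / 2)" using phi_pos by (intro mult_left_mono) auto
  have "D * w1 + K * a0 \<noteq> 0 \<or> D * w2 + K * b0 \<noteq> 0" using det_comb[of D K] DR by auto
  hence "phi \<le> hform z t (D * w1 + K * a0) (D * w2 + K * b0)"
    using comb_in_R[OF DR(1,2), of h j] unfolding K_def by (intro minimal)
  hence "phi \<le> phi * (1 / 2) + t\<^sup>2 * (cmod D)\<^sup>2 / phi" unfolding hform_comb using le by linarith
  hence "phi\<^sup>2 \<le> 2 * (t\<^sup>2 * (cmod D)\<^sup>2)" using phi_pos by (simp add: field_simps power2_eq_square)
  moreover have "cmod D \<le> 79 / 50 * s"
  proof -
    have "cmod D = of_int k * of_int N" using hk N_pos by (simp add: D_def norm_mult)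
    also have "\<dots> \<le> real Q * of_int N" using hk N_pos by (intro mult_right_mono) linarith+
    also have "\<dots> \<le> (2 * Im tau + 1) * of_int N" using Q N_pos by (intro mult_right_mono) auto
    also have "\<dots> = s + of_int N" by (simp add: s_eq algebra_simps)
    also have "\<dots> \<le> 79 / 50 * s" using N_le_s by simp
    finally show ?thesis .
  qed
  hence "t\<^sup>2 * (cmod D)\<^sup>2 \<le> t\<^sup>2 * (79 / 50 * s)\<^sup>2" by (intro mult_left_mono power_mono) auto
  ultimately have "phi\<^sup>2 \<le> 2 * (t\<^sup>2 * (79 / 50 * s)\<^sup>2)" by linarith
  also have "\<dots> \<le> (9/4 * s * t)\<^sup>2"
  proof -
    have "2 * (t\<^sup>2 * (79 / 50 * s)\<^sup>2) = 6241 / 1250 * (t\<^sup>2 * s\<^sup>2)" "(9/4 * s * t)\<^sup>2 = 81 / 16 * (t\<^sup>2 * s\<^sup>2)"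
      by (simp_all add: power2_eq_square)
    moreover have "0 \<le> t\<^sup>2 * s\<^sup>2" by simp
    ultimately show ?thesis by linarith
  qed
  finally show ?thesis by (rule power2_le_imp_le) (use s_pos t_pos in auto)
qed

text \<open>\<open>Mq\<close> is the form in which \<delta> enters, as
  \<open>s^2 = |\<Delta>|\<close>. \<open>t_small\<close> will come from
  \<open>|\<mu>| \<ge> 14 * J * M\<close> and \<open>t \<le> 1 / |\<mu>|\<close>.\<close>

context
  assumes J1: "J \<ge> 1" and Ms: "of_int J * s \<le> M"
    and Mq: "\<And>q::nat. prime q \<Longrightarrow> int q dvd g \<Longrightarrow> s\<^sup>2 / real q \<le> M"
    and t_small: "14 * of_int J * M * t \<le> 1"
begin

lemma s_le_M: "s \<le> M"
proof -
  have "1 * s \<le> of_int J * s" using J1 s_pos by (intro mult_right_mono) auto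
  thus ?thesis using Ms by simp
qed

lemma M_pos: "M > 0" using s_le_M s_pos by linarith

lemma Mt_le: "14 * (M * t) \<le> 1"
proof -
  have "1 * (14 * (M * t)) \<le> of_int J * (14 * (M * t))" using J1 M_pos t_pos by (intro mult_right_mono) auto
  thus ?thesis using t_small by (simp add: mult_ac)
qed

lemma phi_lt_1: "phi < 1"
proof -
  have "s * t \<le> M * t" using s_le_M t_pos by (intro mult_right_mono) auto
  thus ?thesis using phi_le Mt_le by simp
qed

text \<open>If \<open>N = 1\<close>, the inverse ideal is \<open>R\<close>, so the cusp vector is
  unimodular and \<open>phi \<ge> 1\<close>. The factor 2 gained makes room in the size condition on
  the rows.\<close>

lemma N_ge_2: "N \<ge> 2"
proof (rule ccontr)
  assume "\<not> N \<ge> 2"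
  hence N1: "N = 1" using N_pos by simp
  have "of_int N * tau = tau" using N1 by simp
  hence om_tau1: "om = tau" by (simp only: N_tau)
  have "x \<in> R" if xI: "x * a0 \<in> R" "x * b0 \<in> R" for x
  proof -
    obtain p q where "x = of_int p + of_int q * tau" using xI inverse_iff by blast
    hence "x = of_int p + of_int q * om" by (simp only: om_tau1)
    thus ?thesis using om_R by (simp add: R_closed)
  qed
  hence w: "w1 \<in> R" "w2 \<in> R" using w_in by auto
  have "w2 * a0 + (- w1) * b0 = 1" using w_det by (simp add: algebra_simps)
  hence "1 \<le> hform z t a0 b0" using covered[OF cusp_in w(2) R_uminus[OF w(1)]] by blast
  thus False using phi_lt_1 by (simp add: phi_def)
qed

text \<open>The determinant lies in the cusp ideal. If it vanished, the cusp vector would be an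
  \<open>R\<close>-multiple of \<open>(e1, e2)\<close>, forcing \<open>phi \<ge> 1\<close>.\<close>

lemma touching_det:
  assumes e: "e1 \<in> R" "e2 \<in> R" "x \<in> R" "y \<in> R" "x * e1 + y * e2 = 1" and h: "hform z t e1 e2 = 1"
  shows "cmod (a0 * e2 - b0 * e1) \<ge> of_int N"
proof (rule inverse_ideal_norm)
  have tau0: "tau * a0 \<in> R" "tau * b0 \<in> R" using inverse_iff[of tau] by (auto intro: exI[of _ 0] exI[of _ 1])
  show "a0 * e2 - b0 * e1 \<in> R" using cusp_in e by (intro R_diff R_mult)
  have "(tau * a0) * e2 - (tau * b0) * e1 \<in> R" by (rule R_diff[OF R_mult[OF tau0(1) e(2)] R_mult[OF tau0(2) e(1)]])
  thus "(a0 * e2 - b0 * e1) * tau \<in> R" by (simp add: algebra_simps)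
  show "a0 * e2 - b0 * e1 \<noteq> 0"
  proof
    assume d0: "a0 * e2 - b0 * e1 = 0"
    define c where "c = x * a0 + y * b0"
    have "c * e1 = (x * e1 + y * e2) * a0 - y * (a0 * e2 - b0 * e1)"
      "c * e2 = (x * e1 + y * e2) * b0 + x * (a0 * e2 - b0 * e1)"
      by (simp_all add: c_def algebra_simps)
    hence ce: "a0 = c * e1" "b0 = c * e2" using d0 e by simp_all
    have "c \<in> R" unfolding c_def using cusp_in e by (intro R_add R_mult)
    moreover have "c \<noteq> 0" using ce w_det by auto
    ultimately have "1\<^sup>2 \<le> (cmod c)\<^sup>2" using R_cmod_ge_1 by (intro power_mono) auto
    moreover have "phi = hform z t (c * e1) (c * e2)" by (simp only: ce[symmetric] phi_def)
    hence "phi = (cmod c)\<^sup>2" unfolding hform_scale h by simp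
    ultimately show False using phi_lt_1 by simp
  qed
qed

lemma phi_J: "phi * (of_int J / 2)\<^sup>2 \<le> 9 / 16 * (of_int J * M * t)"
proof -
  have "phi * (of_int J / 2)\<^sup>2 \<le> (9/4 * s * t) * (of_int J / 2)\<^sup>2"
    using phi_le by (intro mult_right_mono) auto
  also have "\<dots> = 9 / 16 * of_int J * t * (of_int J * s)" by (simp add: power2_eq_square field_simps)
  also have "\<dots> \<le> 9 / 16 * of_int J * t * M" using J1 t_pos Ms by (intro mult_left_mono) auto
  finally show ?thesis by (simp add: mult_ac)
qed

text \<open>Unifies the two families: \<open>D0 = N\<close> if \<open>g = 1\<close>, otherwise
  \<open>D0 = N' * om\<close>. \<open>G\<close> is the error in replacing a real by an integer prime
  to \<open>g\<close>; the product \<open>G * |D0| * Im tau\<close> enters the final bound. In the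
  second case it equals \<open>|om| * s / (2 * q)\<close>, which is where
  \<open>|\<Delta>| / q \<le> M\<close> is needed.\<close>

lemma step_exists:
  obtains D0 G where "D0 \<noteq> 0" "cmod D0 * Im tau \<le> M / 2" "cmod D0 \<le> M" "G \<ge> 0" "G * (cmod D0 * Im tau) \<le> M / 2"
    "\<And>m r. m > 0 \<Longrightarrow> (of_int m)\<^sup>2 * (cmod D0)\<^sup>2 < 4 * M\<^sup>2 * of_int N \<Longrightarrow>
      (\<And>q::nat. prime q \<Longrightarrow> int q dvd m \<Longrightarrow> int q dvd N \<Longrightarrow> \<not> int q dvd r) \<Longrightarrow>
      (even m \<Longrightarrow> odd N \<Longrightarrow> even r) \<Longrightarrow> row_ok (of_int m * D0) r"
    "\<And>x::real. \<exists>r::int. \<bar>of_int r - x\<bar> \<le> G \<and> (\<forall>q::nat. prime q \<longrightarrow> int q dvd g \<longrightarrow> \<not> int q dvd r)"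
proof (cases "g = 1")
  case True
  have no: "\<not> int q dvd g" if "prime q" for q :: nat
    using True prime_gt_1_nat[OF that] by simp
  have L: "cmod (of_int N) * Im tau = s / 2" using N_pos by (simp add: s_eq)
  show ?thesis
  proof (rule that[of "of_int N" 1])
    show "(of_int N :: complex) \<noteq> 0" using N_pos by simp
    show "cmod (of_int N) * Im tau \<le> M / 2" "1 * (cmod (of_int N) * Im tau) \<le> M / 2"
      unfolding L using s_le_M by simp_all
    show "cmod (of_int N) \<le> M" using N_le_s s_le_M s_pos N_pos by simp
    show "(1::real) \<ge> 0" by simp
    show "row_ok (of_int m * of_int N) r" if m: "m > 0" and sz: "(of_int m)\<^sup>2 * (cmod (of_int N))\<^sup>2 < 4 * M\<^sup>2 * of_int N"
      and rm: "\<And>q::nat. prime q \<Longrightarrow> int q dvd m \<Longrightarrow> int q dvd N \<Longrightarrow> \<not> int q dvd r"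
      and par: "even m \<Longrightarrow> odd N \<Longrightarrow> even r" for m r
    proof -
      have "of_int (m\<^sup>2 * N) * real_of_int N < 4 * M\<^sup>2 * of_int N"
        using sz N_pos by (simp add: power2_eq_square mult_ac)
      hence "of_int (m\<^sup>2 * N) < 4 * M\<^sup>2" using N_pos by (simp only: mult_less_cancel_right_pos of_int_0_less_iff)
      hence "row_ok (of_int (m * N)) r" using row_ok_N[OF m M_pos _ _ rm par] no by blast
      thus ?thesis by simp
    qed
    show "\<exists>r::int. \<bar>of_int r - x\<bar> \<le> 1 \<and> (\<forall>q::nat. prime q \<longrightarrow> int q dvd g \<longrightarrow> \<not> int q dvd r)" for x :: real
      using of_int_round_abs_le[of x] no by (intro exI[of _ "round x"]) auto
  qed
next
  case False
  hence "nat g \<noteq> 1" using g_pos by simp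
  then obtain q where "prime q" "q dvd nat g" using prime_factor_nat by blast
  hence q: "prime q" "int q dvd g" using g_pos by (simp_all add: int_dvd_int_iff[symmetric])
  have q1: "q > 1" using q prime_gt_1_nat by blast
  have qg: "real q \<le> of_int g" using zdvd_imp_le[OF q(2) g_pos] by linarith
  have Nr: "real_of_int N = of_int g * of_int N'" using N_eq by (metis of_int_mult)
  define D0 where "D0 = of_int N' * om"
  have cD0: "cmod D0 = of_int N' * cmod om" using N'_pos by (simp add: D0_def norm_mult)
  have gp: "real_of_int g > 0" "real_of_int N' > 0" using g_pos N'_pos by simp_all
  have oms: "cmod om * s \<le> 29 / 50 * s\<^sup>2" using mult_right_mono[OF om_le_s, of s] s_pos by (simp add: power2_eq_square)
  have Mg: "s\<^sup>2 / of_int g \<le> M"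
  proof -
    have "s\<^sup>2 / of_int g \<le> s\<^sup>2 / real q" using qg q1 by (intro divide_left_mono) auto
    thus ?thesis using Mq[OF q] by linarith
  qed
  have L: "cmod D0 * Im tau = cmod om * s / (2 * of_int g)"
    using gp by (simp add: cD0 s_eq Nr field_simps)
  show ?thesis
  proof (rule that[of D0 "of_int g / real q"])
    show "D0 \<noteq> 0" using gp om_Im(2) by (auto simp: D0_def)
    have "cmod D0 * Im tau \<le> 29 / 50 * s\<^sup>2 / (2 * of_int g)" unfolding L using oms gp by (intro divide_right_mono) auto
    also have "\<dots> = 29 / 100 * (s\<^sup>2 / of_int g)" by simp
    also have "\<dots> \<le> 29 / 100 * M" using Mg by (intro mult_left_mono) auto
    finally have "cmod D0 * Im tau \<le> 29 / 100 * M" .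
    thus "cmod D0 * Im tau \<le> M / 2" using M_pos by linarith
    have "of_int g / real q * (cmod D0 * Im tau) = cmod om * s / (2 * real q)" unfolding L using gp q1 by (simp add: field_simps)
    also have "\<dots> \<le> 29 / 50 * s\<^sup>2 / (2 * real q)" using oms by (intro divide_right_mono) auto
    also have "\<dots> = 29 / 100 * (s\<^sup>2 / real q)" by simp
    also have "\<dots> \<le> 29 / 100 * M" using Mq[OF q] by (intro mult_left_mono) auto
    finally have "of_int g / real q * (cmod D0 * Im tau) \<le> 29 / 100 * M" .
    thus "of_int g / real q * (cmod D0 * Im tau) \<le> M / 2" using M_pos by linarith
    have "of_int g * cmod D0 = of_int N * cmod om" by (simp add: cD0 Nr)
    also have "\<dots> \<le> (29 / 50 * s) * (29 / 50 * s)" using N_le_s om_le_s s_pos by (intro mult_mono) auto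
    also have "\<dots> \<le> s\<^sup>2" by (simp add: power2_eq_square)
    finally have "cmod D0 \<le> s\<^sup>2 / of_int g" using gp by (simp add: field_simps)
    thus "cmod D0 \<le> M" using Mg by linarith
    show "of_int g / real q \<ge> 0" using gp by simp
    show "row_ok (of_int m * D0) r" if m: "m > 0" and sz: "(of_int m)\<^sup>2 * (cmod D0)\<^sup>2 < 4 * M\<^sup>2 * of_int N"
      and rm: "\<And>q::nat. prime q \<Longrightarrow> int q dvd m \<Longrightarrow> int q dvd N \<Longrightarrow> \<not> int q dvd r"
      and par: "even m \<Longrightarrow> odd N \<Longrightarrow> even r" for m r
    proof -
      have "(cmod D0)\<^sup>2 = of_int (N'\<^sup>2 * (N * C))" unfolding cD0 power_mult_distrib om_cmod by simp
      hence "of_int (m\<^sup>2 * (N'\<^sup>2 * C)) * real_of_int N < 4 * M\<^sup>2 * of_int N"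
        using sz by (simp add: mult_ac)
      hence "of_int (m\<^sup>2 * (N'\<^sup>2 * C)) < 4 * M\<^sup>2" using N_pos by (simp only: mult_less_cancel_right_pos of_int_0_less_iff)
      from row_ok_N'om[OF m M_pos this rm par] show ?thesis unfolding D0_def by blast
    qed
    show "\<exists>r::int. \<bar>of_int r - x\<bar> \<le> of_int g / real q \<and> (\<forall>q::nat. prime q \<longrightarrow> int q dvd g \<longrightarrow> \<not> int q dvd r)" for x :: real
      by (rule coprime_g_approx[OF q])
  qed
qed

text \<open>Dirichlet approximation with a denominator close to the balance point of the two terms.\<close>

lemma step_large:
  assumes D0: "D0 \<noteq> 0" "cmod D0 * Im tau \<le> M / 2" 
    and ok: "\<And>m r. m > 0 \<Longrightarrow> (of_int m)\<^sup>2 * (cmod D0)\<^sup>2 < 4 * M\<^sup>2 * of_int N \<Longrightarrow>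
      (\<And>q::nat. prime q \<Longrightarrow> int q dvd m \<Longrightarrow> int q dvd N \<Longrightarrow> \<not> int q dvd r) \<Longrightarrow>
      (even m \<Longrightarrow> odd N \<Longrightarrow> even r) \<Longrightarrow> row_ok (of_int m * D0) r"
  shows "Im tau * phi < t * cmod D0"
proof (rule ccontr)
  assume "\<not> ?thesis"
  hence ge: "t * cmod D0 \<le> Im tau * phi" by simp
  define A where "A = cmod D0"
  have A: "A > 0" using D0 by (simp add: A_def)
  \<comment> \<open>At this denominator \<open>phi * (Im tau / x)^2\<close> and
    \<open>t^2 * x^2 * A^2 / phi\<close> are equal.\<close>
  define x where "x = sqrt (Im tau * phi / (t * A))"
  have x2: "x\<^sup>2 = Im tau * phi / (t * A)" unfolding x_def using tau_Im phi_pos t_pos A by simp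
  have "1 \<le> Im tau * phi / (t * A)" using ge t_pos A by (simp add: A_def field_simps)
  hence x1: "x \<ge> 1" unfolding x_def by simp
  define Q where "Q = nat \<lfloor>x\<rfloor>"
  have fl: "\<lfloor>x\<rfloor> \<ge> 1" using x1 by simp
  hence Qx: "real Q = of_int \<lfloor>x\<rfloor>" unfolding Q_def by simp
  have "real_of_int \<lfloor>x\<rfloor> \<ge> 1" using fl by linarith
  moreover have "of_int \<lfloor>x\<rfloor> \<le> x" "x < of_int \<lfloor>x\<rfloor> + 1" by linarith+
  ultimately have Q: "real Q \<le> x" "x \<le> 2 * real Q" unfolding Qx by linarith+
  have Q0: "Q > 0" unfolding Q_def using fl by simp
  note Q = Q0 Q
  obtain h k where hk: "coprime h k" "0 < k" "k \<le> int Q"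
    "\<bar>of_int k * (- Im (D0 * z0) / Im tau) - of_int h\<bar> < 1 / real Q"
    using Dirichlet_approx_coprime[OF Q(1)] by metis
  have kQ: "real_of_int k \<le> real Q" using hk(3) by linarith
  \<comment> \<open>If \<open>k\<close> is even and \<open>N\<close> odd, then \<open>h\<close> is
    odd, against the parity condition on rows; doubling both repairs this. In the other cases
    coprimality of \<open>h\<close> and \<open>k\<close> is enough.\<close>
  define c :: int where "c = (if even k \<and> odd N then 2 else 1)"
  define m r where "m = c * k" "r = c * h"
  have c: "c > 0" "c \<le> 2" by (auto simp: c_def)
  have m0: "m > 0" using c hk by (simp add: m_r_def)
  have mQ: "real_of_int m \<le> 2 * real Q"
  proof -
    have "real_of_int m = of_int c * of_int k" by (simp add: m_r_def)
    also have "\<dots> \<le> 2 * real Q" using c hk kQ by (intro mult_mono) auto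
    finally show ?thesis .
  qed
  hence mx: "real_of_int m \<le> 2 * x" using Q by linarith
  define E where "E = Im (of_int k * D0 * z0 + of_int h * tau)"
  have e1: "Im (of_int m * D0 * z0 + of_int r * tau) = of_int c * E"
    by (simp add: E_def m_r_def algebra_simps)
  have e2: "\<bar>E\<bar> \<le> 1 / real Q * Im tau"
    unfolding E_def using hk by (intro Im_row_bound[of 1]) auto
  have "\<bar>Im (of_int m * D0 * z0 + of_int r * tau)\<bar> = of_int c * \<bar>E\<bar>"
    unfolding e1 abs_mult using c by simp
  also have "\<dots> \<le> 2 * (1 / real Q * Im tau)" using c e2 by (intro mult_mono) auto
  also have "\<dots> \<le> 4 * Im tau / x" using Q x1 tau_Im by (simp add: field_simps)
  finally have "\<bar>Im (of_int m * D0 * z0 + of_int r * tau)\<bar>\<^sup>2 \<le> (4 * Im tau / x)\<^sup>2" by (intro power_mono) auto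
  hence "phi * (Im (of_int m * D0 * z0 + of_int r * tau))\<^sup>2 \<le> phi * (4 * Im tau / x)\<^sup>2"
    using phi_pos by (intro mult_left_mono) auto
  also have "\<dots> = 16 * phi * (Im tau)\<^sup>2 / x\<^sup>2" by (simp add: power_divide power_mult_distrib)
  also have "\<dots> = 16 * t * (A * Im tau)" unfolding x2 using tau_Im phi_pos t_pos A by (simp add: field_simps power2_eq_square)
  finally have b1: "phi * (Im (of_int m * D0 * z0 + of_int r * tau))\<^sup>2 \<le> 16 * t * (A * Im tau)" .
  have m2: "(of_int m)\<^sup>2 \<le> 4 * x\<^sup>2" using power_mono[OF mx, of 2] m0 by (simp add: power_mult_distrib)
  have mA: "(of_int m)\<^sup>2 * A\<^sup>2 \<le> 4 * (A * Im tau) * (phi / t)"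
  proof -
    have "(of_int m)\<^sup>2 * A\<^sup>2 \<le> 4 * x\<^sup>2 * A\<^sup>2" using m2 by (intro mult_right_mono) auto
    also have "\<dots> = 4 * (A * Im tau) * (phi / t)" unfolding x2 using t_pos A by (simp add: field_simps power2_eq_square)
    finally show ?thesis .
  qed
  have "t\<^sup>2 * (cmod (of_int m * D0))\<^sup>2 / phi = t\<^sup>2 * ((of_int m)\<^sup>2 * A\<^sup>2) / phi"
    by (simp add: A_def norm_mult power_mult_distrib)
  also have "\<dots> \<le> t\<^sup>2 * (4 * (A * Im tau) * (phi / t)) / phi"
    using mA phi_pos by (intro divide_right_mono mult_left_mono) auto
  also have "\<dots> = 4 * t * (A * Im tau)" using phi_pos t_pos by (simp add: field_simps power2_eq_square)
  finally have b2: "t\<^sup>2 * (cmod (of_int m * D0))\<^sup>2 / phi \<le> 4 * t * (A * Im tau)" .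
  have "row_ok (of_int m * D0) r"
  proof (rule ok[OF m0])
    have "phi / t \<le> 9/4 * M" 
    proof -
      have "phi / t \<le> 9/4 * s" using phi_le t_pos by (simp add: field_simps)
      thus ?thesis using s_le_M by linarith
    qed
    \<comment> \<open>The bound is \<open>9/2 * M^2\<close>, and \<open>N \<ge> 2\<close> leaves
      room for it below \<open>4 * M^2 * N\<close>.\<close>
    hence "4 * (A * Im tau) * (phi / t) \<le> 4 * (M / 2) * (9/4 * M)"
      using D0(2) A tau_Im phi_pos t_pos M_pos unfolding A_def by (intro mult_mono) auto
    also have "\<dots> < 4 * M\<^sup>2 * 2" using M_pos by (simp add: power2_eq_square)
    also have "\<dots> \<le> 4 * M\<^sup>2 * of_int N" using N_ge_2 M_pos by (intro mult_left_mono) auto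
    finally show "(of_int m)\<^sup>2 * (cmod D0)\<^sup>2 < 4 * M\<^sup>2 * of_int N" using mA unfolding A_def by linarith
    show "\<not> int q dvd r" if q: "prime q" "int q dvd m" "int q dvd N" for q :: nat
    proof -
      have nc: "\<not> int q dvd c"
      proof
        assume qc: "int q dvd c"
        have "q \<noteq> 1" using q by auto
        hence c2: "c = 2" "odd N" using qc by (auto simp: c_def split: if_splits)
        hence "int q dvd int 2" using qc by simp
        hence "q dvd 2" by (simp only: int_dvd_int_iff)
        hence "q = 2" using primes_dvd_imp_eq[OF q(1) two_is_prime_nat] by simp
        thus False using q(3) c2 by simp
      qed
      hence "int q dvd k" using q prime_int_dvd_mult[OF q(1), of c k] by (simp add: m_r_def)
      hence "\<not> int q dvd h" using hk(1) q(1) by (metis coprime_common_divisor int_dvd_int_iff not_prime_unit zdvd1_eq of_nat_1 prime_nat_int_transfer)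
      thus ?thesis using nc prime_int_dvd_mult[OF q(1), of c h] by (auto simp: m_r_def)
    qed
    show "even r" if "even m" "odd N"
      using that by (auto simp: m_r_def c_def split: if_splits)
  qed
  \<comment> \<open>With \<open>A * Im tau \<le> M / 2\<close> the right side is at most
    \<open>(8 + 9/16 + 2) * J * M * t\<close>, and \<open>169/16 < 14\<close>.\<close>
  hence "1 \<le> 16 * t * (A * Im tau) + 9 / 16 * (of_int J * M * t) + 4 * t * (A * Im tau)"
    unfolding row_ok_def distrib_left using b1 b2 phi_J by linarith
  moreover have "t * (A * Im tau) \<le> t * (M / 2)" using D0(2) t_pos unfolding A_def by (intro mult_left_mono) auto
  moreover have "1 * (M * t) \<le> of_int J * (M * t)" using J1 M_pos t_pos by (intro mult_right_mono) auto
  moreover have "14 * (of_int J * M * t) \<le> 1" using t_small by (simp add: mult_ac)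
  ultimately show False by (simp add: mult_ac)
qed

text \<open>In the deep case the row over \<open>D0\<close> shows that \<open>phi / t^2\<close> is
  at most about \<open>|D0|^2\<close>, which bounds the determinant of a touching vector with the
  cusp vector. The row over \<open>N\<close>, a lower bound for the modulus of such a determinant,
  bounds its \<open>kap\<close>. Both bounds apply to \<open>(1, 0)\<close> and to
  \<open>(e1, e2)\<close>, whose determinant is \<open>e2\<close>.\<close>

lemma touching_bound:
  assumes e: "e1 \<in> R" "e2 \<in> R" "x \<in> R" "y \<in> R" "x * e1 + y * e2 = 1" and h: "hform z t e1 e2 = 1"
  shows "cmod e2 \<le> 4 * of_int J * M"
proof -
  obtain D0 G where D0: "D0 \<noteq> 0" "cmod D0 * Im tau \<le> M / 2" "cmod D0 \<le> M"
    and G: "G \<ge> 0" "G * (cmod D0 * Im tau) \<le> M / 2"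
    and ok: "\<And>m r. m > 0 \<Longrightarrow> (of_int m)\<^sup>2 * (cmod D0)\<^sup>2 < 4 * M\<^sup>2 * of_int N \<Longrightarrow>
      (\<And>q::nat. prime q \<Longrightarrow> int q dvd m \<Longrightarrow> int q dvd N \<Longrightarrow> \<not> int q dvd r) \<Longrightarrow>
      (even m \<Longrightarrow> odd N \<Longrightarrow> even r) \<Longrightarrow> row_ok (of_int m * D0) r"
    and appr: "\<And>x::real. \<exists>r::int. \<bar>of_int r - x\<bar> \<le> G \<and> (\<forall>q::nat. prime q \<longrightarrow> int q dvd g \<longrightarrow> \<not> int q dvd r)"
    by (rule step_exists) blast
  define A where "A = cmod D0"
  have A: "A > 0" using D0 by (simp add: A_def)
  have small: "Im tau * phi < t * A" unfolding A_def using step_large[OF D0(1,2) ok] .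
  have JM: "14 * (of_int J * M * t) \<le> 1" using t_small by (simp add: mult_ac)
  have AM: "A * Im tau \<le> M / 2" "A \<le> M" using D0 by (simp_all add: A_def)
  define r where "r = round (- Im (D0 * z0) / Im tau)"
  have "\<bar>of_int 1 * (- Im (D0 * z0) / Im tau) - of_int r\<bar> \<le> 1 / 2"
    using of_int_round_abs_le[of "- Im (D0 * z0) / Im tau"] by (simp add: r_def abs_minus_commute)
  hence "\<bar>Im (of_int 1 * D0 * z0 + of_int r * tau)\<bar> \<le> 1 / 2 * Im tau" by (intro Im_row_bound[of 1]) auto
  hence "\<bar>Im (of_int 1 * D0 * z0 + of_int r * tau)\<bar>\<^sup>2 \<le> (1 / 2 * Im tau)\<^sup>2" by (intro power_mono) auto
  hence "phi * (Im (of_int 1 * D0 * z0 + of_int r * tau))\<^sup>2 \<le> phi * (1 / 2 * Im tau)\<^sup>2"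
    using phi_pos by (intro mult_left_mono) auto
  also have "\<dots> = (Im tau * phi) * Im tau / 4" by (simp add: power2_eq_square)
  also have "\<dots> \<le> (t * A) * Im tau / 4" using small tau_Im by (intro divide_right_mono mult_right_mono) auto
  also have "\<dots> = t * (A * Im tau) / 4" by simp
  also have "\<dots> \<le> t * (M / 2) / 4" using AM t_pos by (intro divide_right_mono mult_left_mono) auto
  finally have b1: "phi * (Im (of_int 1 * D0 * z0 + of_int r * tau))\<^sup>2 \<le> M * t / 8" by (simp add: mult_ac)
  have "row_ok (of_int 1 * D0) r"
  proof (rule ok)
    have "(cmod D0)\<^sup>2 \<le> M\<^sup>2" using D0(3) by (intro power_mono) auto
    also have "\<dots> < 4 * M\<^sup>2 * 2" using M_pos by simp
    also have "\<dots> \<le> 4 * M\<^sup>2 * of_int N" using N_ge_2 M_pos by (intro mult_left_mono) auto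
    finally show "(of_int 1)\<^sup>2 * (cmod D0)\<^sup>2 < 4 * M\<^sup>2 * of_int N" by simp
  qed (auto simp: not_prime_unit)
  hence "1 \<le> M * t / 8 + 9 / 16 * (of_int J * M * t) + t\<^sup>2 * (cmod (of_int 1 * D0))\<^sup>2 / phi"
    unfolding row_ok_def distrib_left using b1 phi_J by linarith
  \<comment> \<open>The first two terms are at most \<open>(1/8 + 9/16) / 14 < 1/10\<close>.\<close>
  hence "9 / 10 \<le> t\<^sup>2 * A\<^sup>2 / phi" using JM Mt_le by (simp add: A_def)
  hence deep: "phi / t\<^sup>2 \<le> 10 / 9 * A\<^sup>2" using phi_pos t_pos by (simp add: field_simps)
  obtain r' :: int where r': "\<bar>of_int r' - (- Im (of_int N * z0) / Im tau)\<bar> \<le> G"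
      "\<And>q::nat. prime q \<Longrightarrow> int q dvd g \<Longrightarrow> \<not> int q dvd r'" using appr by blast
  have "row_ok (of_int (1 * N)) r'"
  proof (rule row_ok_N)
    have "s * s \<le> M * M" using s_le_M s_pos by (intro mult_mono) auto
    moreover have "of_int N \<le> s * s"
    proof -
      have "of_int N * 1 \<le> real_of_int N * of_int C" using N_pos C_pos by (intro mult_left_mono) auto
      also have "\<dots> = of_int (N * C)" by simp
      also have "\<dots> \<le> s\<^sup>2"
      proof -
        have "N * C \<le> 4 * (N * C) - B\<^sup>2" using NC_le mult_pos_pos[OF N_pos C_pos] by linarith
        thus ?thesis unfolding s_sq by (simp only: of_int_le_iff)
      qed
      finally show ?thesis by (simp add: power2_eq_square)
    qed
    moreover have "0 < M * M" using M_pos by simp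
    ultimately have "of_int N < 4 * (M * M)" by linarith
    thus "of_int (1\<^sup>2 * N) < 4 * M\<^sup>2" by (simp add: power2_eq_square)
  qed (use M_pos r' in \<open>auto simp: not_prime_unit\<close>)
  moreover have "\<bar>Im (of_int 1 * of_int N * z0 + of_int r' * tau)\<bar> \<le> G * Im tau"
    using r'(1) by (intro Im_row_bound[of 1]) (auto simp: abs_minus_commute)
  hence "\<bar>Im (of_int 1 * of_int N * z0 + of_int r' * tau)\<bar>\<^sup>2 \<le> (G * Im tau)\<^sup>2" by (intro power_mono) auto
  hence "phi * ((Im (of_int 1 * of_int N * z0 + of_int r' * tau))\<^sup>2 + (of_int J / 2)\<^sup>2) \<le> phi * ((G * Im tau)\<^sup>2 + (of_int J / 2)\<^sup>2)"
    using phi_pos by (intro mult_left_mono) auto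
  ultimately have rowN: "1 \<le> phi * ((G * Im tau)\<^sup>2 + (of_int J / 2)\<^sup>2) + t\<^sup>2 * (of_int N)\<^sup>2 / phi"
    unfolding row_ok_def by simp
  have J0: "of_int J / 2 \<ge> (0::real)" "G * Im tau \<ge> 0" using J1 G tau_Im by auto
  have bounds: "cmod (kap f1 f2) \<le> G * Im tau + of_int J / 2 \<and> cmod (a0 * f2 - b0 * f1) \<le> 11 / 10 * A"
    if f: "f1 \<in> R" "f2 \<in> R" "x \<in> R" "y \<in> R" "x * f1 + y * f2 = 1" "hform z t f1 f2 = 1" for f1 f2 x y
  proof -
    have eq: "1 = phi * (cmod (kap f1 f2))\<^sup>2 + t\<^sup>2 * (cmod (a0 * f2 - b0 * f1))\<^sup>2 / phi"
      using hform_decomp[of f1 f2] f(6) by simp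
    \<comment> \<open>The determinant term of a touching vector is at least that of the row over
      \<open>N\<close>, while its total is 1; so its \<open>kap\<close> term is at most the first
      term of that row.\<close>
    have "of_int N \<le> cmod (a0 * f2 - b0 * f1)" by (rule touching_det[OF f])
    hence "(of_int N)\<^sup>2 \<le> (cmod (a0 * f2 - b0 * f1))\<^sup>2" using N_pos by (intro power_mono) auto
    hence "t\<^sup>2 * (of_int N)\<^sup>2 / phi \<le> t\<^sup>2 * (cmod (a0 * f2 - b0 * f1))\<^sup>2 / phi"
      using phi_pos by (intro divide_right_mono mult_left_mono) auto
    hence "phi * (cmod (kap f1 f2))\<^sup>2 \<le> phi * ((G * Im tau)\<^sup>2 + (of_int J / 2)\<^sup>2)"
      using eq rowN by linarith
    hence "(cmod (kap f1 f2))\<^sup>2 \<le> (G * Im tau)\<^sup>2 + (of_int J / 2)\<^sup>2" using phi_pos by simp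
    also have "\<dots> \<le> (G * Im tau + of_int J / 2)\<^sup>2"
      using mult_nonneg_nonneg[OF J0] unfolding power2_sum by (simp add: mult_ac)
    finally have 1: "cmod (kap f1 f2) \<le> G * Im tau + of_int J / 2"
      by (rule power2_le_imp_le) (use J0 in auto)
    have "t\<^sup>2 * (cmod (a0 * f2 - b0 * f1))\<^sup>2 / phi \<le> 1" using eq phi_pos by (smt (verit) mult_nonneg_nonneg zero_le_power2)
    hence "(cmod (a0 * f2 - b0 * f1))\<^sup>2 \<le> phi / t\<^sup>2" using phi_pos t_pos by (simp add: field_simps)
    also have "\<dots> \<le> (11 / 10 * A)\<^sup>2"
    proof -
      have "(11 / 10 * A)\<^sup>2 = 121 / 100 * A\<^sup>2" by (simp add: power2_eq_square)
      thus ?thesis using deep zero_le_power2[of A] by linarith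
    qed
    finally have 2: "cmod (a0 * f2 - b0 * f1) \<le> 11 / 10 * A" by (rule power2_le_imp_le) (use A in auto)
    show ?thesis using 1 2 by blast
  qed
  have h1: "hform z t 1 0 = 1" by (simp add: hform_def)
  have be: "cmod (kap e1 e2) \<le> G * Im tau + of_int J / 2" "cmod (a0 * e2 - b0 * e1) \<le> 11 / 10 * A"
    using bounds[OF e h] by auto
  have b1: "cmod (kap 1 0) \<le> G * Im tau + of_int J / 2" "cmod (a0 * 0 - b0 * 1) \<le> 11 / 10 * A"
    using bounds[OF R_1 R_0 R_1 R_0 _ h1] by auto
  have "e2 = kap 1 0 * (a0 * e2 - b0 * e1) - kap e1 e2 * (a0 * 0 - b0 * 1)"
    using det_kap[of 1 e2 0 e1] by simp
  hence "cmod e2 \<le> cmod (kap 1 0 * (a0 * e2 - b0 * e1)) + cmod (kap e1 e2 * (a0 * 0 - b0 * 1))"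
    by (metis norm_triangle_ineq4)
  also have "\<dots> \<le> (G * Im tau + of_int J / 2) * (11 / 10 * A) + (G * Im tau + of_int J / 2) * (11 / 10 * A)"
    unfolding norm_mult using be b1 J0 by (intro add_mono mult_mono) auto
  also have "\<dots> = 11 / 5 * (G * (A * Im tau)) + 11 / 10 * (of_int J * A)" by (simp add: algebra_simps)
  also have "\<dots> \<le> 11 / 5 * (M / 2) + 11 / 10 * (of_int J * M)"
    using G(2) AM J1 unfolding A_def by (intro add_mono mult_left_mono) auto
  also have "\<dots> \<le> 4 * of_int J * M"
  proof -
    have "1 * M \<le> of_int J * M" using J1 M_pos by (intro mult_right_mono) auto
    thus ?thesis unfolding mult.assoc using M_pos by linarith
  qed
  finally show ?thesis .
qed

end

end

end

section \<open>The ring of integers\<close>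

lemma complex_ring_simps:
  "carrier complex_ring = UNIV" "x \<otimes>\<^bsub>complex_ring\<^esub> y = x * y" "x \<oplus>\<^bsub>complex_ring\<^esub> y = x + y"
  "\<zero>\<^bsub>complex_ring\<^esub> = 0" "\<one>\<^bsub>complex_ring\<^esub> = 1"
  by (auto simp: complex_ring_def)

lemma complex_subfield:
  assumes K: "subfield K complex_ring"
  shows "1 \<in> K" "0 \<in> K" "x \<in> K \<Longrightarrow> y \<in> K \<Longrightarrow> x + y \<in> K" "x \<in> K \<Longrightarrow> y \<in> K \<Longrightarrow> x * y \<in> K"
    "x \<in> K \<Longrightarrow> - x \<in> K" "x \<in> K \<Longrightarrow> y \<in> K \<Longrightarrow> y \<noteq> 0 \<Longrightarrow> x / y \<in> K"
proof -
  interpret C: ring complex_ring by (rule ring_complex_ring)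
  note sub = subringE[OF subfieldE(1)[OF K], unfolded complex_ring_simps]
  show "1 \<in> K" "0 \<in> K" using sub by auto
  show "x \<in> K \<Longrightarrow> y \<in> K \<Longrightarrow> x + y \<in> K" and m: "x \<in> K \<Longrightarrow> y \<in> K \<Longrightarrow> x * y \<in> K" for x y
    using sub(6,7) by auto
  have "\<ominus>\<^bsub>complex_ring\<^esub> x = - x" for x
    using C.minus_equality[of "- x" x] by (simp add: complex_ring_simps)
  thus "x \<in> K \<Longrightarrow> - x \<in> K" for x using sub(5) by metis
  show "x / y \<in> K" if "x \<in> K" "y \<in> K" "y \<noteq> 0" for x y
  proof -
    have y: "y \<in> K - {\<zero>\<^bsub>complex_ring\<^esub>}" using that by (simp add: complex_ring_simps)
    have i: "inv\<^bsub>complex_ring\<^esub> y \<in> K" using C.subfield_m_inv(1)[OF K y] by simp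
    have "y * inv\<^bsub>complex_ring\<^esub> y = 1" using C.subfield_m_inv(2)[OF K y] by (simp add: complex_ring_simps)
    hence "inv\<^bsub>complex_ring\<^esub> y = 1 / y" using that by (simp add: field_simps)
    thus ?thesis using m[OF that(1) i] by simp
  qed
qed

lemma dimension_2_span:
  assumes "ring.dimension complex_ring 2 \<rat> K"
  obtains a b where "K = {p * a + q * b | p q. p \<in> \<rat> \<and> q \<in> \<rat>}"
proof -
  interpret C: ring complex_ring by (rule ring_complex_ring)
  have "C.dimension (Suc (Suc 0)) \<rat> K" using assms by (simp add: numeral_2_eq_2)
  then obtain a E where 1: "K = C.line_extension \<rat> a E" "C.dimension (Suc 0) \<rat> E"
    by (auto elim: C.dimension.cases)
  from 1(2) obtain b E' where 2: "E = C.line_extension \<rat> b E'" "C.dimension 0 \<rat> E'"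
    by (auto elim: C.dimension.cases)
  from 2(2) have "E' = {0}" by (auto elim: C.dimension.cases simp: complex_ring_simps)
  hence "K = {p * a + q * b | p q. p \<in> \<rat> \<and> q \<in> \<rat>}"
  proof -
    have le: "C.line_extension A c B = {k * c + e | k e. k \<in> A \<and> e \<in> B}" for A c B
      unfolding C.line_extension_def set_add_def set_mult_def r_coset_def
      by (auto simp: complex_ring_def)
    show ?thesis unfolding 1(1) 2(1) \<open>E' = {0}\<close> le by (auto simp: add.assoc)
  qed
  thus ?thesis using that by blast
qed

text \<open>Multiplication by \<open>x\<close> on the rational plane \<open>K\<close> has the rational trace and norm of \<open>x\<close>.\<close>

lemma quadratic_trace_norm:
  assumes K: "imaginary_quadratic_field K" and x: "x \<in> K"
  shows "x + cnj x \<in> \<rat>" "x * cnj x \<in> \<rat>"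
proof -
  note F = complex_subfield[OF K[unfolded imaginary_quadratic_field_def, THEN conjunct1]]
  obtain a b where ab: "K = {p * a + q * b | p q. p \<in> \<rat> \<and> q \<in> \<rat>}"
    by (rule dimension_2_span[OF K[unfolded imaginary_quadratic_field_def, THEN conjunct2, THEN conjunct1]]) (rule that)
  have nr: "\<not> K \<subseteq> \<real>" using K by (simp add: imaginary_quadratic_field_def)
  have inK: "p * a + q * b \<in> K" if "p \<in> \<rat>" "q \<in> \<rat>" for p q using that unfolding ab by blast
  have "1 * a + 0 * b \<in> K" "0 * a + 1 * b \<in> K" by (rule inK; simp)+
  hence "x * a \<in> K" "x * b \<in> K" using F(4)[OF x] by simp_all
  then obtain p q r s' where pq: "p \<in> \<rat>" "q \<in> \<rat>" "r \<in> \<rat>" "s' \<in> \<rat>"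
    "x * a = p * a + q * b" "x * b = r * a + s' * b" unfolding ab by blast
  have RR: "\<rat> \<subseteq> (\<real> :: complex set)" by (auto elim!: Rats_cases')
  hence rat: "x \<in> \<rat> \<Longrightarrow> cnj x = x" using Reals_cnj_iff by blast
  have ratcase: "(x + cnj x \<in> \<rat>) \<and> (x * cnj x \<in> \<rat>)" if "x \<in> \<rat>" using that rat by (simp add: Rats_add Rats_mult)
  have "(x + cnj x \<in> \<rat>) \<and> (x * cnj x \<in> \<rat>)"
  proof (cases "a = 0")
    case a0: True
    have "b \<noteq> 0" using F(1) a0 unfolding ab by auto
    hence "x = s'" using pq a0 by simp
    thus ?thesis using ratcase pq by blast
  next
    case a0: False
    show ?thesis
    proof (cases "q = 0")
      case True
      hence "x = p" using pq a0 by simp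
      thus ?thesis using ratcase pq by blast
    next
      case q0: False
      have b: "b = (x - p) / q * a" using pq q0 by (simp add: field_simps)
      have "x * ((x - p) * a) = q * (x * b)" using b q0 by simp
      also have "\<dots> = q * r * a + s' * (q * b)" using pq by (simp add: algebra_simps)
      also have "q * b = (x - p) * a" using b q0 by simp
      \<comment> \<open>Cayley-Hamilton for the matrix with rows \<open>(p, q)\<close> and
        \<open>(r, s')\<close>.\<close>
      finally have "a * (x * x - (p + s') * x + (p * s' - q * r)) = 0" by (simp add: algebra_simps)
      hence root: "x * x - (p + s') * x + (p * s' - q * r) = 0" using a0 by simp
      have nonreal: "x \<notin> \<real>"
      proof
        assume xr: "x \<in> \<real>"
        have c: "\<exists>c\<in>\<real>. y = c * a" if "y \<in> K" for y
        proof -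
          obtain u v where uv: "u \<in> \<rat>" "v \<in> \<rat>" "y = u * a + v * b" using \<open>y \<in> K\<close> unfolding ab by blast
          have "y = (u + v * ((x - p) / q)) * a" unfolding uv(3) by (subst b) (simp add: algebra_simps)
          moreover have "u + v * ((x - p) / q) \<in> \<real>" using uv pq xr RR by (intro Reals_add Reals_mult Reals_divide Reals_diff) auto
          ultimately show ?thesis by blast
        qed
        obtain c1 where c1: "c1 \<in> \<real>" "1 = c1 * a" using c[OF F(1)] by blast
        have "c1 \<noteq> 0" using c1(2) by auto
        hence "a = 1 / c1" using c1(2) by (simp add: field_simps)
        hence "a \<in> \<real>" using c1 by simp
        hence "K \<subseteq> \<real>" using c Reals_mult by blast
        thus False using nr by blast
      qed
      have cr: "cnj y = y" if "y \<in> \<rat>" for y using that RR Reals_cnj_iff by blast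
      have "cnj (x * x - (p + s') * x + (p * s' - q * r)) = 0" using root by simp
      hence root': "cnj x * cnj x - (p + s') * cnj x + (p * s' - q * r) = 0" using pq cr by simp
      \<comment> \<open>\<open>x\<close> and \<open>cnj x\<close> are distinct roots of one
        quadratic, which gives trace and norm by Vieta.\<close>
      have "(x - cnj x) * (x + cnj x - (p + s'))
        = (x * x - (p + s') * x + (p * s' - q * r)) - (cnj x * cnj x - (p + s') * cnj x + (p * s' - q * r))"
        by (simp add: algebra_simps)
      hence "(x - cnj x) * (x + cnj x - (p + s')) = 0" unfolding root root' by simp
      moreover have "x - cnj x \<noteq> 0" using nonreal Reals_cnj_iff by force
      ultimately have tr: "x + cnj x = p + s'" by simp
      have "x * cnj x = p * s' - q * r"
      proof -
        have "x * cnj x = x * (x + cnj x) - x * x" by (simp add: algebra_simps)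
        also have "\<dots> = (p * s' - q * r) - (x * x - (p + s') * x + (p * s' - q * r))"
          unfolding tr by (simp add: algebra_simps)
        finally show ?thesis unfolding root by simp
      qed
      thus ?thesis using tr pq by (simp add: Rats_add Rats_mult Rats_diff)
    qed
  qed
  thus "x + cnj x \<in> \<rat>" "x * cnj x \<in> \<rat>" by auto
qed

lemma of_int_poly_eval:
  fixes x :: complex
  shows "poly (map_poly of_int (p * q)) x = poly (map_poly of_int p) x * poly (map_poly of_int q) x"
    "poly (map_poly of_int (p + q)) x = poly (map_poly of_int p) x + poly (map_poly of_int q) x"
    "poly (map_poly of_int (smult c p)) x = of_int c * poly (map_poly of_int p) x"
proof -
  have "map_poly of_int (p * q) = map_poly of_int p * (map_poly of_int q :: complex poly)"
    by (rule poly_eqI) (simp add: coeff_map_poly coeff_mult)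
  thus "poly (map_poly of_int (p * q)) x = poly (map_poly of_int p) x * poly (map_poly of_int q) x" by simp
  have "map_poly of_int (p + q) = map_poly of_int p + (map_poly of_int q :: complex poly)"
    by (rule poly_eqI) (simp add: coeff_map_poly)
  thus "poly (map_poly of_int (p + q)) x = poly (map_poly of_int p) x + poly (map_poly of_int q) x" by simp
  have "map_poly of_int (smult c p) = smult (of_int c) (map_poly of_int p :: complex poly)"
    by (rule poly_eqI) (simp add: coeff_map_poly)
  thus "poly (map_poly of_int (smult c p)) x = of_int c * poly (map_poly of_int p) x" by simp
qed

text \<open>Gauss's lemma: the primitive integral multiple of the minimal polynomial divides a monic
  integral polynomial, so its leading coefficient is a unit.\<close>

lemma algebraic_int_trace_norm:
  assumes x: "algebraic_int (x::complex)" "Im x \<noteq> 0" and rat: "x + cnj x \<in> \<rat>" "x * cnj x \<in> \<rat>"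
  shows "x + cnj x \<in> \<int>" "x * cnj x \<in> \<int>"
proof -
  obtain a1 b1 where T: "b1 > 0" "x + cnj x = of_int a1 / of_int b1" using rat(1) by (auto elim: Rats_cases')
  obtain a2 b2 where Nn: "b2 > 0" "x * cnj x = of_int a2 / of_int b2" using rat(2) by (auto elim: Rats_cases')
  define f0 where "f0 = [:a2 * b1, - (a1 * b2), b1 * b2:]"
  define f where "f = primitive_part f0"
  define ct where "ct = content f0"
  have f0: "f0 \<noteq> 0" "degree f0 = 2" using T Nn by (simp_all add: f0_def)
  have f0f: "f0 = smult ct f" by (simp add: ct_def f_def)
  have ct0: "ct \<noteq> 0" using f0 by (simp add: ct_def)
  have f: "f \<noteq> 0" "degree f = 2" "content f = 1" using f0 by (simp_all add: f_def)
  have ct: "b1 * b2 = ct * coeff f 2" "- (a1 * b2) = ct * coeff f 1" "a2 * b1 = ct * coeff f 0"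
    using arg_cong[OF f0f, of "\<lambda>p. coeff p 2"] arg_cong[OF f0f, of "\<lambda>p. coeff p 1"]
      arg_cong[OF f0f, of "\<lambda>p. coeff p 0"] by (simp_all add: f0_def numeral_2_eq_2)
  have "poly (map_poly of_int f0) x = of_int (b1 * b2) * (x * x - (x + cnj x) * x + x * cnj x)"
    unfolding T(2) Nn(2) using T(1) Nn(1) by (simp add: f0_def map_poly_pCons field_simps)
  also have "\<dots> = 0" by (simp add: algebra_simps)
  finally have "of_int ct * poly (map_poly of_int f) x = 0" unfolding f0f of_int_poly_eval .
  hence fx: "poly (map_poly of_int f) x = 0" using ct0 by simp
  obtain p where p: "poly (map_poly of_int p) x = 0" "lead_coeff p = (1::int)"
    using x(1) unfolding algebraic_int_altdef_ipoly by blast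
  define r where "r = pseudo_mod p f"
  obtain a q where aq: "a \<noteq> 0" "smult a p = f * q + r" "r = 0 \<or> degree r < degree f"
    using pseudo_mod[OF f(1), of p] unfolding r_def by blast
  have rx: "poly (map_poly of_int r) x = 0"
    using arg_cong[OF aq(2), of "\<lambda>p. poly (map_poly of_int p) x"] unfolding of_int_poly_eval p(1) fx by simp
  \<comment> \<open>A remainder of degree at most 1 with the nonreal root \<open>x\<close>
    vanishes.\<close>
  have "r = 0"
  proof (rule ccontr)
    assume "r \<noteq> 0"
    hence "degree r \<le> 1" using aq(3) f by simp
    hence r: "r = [:coeff r 0, coeff r 1:]"
      by (intro poly_eqI) (auto simp: coeff_pCons coeff_eq_0 split: nat.split)
    have "of_int (coeff r 0) + x * of_int (coeff r 1) = 0"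
      using rx by (subst (asm) r) (simp add: map_poly_pCons)
    hence eq: "of_int (coeff r 0) + x * of_int (coeff r 1) = (0::complex)" .
    have "Im x * of_int (coeff r 1) = 0" using arg_cong[OF eq, of Im] by simp
    hence "coeff r 1 = 0" using x(2) by simp
    moreover from this have "coeff r 0 = 0" using eq by simp
    ultimately show False using r \<open>r \<noteq> 0\<close> by simp
  qed
  hence apq: "smult a p = f * q" using aq by simp
  \<comment> \<open>\<open>p\<close> and \<open>f\<close> are primitive, so \<open>q\<close> has
    content \<open>|a|\<close>. Cancelling it leaves two integral leading coefficients whose product
    is 1 up to sign.\<close>
  have "content p dvd 1" using content_dvd_coeff[of p "degree p"] p(2) by simp
  hence "content p = 1" by (metis is_unit_normalize normalize_content)
  hence cq: "content q = \<bar>a\<bar>"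
    using arg_cong[OF apq, of content] f(3) by (simp add: content_mult)
  define q' where "q' = primitive_part q"
  have q': "q = smult \<bar>a\<bar> q'" using content_times_primitive_part[of q] cq by (simp add: q'_def)
  have "a * lead_coeff p = \<bar>a\<bar> * (lead_coeff f * lead_coeff q')"
    using arg_cong[OF apq, of lead_coeff] aq(1) unfolding q' by (simp add: lead_coeff_mult)
  hence "\<bar>a\<bar> * 1 = \<bar>a\<bar> * \<bar>coeff f 2 * lead_coeff q'\<bar>" using p(2) f(2) by (metis abs_abs abs_mult mult.right_neutral)
  hence "\<bar>coeff f 2 * lead_coeff q'\<bar> = 1" using aq(1) by simp
  hence "\<bar>coeff f 2\<bar> = 1" by (metis abs_mult abs_zmult_eq_1)
  then obtain e where e: "coeff f 2 = e" "e * e = 1" by (metis abs_mult_self_eq mult.right_neutral)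
  have eC: "(of_int e :: complex) * of_int e = 1" using e(2) by (metis of_int_1 of_int_mult)
  have b12: "(of_int (b1 * b2) :: complex) = of_int ct * of_int e" using ct(1) e by (metis of_int_mult)
  have "x + cnj x = of_int (a1 * b2) / of_int (b1 * b2)" unfolding T(2) using Nn(1) by simp
  also have "\<dots> = of_int (- (coeff f 1) * e)"
  proof -
    have "(of_int (a1 * b2) :: complex) = of_int ct * of_int (- coeff f 1)" using ct(2) by (metis of_int_mult minus_mult_right minus_minus)
    moreover have "of_int e \<noteq> (0::complex)" using e by auto
    ultimately show ?thesis unfolding b12 using ct0 eC by (simp add: field_simps)
  qed
  finally show "x + cnj x \<in> \<int>" by (metis Ints_of_int)
  have "x * cnj x = of_int (a2 * b1) / of_int (b1 * b2)" unfolding Nn(2) using T(1) by simp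
  also have "\<dots> = of_int (coeff f 0 * e)"
  proof -
    have "(of_int (a2 * b1) :: complex) = of_int ct * of_int (coeff f 0)" using ct(3) by (metis of_int_mult)
    moreover have "of_int e \<noteq> (0::complex)" using e by auto
    ultimately show ?thesis unfolding b12 using ct0 eC by (simp add: field_simps)
  qed
  finally show "x * cnj x \<in> \<int>" by (metis Ints_of_int)
qed

lemma algebraic_int_if_trace_norm:
  assumes "x + cnj x \<in> \<int>" "x * cnj x \<in> \<int>"
  shows "algebraic_int (x::complex)"
proof (rule algebraic_int.intros)
  show "lead_coeff [:x * cnj x, - (x + cnj x), 1:] = 1" by simp
  show "\<forall>i. coeff [:x * cnj x, - (x + cnj x), 1:] i \<in> \<int>"
    using assms Ints_minus[OF assms(1)] by (auto simp: coeff_pCons split: nat.split)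
  show "poly [:x * cnj x, - (x + cnj x), 1:] x = 0" by (simp add: algebra_simps)
qed

lemma carrier_ring_of_integers: "carrier (ring_of_integers K) = {x \<in> K. algebraic_int x}"
  by (simp add: ring_of_integers_def)

lemma ring_of_integers_trace_norm:
  assumes K: "imaginary_quadratic_field K" and x: "x \<in> carrier (ring_of_integers K)"
  shows "x + cnj x \<in> \<int>" "x * cnj x \<in> \<int>"
proof -
  have x': "x \<in> K" "algebraic_int x" using x by (auto simp: carrier_ring_of_integers)
  note q = quadratic_trace_norm[OF K x'(1)]
  have "x + cnj x \<in> \<int> \<and> x * cnj x \<in> \<int>"
  proof (cases "Im x = 0")
    case True
    hence c: "cnj x = x" by (simp add: complex_eq_iff)
    hence "2 * x \<in> \<rat>" using q(1) by simp
    hence "(2 * x) / 2 \<in> \<rat>" by (intro Rats_divide) auto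
    hence "x \<in> \<rat>" by simp
    hence "x \<in> \<int>" using rational_algebraic_int_is_int x' by blast
    thus ?thesis using c by simp
  next
    case False
    thus ?thesis using algebraic_int_trace_norm[OF x'(2) False q] by blast
  qed
  thus "x + cnj x \<in> \<int>" "x * cnj x \<in> \<int>" by auto
qed

text \<open>Closure under sums is read off the given lattice basis. For products, the trace of
  \<open>x * y\<close> is the product of the traces minus the polarised norm, which needs the norm
  of \<open>x + y\<close>.\<close>

lemma imag_quad_order_ring_of_integers:
  assumes K: "imaginary_quadratic_field K" and L: "lattice_basis (carrier (ring_of_integers K)) \<omega>\<^sub>1 \<omega>\<^sub>2"
  shows "imag_quad_order (carrier (ring_of_integers K))"
proof -
  define R where "R = carrier (ring_of_integers K)"
  note F = complex_subfield[OF K[unfolded imaginary_quadratic_field_def, THEN conjunct1]]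
  note tn = ring_of_integers_trace_norm[OF K, folded R_def]
  have memI: "x \<in> R" if "x \<in> K" "x + cnj x \<in> \<int>" "x * cnj x \<in> \<int>" for x
    using that algebraic_int_if_trace_norm by (auto simp: R_def carrier_ring_of_integers)
  have RK: "x \<in> K" if "x \<in> R" for x using that by (simp add: R_def carrier_ring_of_integers)
  have L': "R = {of_int m * \<omega>\<^sub>1 + of_int n * \<omega>\<^sub>2 | m n. True}"
    "\<And>s t. of_real s * \<omega>\<^sub>1 + of_real t * \<omega>\<^sub>2 = 0 \<Longrightarrow> s = 0 \<and> t = 0"
    using L by (auto simp: lattice_basis_def R_def)
  have add: "x + y \<in> R" if xy: "x \<in> R" "y \<in> R" for x y
  proof -
    obtain m n m' n' where "x = of_int m * \<omega>\<^sub>1 + of_int n * \<omega>\<^sub>2" "y = of_int m' * \<omega>\<^sub>1 + of_int n' * \<omega>\<^sub>2"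
      using xy unfolding L'(1) by blast
    hence "x + y = of_int (m + m') * \<omega>\<^sub>1 + of_int (n + n') * \<omega>\<^sub>2" by (simp add: algebra_simps)
    thus ?thesis unfolding L'(1) by blast
  qed
  have "imag_quad_order R"
  proof
    show "1 \<in> R" using F by (intro memI) auto
    show "x + y \<in> R" if "x \<in> R" "y \<in> R" for x y using add that .
    show "- x \<in> R" if "x \<in> R" for x
      using F(5) RK[OF that] that by (simp add: R_def carrier_ring_of_integers)
    show "x * y \<in> R" if xy: "x \<in> R" "y \<in> R" for x y
    proof (rule memI)
      show "x * y \<in> K" using F(4) RK xy by blast
      have "x * y * cnj (x * y) = (x * cnj x) * (y * cnj y)" by simp
      also have "\<dots> \<in> \<int>" by (rule Ints_mult[OF tn(2)[OF xy(1)] tn(2)[OF xy(2)]])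
      finally show "x * y * cnj (x * y) \<in> \<int>" .
      have "x * y + cnj (x * y) = (x + cnj x) * (y + cnj y)
          - ((x + y) * cnj (x + y) - x * cnj x - y * cnj y)"
        by (simp add: algebra_simps)
      also have "\<dots> \<in> \<int>"
        by (rule Ints_diff[OF Ints_mult[OF tn(1)[OF xy(1)] tn(1)[OF xy(2)]]
              Ints_diff[OF Ints_diff[OF tn(2)[OF add[OF xy]] tn(2)[OF xy(1)]] tn(2)[OF xy(2)]]])
      finally show "x * y + cnj (x * y) \<in> \<int>" .
    qed
    show "\<exists>x\<in>R. Im x \<noteq> 0"
    proof (rule ccontr)
      assume c: "\<not> ?thesis"
      have "of_int 1 * \<omega>\<^sub>1 + of_int 0 * \<omega>\<^sub>2 \<in> R" "of_int 0 * \<omega>\<^sub>1 + of_int 1 * \<omega>\<^sub>2 \<in> R" unfolding L'(1) by blast+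
      hence "Im \<omega>\<^sub>1 = 0" "Im \<omega>\<^sub>2 = 0" using c by auto
      hence "of_real (Re \<omega>\<^sub>2) * \<omega>\<^sub>1 + of_real (- Re \<omega>\<^sub>1) * \<omega>\<^sub>2 = 0" by (simp add: complex_eq_iff)
      from L'(2)[OF this] have "\<omega>\<^sub>1 = 0" using \<open>Im \<omega>\<^sub>1 = 0\<close> by (simp add: complex_eq_iff)
      hence "of_real 1 * \<omega>\<^sub>1 + of_real 0 * \<omega>\<^sub>2 = 0" by simp
      from L'(2)[OF this] show False by simp
    qed
    show "x + cnj x \<in> \<int>" "x * cnj x \<in> \<int>" if "x \<in> R" for x using tn that by auto
    show "a / b \<in> R" if "a \<in> R" "b \<in> R" "b \<noteq> 0" "a / b + cnj (a / b) \<in> \<int>" "a / b * cnj (a / b) \<in> \<int>" for a b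
      using that F(6) RK by (intro memI) auto
  qed
  thus ?thesis by (simp add: R_def)
qed

text \<open>The \<open>THE\<close> requires uniqueness: two bases differ by an integral matrix of
  determinant 1 or -1, and the determinant enters squared.\<close>

lemma field_discriminant_eq:
  assumes R: "carrier (ring_of_integers K) = {of_int p + of_int q * w | p q. True}" and w: "Im w > 0"
    and D: "(of_int D :: complex) = (w - cnj w)\<^sup>2"
  shows "field_discriminant K = D"
  unfolding field_discriminant_def
proof (rule the_equality)
  have "lattice_basis (carrier (ring_of_integers K)) w 1"
    unfolding lattice_basis_def R
  proof (intro conjI allI impI)
    fix s t assume eq: "of_real s * w + of_real t * 1 = 0"
    have "s * Im w = 0" using arg_cong[OF eq, of Im] by simp
    thus "s = 0" using w by simp
    thus "t = 0" using eq by simp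
  next
    show "{of_int p + of_int q * w | p q. True} = {of_int m * w + of_int n * 1 | m n. True}"
      by (auto simp: add.commute)
  qed
  thus "\<exists>\<omega>\<^sub>1 \<omega>\<^sub>2. lattice_basis (carrier (ring_of_integers K)) \<omega>\<^sub>1 \<omega>\<^sub>2 \<and>
     of_int D = (\<omega>\<^sub>1 * cnj \<omega>\<^sub>2 - \<omega>\<^sub>2 * cnj \<omega>\<^sub>1)\<^sup>2" using D by (intro exI[of _ w] exI[of _ 1]) simp
next
  fix E assume "\<exists>\<omega>\<^sub>1 \<omega>\<^sub>2. lattice_basis (carrier (ring_of_integers K)) \<omega>\<^sub>1 \<omega>\<^sub>2 \<and>
     of_int E = (\<omega>\<^sub>1 * cnj \<omega>\<^sub>2 - \<omega>\<^sub>2 * cnj \<omega>\<^sub>1)\<^sup>2"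
  then obtain u v where L: "lattice_basis (carrier (ring_of_integers K)) u v"
    and E: "of_int E = (u * cnj v - v * cnj u)\<^sup>2" by blast
  have eqR: "{of_int p + of_int q * w | p q. True} = {of_int m * u + of_int n * v | m n. True}"
    using L R unfolding lattice_basis_def by simp
  have uniq: "p = p' \<and> q = q'" if eq: "of_int p + of_int q * w = of_int p' + of_int q' * w" for p q p' q' :: int
  proof -
    have "of_int q * Im w = of_int q' * Im w" using arg_cong[OF eq, of Im] by simp
    hence "q = q'" using w by simp
    thus ?thesis using eq by simp
  qed
  have "of_int 1 * u + of_int 0 * v \<in> {of_int m * u + of_int n * v | m n. True}"
    "of_int 0 * u + of_int 1 * v \<in> {of_int m * u + of_int n * v | m n. True}" by blast+
  then obtain a b c d where uv: "u = of_int a + of_int b * w" "v = of_int c + of_int d * w"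
    unfolding eqR[symmetric] by auto
  have "of_int 1 + of_int 0 * w \<in> {of_int p + of_int q * w | p q. True}"
    "of_int 0 + of_int 1 * w \<in> {of_int p + of_int q * w | p q. True}" by blast+
  then obtain m n m' n' where mn: "1 = of_int m * u + of_int n * v" "w = of_int m' * u + of_int n' * v"
    unfolding eqR by auto
  have "of_int (m * a + n * c) + of_int (m * b + n * d) * w = of_int 1 + of_int 0 * w"
    using mn(1) unfolding uv by (simp add: algebra_simps)
  hence 1: "m * a + n * c = 1" "m * b + n * d = 0" using uniq by blast+
  have "of_int (m' * a + n' * c) + of_int (m' * b + n' * d) * w = of_int 0 + of_int 1 * w"
  proof -
    have "of_int (m' * a + n' * c) + of_int (m' * b + n' * d) * w = of_int m' * u + of_int n' * v"
      unfolding uv by (simp add: algebra_simps)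
    thus ?thesis using mn(2) by simp
  qed
  hence 2: "m' * a + n' * c = 0" "m' * b + n' * d = 1" using uniq by blast+
  have "(m * n' - n * m') * (a * d - b * c) = (m * a + n * c) * (m' * b + n' * d) - (m * b + n * d) * (m' * a + n' * c)"
    by (simp add: algebra_simps)
  hence "(m * n' - n * m') * (a * d - b * c) = 1" using 1 2 by simp
  hence "\<bar>a * d - b * c\<bar> = 1" by (metis abs_zmult_eq_1 abs_1 mult.commute)
  hence det: "(a * d - b * c) * (a * d - b * c) = 1" by (metis abs_mult_self_eq mult.right_neutral)
  have "u * cnj v - v * cnj u = - of_int (a * d - b * c) * (w - cnj w)"
    unfolding uv by (simp add: algebra_simps)
  hence "(u * cnj v - v * cnj u)\<^sup>2 = of_int ((a * d - b * c) * (a * d - b * c)) * (w - cnj w)\<^sup>2"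
  proof -
    have "(- of_int e * y)\<^sup>2 = of_int (e * e) * y\<^sup>2" for e :: int and y :: complex
      by (simp add: power2_eq_square)
    thus ?thesis unfolding \<open>u * cnj v - v * cnj u = _\<close> .
  qed
  hence "(of_int E :: complex) = of_int D" using E D det by simp
  thus "E = D" by simp
qed

section \<open>Visible hemispheres and Swan's number\<close>

lemma snd_SL2_act:
  "snd (SL2_act A (z, t)) = t / hform z t (- A $ 2 $ 2) (A $ 2 $ 1)"
  by (simp add: SL2_act_def Let_def hform_def)

lemma PSL2_representative:
  assumes "g \<in> carrier (PSL2 Rg)"
  obtains A where "A \<in> carrier (SL2 Rg)" "\<And>P. PSL2_act g P = SL2_act A P"
proof -
  obtain A where A: "A \<in> carrier (SL2 Rg)" "g = {mat 1, - mat 1} #>\<^bsub>SL2 Rg\<^esub> A"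
    using assms by (auto simp: PSL2_def FactGroup_def RCOSETS_def)
  have "mat 1 \<otimes>\<^bsub>SL2 Rg\<^esub> A = A" by (simp add: SL2_def)
  hence "A \<in> g" unfolding A(2) r_coset_def by force
  thus ?thesis using that A PSL2_act_eq[OF assms] by blast
qed

lemma PSL2_coset:
  assumes "A \<in> carrier (SL2 Rg)"
  obtains g where "g \<in> carrier (PSL2 Rg)" "\<And>P. PSL2_act g P = SL2_act A P"
proof -
  define g where "g = {mat 1, - mat 1} #>\<^bsub>SL2 Rg\<^esub> A"
  have g: "g \<in> carrier (PSL2 Rg)" using assms by (auto simp: PSL2_def FactGroup_def RCOSETS_def g_def)
  have "mat 1 \<otimes>\<^bsub>SL2 Rg\<^esub> A = A" by (simp add: SL2_def)
  hence "A \<in> g" unfolding g_def r_coset_def by force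
  thus ?thesis using that g PSL2_act_eq[OF g] by blast
qed

text \<open>Induction on \<open>S\<close>: if a new function exceeds the current maximum somewhere,
  it does so on a smaller nonempty open set. This finds a region over which one hemisphere is
  highest.\<close>

lemma finite_max_on_open:
  fixes h :: "'i \<Rightarrow> 'a::topological_space \<Rightarrow> real"
  assumes "finite S" "S \<noteq> {}" and "open W" "W \<noteq> {}" and "\<And>i. i \<in> S \<Longrightarrow> continuous_on UNIV (h i)"
  shows "\<exists>i\<in>S. \<exists>V. open V \<and> V \<noteq> {} \<and> V \<subseteq> W \<and> (\<forall>x\<in>V. \<forall>k\<in>S. h k x \<le> h i x)"
  using assms(1,2,5)
proof (induction S rule: finite_ne_induct)
  case (singleton i)
  thus ?case using assms(3,4) by (intro bexI[of _ i] exI[of _ W]) auto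
next
  case (insert j S)
  then obtain i V where iV: "i \<in> S" "open V" "V \<noteq> {}" "V \<subseteq> W" "\<forall>x\<in>V. \<forall>k\<in>S. h k x \<le> h i x" by auto
  show ?case
  proof (cases "\<forall>x\<in>V. h j x \<le> h i x")
    case True
    thus ?thesis using iV by (intro bexI[of _ i] exI[of _ V]) auto
  next
    case False
    define V' where "V' = V \<inter> {x. h i x < h j x}"
    have "open {x. h i x < h j x}" using insert.prems iV(1) by (intro open_Collect_less) auto
    hence "open V'" unfolding V'_def using iV(2) by blast
    moreover have "V' \<noteq> {}" using False by (auto simp: V'_def not_le)
    moreover have "V' \<subseteq> W" using iV by (auto simp: V'_def)
    moreover have "\<forall>x\<in>V'. \<forall>k\<in>insert j S. h k x \<le> h j x"
    proof (intro ballI)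
      fix x k assume x: "x \<in> V'" and k: "k \<in> insert j S"
      have "h i x < h j x" "x \<in> V" using x by (auto simp: V'_def)
      moreover have "k = j \<or> h k x \<le> h i x" using k iV(5) \<open>x \<in> V\<close> by auto
      ultimately show "h k x \<le> h j x" by auto
    qed
    ultimately show ?thesis by (intro bexI[of _ j] exI[of _ V']) auto
  qed
qed

context imag_quad_order
begin

definition unimodular :: "complex \<Rightarrow> complex \<Rightarrow> bool" where
  "unimodular a b \<longleftrightarrow> a \<in> R \<and> b \<in> R \<and> (\<exists>x\<in>R. \<exists>y\<in>R. x * a + y * b = 1)"

lemma unimodular_iff: 
  assumes "a \<in> R" "b \<in> R"
  shows "unimodular a b \<longleftrightarrow> Idl\<^bsub>rr\<^esub> {a, b} = carrier rr"
  using genideal_pair_carrier[OF assms] assms by (simp add: unimodular_def)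

text \<open>Lower rows \<open>(c, d)\<close> of matrices in \<open>SL2\<close> correspond to
  unimodular pairs \<open>(- d, c)\<close>, and the height of the image point is
  \<open>t / hform\<close>.\<close>

lemma bianchi_polyhedron_iff:
  "(z, t) \<in> bianchi_polyhedron rr F \<longleftrightarrow>
     t > 0 \<and> z \<in> closure F \<and> (\<forall>a b. unimodular a b \<longrightarrow> 1 \<le> hform z t a b)"
proof -
  have "(\<forall>g\<in>carrier (PSL2 rr). snd (PSL2_act g (z, t)) \<le> t) \<longleftrightarrow> (\<forall>a b. unimodular a b \<longrightarrow> 1 \<le> hform z t a b)"
    if t: "t > 0"
  proof (intro iffI allI impI ballI)
    fix a b assume all: "\<forall>g\<in>carrier (PSL2 rr). snd (PSL2_act g (z, t)) \<le> t" and u: "unimodular a b"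
    obtain x y where xy: "a \<in> R" "b \<in> R" "x \<in> R" "y \<in> R" "x * a + y * b = 1"
      using u by (auto simp: unimodular_def)
    define A :: "complex^2^2" where
      "A = (\<chi> i j. if i = 1 then (if j = 1 then - x else - y) else (if j = 1 then b else - a))"
    have A: "A $ 1 $ 1 = - x" "A $ 1 $ 2 = - y" "A $ 2 $ 1 = b" "A $ 2 $ 2 = - a"
      by (simp_all add: A_def)
    have "det A = 1" unfolding det_2 A using xy by simp
    hence "A \<in> carrier (SL2 rr)" using xy by (simp add: SL2_def forall_2 A R_uminus)
    then obtain g where g: "g \<in> carrier (PSL2 rr)" "\<And>P. PSL2_act g P = SL2_act A P"
      by (rule PSL2_coset) blast
    have "t / hform z t a b \<le> t" using all g snd_SL2_act[of A z t] by (auto simp: A)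
    moreover have "hform z t a b > 0"
    proof (cases "b = 0")
      case True
      hence "a \<noteq> 0" using xy by auto
      thus ?thesis using True by (simp add: hform_def)
    next
      case False
      thus ?thesis using t unfolding hform_def by (intro add_nonneg_pos) auto
    qed
    ultimately show "1 \<le> hform z t a b" using t by (simp add: field_simps)
  next
    fix g assume all: "\<forall>a b. unimodular a b \<longrightarrow> 1 \<le> hform z t a b" and g: "g \<in> carrier (PSL2 rr)"
    obtain A where A: "A \<in> carrier (SL2 rr)" "\<And>P. PSL2_act g P = SL2_act A P"
      using PSL2_representative[OF g] by blast
    have R: "A $ i $ j \<in> R" for i j using A by (simp add: SL2_def)
    have "det A = 1" using A by (simp add: SL2_def)
    hence "(- A $ 1 $ 1) * (- A $ 2 $ 2) + (- A $ 1 $ 2) * (A $ 2 $ 1) = 1" by (simp add: det_2)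
    hence "unimodular (- A $ 2 $ 2) (A $ 2 $ 1)" unfolding unimodular_def using R R_uminus by blast
    hence h: "1 \<le> hform z t (- A $ 2 $ 2) (A $ 2 $ 1)" using all by blast
    have "t / hform z t (- A $ 2 $ 2) (A $ 2 $ 1) \<le> t / 1" using h t by (intro divide_left_mono) auto
    thus "snd (PSL2_act g (z, t)) \<le> t" unfolding A(2) snd_SL2_act by simp
  qed
  thus ?thesis by (auto simp: bianchi_polyhedron_def hyperbolic_space_def)
qed

text \<open>In the upper half-space this is \<open>hform z t lam mu = 1\<close>, solved for
  \<open>t^2\<close> so that heights of hemispheres over \<open>z\<close> can be compared.\<close>

lemma hemisphere_iff:
  assumes "mu \<noteq> 0"
  shows "(z, t) \<in> hemisphere lam mu \<longleftrightarrow> t > 0 \<and> t\<^sup>2 = (1 - (cmod (mu * z - lam))\<^sup>2) / (cmod mu)\<^sup>2"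
proof -
  have "mu * z - lam = mu * (z - lam / mu)" using assms by (simp add: algebra_simps)
  hence e: "(cmod (mu * z - lam))\<^sup>2 = (cmod mu)\<^sup>2 * (cmod (z - lam / mu))\<^sup>2"
    by (simp only: norm_mult power_mult_distrib)
  have "(z, t) \<in> sphere (lam / mu, 0) (1 / cmod mu) \<longleftrightarrow> sqrt ((cmod (z - lam / mu))\<^sup>2 + t\<^sup>2) = 1 / cmod mu"
    by (simp only: mem_sphere dist_Pair_Pair) (simp add: dist_norm norm_minus_commute)
  also have "\<dots> \<longleftrightarrow> (cmod (z - lam / mu))\<^sup>2 + t\<^sup>2 = (1 / cmod mu)\<^sup>2"
  proof
    assume "sqrt ((cmod (z - lam / mu))\<^sup>2 + t\<^sup>2) = 1 / cmod mu"
    hence "(sqrt ((cmod (z - lam / mu))\<^sup>2 + t\<^sup>2))\<^sup>2 = (1 / cmod mu)\<^sup>2" by simp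
    thus "(cmod (z - lam / mu))\<^sup>2 + t\<^sup>2 = (1 / cmod mu)\<^sup>2" by simp
  next
    assume "(cmod (z - lam / mu))\<^sup>2 + t\<^sup>2 = (1 / cmod mu)\<^sup>2"
    thus "sqrt ((cmod (z - lam / mu))\<^sup>2 + t\<^sup>2) = 1 / cmod mu" by (intro real_sqrt_unique) simp_all
  qed
  also have "\<dots> \<longleftrightarrow> t\<^sup>2 = (1 - (cmod (mu * z - lam))\<^sup>2) / (cmod mu)\<^sup>2"
    unfolding e using assms by (auto simp: field_simps)
  finally show ?thesis by (auto simp: hemisphere_def hyperbolic_space_def)
qed

lemma finite_hform_le:
  assumes t: "t > 0"
  shows "finite {(a, b). a \<in> R \<and> b \<in> R \<and> hform z t a b \<le> c\<^sup>2}"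
proof -
  define c' where "c' = \<bar>c\<bar>"
  have "{(a, b). a \<in> R \<and> b \<in> R \<and> hform z t a b \<le> c\<^sup>2}
    \<subseteq> {a \<in> R. cmod a \<le> c' / t * cmod z + c'} \<times> {b \<in> R. cmod b \<le> c' / t}"
  proof
    fix p assume "p \<in> {(a, b). a \<in> R \<and> b \<in> R \<and> hform z t a b \<le> c\<^sup>2}"
    then obtain a b where p: "p = (a, b)" "a \<in> R" "b \<in> R" and h: "hform z t a b \<le> c\<^sup>2" by auto
    have "(cmod b * t)\<^sup>2 \<le> c'\<^sup>2" "(cmod (b * z - a))\<^sup>2 \<le> c'\<^sup>2"
      using h zero_le_power2[of "cmod (b * z - a)"] zero_le_power2[of "cmod b * t"]
      unfolding hform_def c'_def power_mult_distrib power2_abs by linarith+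
    hence 1: "cmod b * t \<le> c'" and 2: "cmod (b * z - a) \<le> c'"
      using power2_le_imp_le[of _ c'] by (auto simp: c'_def)
    have b: "cmod b \<le> c' / t" using 1 t by (simp add: field_simps)
    have "cmod a \<le> cmod (b * z) + cmod (b * z - a)" using norm_triangle_ineq4[of "b * z" "b * z - a"] by simp
    also have "\<dots> \<le> c' / t * cmod z + c'" unfolding norm_mult using b 2 by (intro add_mono mult_right_mono) auto
    finally show "p \<in> {a \<in> R. cmod a \<le> c' / t * cmod z + c'} \<times> {b \<in> R. cmod b \<le> c' / t}"
      using p b by auto
  qed
  thus ?thesis using finite_R_ball by (meson finite_SigmaI finite_subset)
qed

lemma minimal_vector:
  assumes t: "t > 0"
  obtains a0 b0 where "a0 \<in> R" "b0 \<in> R" "a0 \<noteq> 0 \<or> b0 \<noteq> 0"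
    "\<And>a b. a \<in> R \<Longrightarrow> b \<in> R \<Longrightarrow> a \<noteq> 0 \<or> b \<noteq> 0 \<Longrightarrow> hform z t a0 b0 \<le> hform z t a b"
proof -
  define S where "S = {(a, b). a \<in> R \<and> b \<in> R \<and> hform z t a b \<le> 1\<^sup>2} - {(0, 0)}"
  define f where "f = (\<lambda>(a, b). hform z t a b)"
  have "finite S" unfolding S_def using finite_hform_le[OF t] by blast
  have 10: "(1, 0) \<in> S" by (simp add: S_def R_closed hform_def)
  have fin: "finite (f ` S)" "f ` S \<noteq> {}" using \<open>finite S\<close> 10 by auto
  from Min_in[OF fin] obtain p where p: "p \<in> S" "f p = Min (f ` S)" by auto
  obtain a0 b0 where ab: "p = (a0, b0)" by (cases p)
  have min: "hform z t a0 b0 \<le> hform z t a b" if "a \<in> R" "b \<in> R" "a \<noteq> 0 \<or> b \<noteq> 0" for a b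
  proof (cases "hform z t a b \<le> 1")
    case True
    hence "(a, b) \<in> S" using that by (auto simp: S_def)
    hence "f p \<le> f (a, b)" using p(2) fin by simp
    thus ?thesis by (simp add: f_def ab)
  next
    case False
    have "f p \<le> f (1, 0)" using p(2) fin 10 by simp
    thus ?thesis using False by (simp add: f_def ab hform_def)
  qed
  show ?thesis using that[of a0 b0] p(1) min unfolding ab S_def by auto
qed

text \<open>A minimal vector at the point supplies the cusp. There \<open>om\<close> has
  discriminant \<open>B^2 - 4 * N * C = \<Delta>\<close>, so \<open>s = sqrt |\<Delta>|\<close>, and
  the primes dividing \<open>g\<close> divide \<Delta>. \<open>touching_bound\<close> then
  contradicts \<open>|\<mu>| \<ge> 14 * J * M\<close>.\<close>

lemma visible_hemisphere_bound:
  fixes J :: int and M :: real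
  assumes maxj: "max_ideal_j rr (2 * M) \<le> of_int J" and J1: "J \<ge> 1"
    and disc: "\<And>w D. R = {of_int p + of_int q * w | p q. True} \<Longrightarrow> Im w > 0 \<Longrightarrow>
        (of_int D :: complex) = (w - cnj w)\<^sup>2 \<Longrightarrow> D = \<Delta>"
    and Js: "of_int J * sqrt \<bar>of_int \<Delta>\<bar> \<le> M"
    and Mq: "\<And>q::nat. prime q \<Longrightarrow> int q dvd \<Delta> \<Longrightarrow> \<bar>of_int \<Delta>\<bar> / real q \<le> M"
    and mu: "unimodular lam mu" "mu \<noteq> 0" and P: "(z, t) \<in> hemisphere lam mu" "(z, t) \<in> bianchi_polyhedron rr F"
    and M0: "M > 0"
  shows "cmod mu < 14 * of_int J * M"
proof (rule ccontr)
  assume "\<not> ?thesis"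
  hence big: "14 * of_int J * M \<le> cmod mu" by simp
  have t: "t > 0" using P(1) hemisphere_iff[OF mu(2)] by blast
  have t2: "t\<^sup>2 = (1 - (cmod (mu * z - lam))\<^sup>2) / (cmod mu)\<^sup>2" using P(1) hemisphere_iff[OF mu(2)] by blast
  hence h1: "hform z t lam mu = 1" using mu(2) by (simp add: hform_def)
  have "(cmod mu)\<^sup>2 * t\<^sup>2 \<le> 1"
    using h1[unfolded hform_def] zero_le_power2[of "cmod (mu * z - lam)"] by linarith
  hence "(cmod mu * t)\<^sup>2 \<le> 1\<^sup>2" by (simp add: power_mult_distrib)
  hence "cmod mu * t \<le> 1" by (rule power2_le_imp_le) simp
  moreover have "14 * of_int J * M * t \<le> cmod mu * t" using big t by (intro mult_right_mono) auto
  ultimately have tsm: "14 * of_int J * M * t \<le> 1" by linarith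
  have cov: "1 \<le> hform z t a b" if "a \<in> R" "b \<in> R" "x \<in> R" "y \<in> R" "x * a + y * b = 1" for a b x y
    using P(2) that unfolding bianchi_polyhedron_iff unimodular_def by blast
  obtain a0 b0 where v: "a0 \<in> R" "b0 \<in> R" "a0 \<noteq> 0 \<or> b0 \<noteq> 0"
    "\<And>a b. a \<in> R \<Longrightarrow> b \<in> R \<Longrightarrow> a \<noteq> 0 \<or> b \<noteq> 0 \<Longrightarrow> hform z t a0 b0 \<le> hform z t a b"
    using minimal_vector[OF t, where z = z] by blast
  have hpos: "hform z t a0 b0 > 0"
    using v(3) t unfolding hform_def by (cases "b0 = 0") (auto intro: add_nonneg_pos)
  have vmin: "cmod x \<ge> 1" if "x * a0 \<in> R" "x * b0 \<in> R" "x \<noteq> 0" for x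
  proof -
    have "1 * hform z t a0 b0 \<le> (cmod x)\<^sup>2 * hform z t a0 b0"
      using v(4)[OF that(1,2)] v(3) that(3) unfolding hform_scale by auto
    hence "1\<^sup>2 \<le> (cmod x)\<^sup>2" using hpos by (simp only: mult_le_cancel_right_pos power_one)
    thus ?thesis by (rule power2_le_imp_le) simp
  qed
  obtain tau w1 w2 N B C where rc: "reduced_cusp R a0 b0 tau w1 w2 N B C"
    using reduced_cusp_exists[OF v(1-3) vmin] by blast
  interpret rc: reduced_cusp R a0 b0 tau w1 w2 N B C by (rule rc)
  interpret cp: cusp_point R a0 b0 tau w1 w2 N B C z t M J
  proof
    show "t > 0" by (rule t)
    show "1 \<le> hform z t a b" if "a \<in> R" "b \<in> R" "x \<in> R" "y \<in> R" "x * a + y * b = 1" for a b x y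
      using cov that .
    show "\<exists>j::int. X \<le> of_int j \<and> of_int j \<le> X + of_int J \<and> coprime_shift I \<alpha> j"
      if "ideal_of I" "x0 \<in> I" "x0 \<noteq> 0" "sqrt (real (ideal_norm rr I)) < 2 * M"
        "\<And>P. prime_of P \<Longrightarrow> principal_of P \<Longrightarrow> \<not> I \<subseteq> P" "\<alpha> \<in> R" "admissible_shift rr I \<alpha>" for I x0 \<alpha> and X :: real
    proof (rule max_ideal_j_works[OF maxj that(1-4) _ that(6,7)])
      show "\<not> I \<subseteq> P" if "prime_of P" "principal_of P" for P
        using \<open>\<And>P. prime_of P \<Longrightarrow> principal_of P \<Longrightarrow> \<not> I \<subseteq> P\<close> that by blast
    qed
  qed
  have "(rc.om - cnj rc.om)\<^sup>2 = (rc.om + cnj rc.om)\<^sup>2 - 4 * (rc.om * cnj rc.om)"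
    by (simp add: power2_eq_square algebra_simps)
  hence "of_int (B\<^sup>2 - 4 * (N * C)) = (rc.om - cnj rc.om)\<^sup>2"
    unfolding rc.om_trace rc.om_norm by simp
  hence D: "B\<^sup>2 - 4 * (N * C) = \<Delta>" using disc[OF rc.R_eq_om rc.om_Im(2)] by blast
  hence sD: "rc.s\<^sup>2 = \<bar>of_int \<Delta>\<bar>" 
  proof -
    have "rc.s\<^sup>2 = of_int (- \<Delta>)" unfolding rc.s_sq D[symmetric] by simp
    moreover have "rc.s\<^sup>2 \<ge> 0" by simp
    ultimately show ?thesis by simp
  qed
  have s: "rc.s = sqrt \<bar>of_int \<Delta>\<bar>" using sD rc.s_pos real_sqrt_unique[of rc.s] by simp
  obtain x y where xy: "lam \<in> R" "mu \<in> R" "x \<in> R" "y \<in> R" "x * lam + y * mu = 1"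
    using mu(1) by (auto simp: unimodular_def)
  have "cmod mu \<le> 4 * of_int J * M"
  proof (rule cp.touching_bound[OF _ J1 _ _ tsm xy h1])
    show "cp.phi \<le> hform z t a b" if "a \<in> R" "b \<in> R" "a \<noteq> 0 \<or> b \<noteq> 0" for a b
      using v(4) that unfolding cp.phi_def .
    show "of_int J * rc.s \<le> M" using Js s by simp
    show "rc.s\<^sup>2 / real q \<le> M" if q: "prime q" "int q dvd rc.g" for q :: nat
    proof -
      have "4 * (N * C) - B\<^sup>2 = - \<Delta>" using D by simp
      hence "rc.g dvd \<Delta>" using rc.g_dvd_disc by (simp only: dvd_minus_iff)
      hence "int q dvd \<Delta>" by (rule dvd_trans[OF q(2)])
      thus ?thesis unfolding sD using Mq[OF q(1)] by simp
    qed
  qed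
  moreover have "of_int J * M > 0" using J1 M0 by simp
  ultimately show False using big by (simp add: mult.assoc)
qed

text \<open>The hemisphere of radius 1 around a lattice point of \<open>F\<close> keeps the floor of the polyhedron away
  from 0 near that point, so only finitely many hemispheres compete there.\<close>

lemma visible_hemisphere_exists:
  assumes F: "fundamental_parallelogram R F"
  shows "\<exists>lam mu. unimodular lam mu \<and> mu \<noteq> 0 \<and>
     (\<exists>U. U \<noteq> {} \<and> openin (top_of_set (hemisphere lam mu)) U \<and>
        U \<subseteq> hemisphere lam mu \<inter> bianchi_polyhedron rr F)"
proof -
  obtain c \<omega>\<^sub>1 \<omega>\<^sub>2 where L: "lattice_basis R \<omega>\<^sub>1 \<omega>\<^sub>2"
    and Feq: "F = {c + of_real s * \<omega>\<^sub>1 + of_real t * \<omega>\<^sub>2 | s t :: real. 0 \<le> s \<and> s < 1 \<and> 0 \<le> t \<and> t < 1}"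
    using F unfolding fundamental_parallelogram_def by blast
  define \<kappa> where "\<kappa> = Im (\<omega>\<^sub>1 * cnj \<omega>\<^sub>2)"
  have k0: "\<kappa> \<noteq> 0"
  proof
    assume k: "\<kappa> = 0"
    have ind: "\<And>s t :: real. of_real s * \<omega>\<^sub>1 + of_real t * \<omega>\<^sub>2 = 0 \<Longrightarrow> s = 0 \<and> t = 0"
      using L by (auto simp: lattice_basis_def)
    have w2: "\<omega>\<^sub>2 \<noteq> 0" using ind[of 0 1] by auto
    define e where "e = Re (\<omega>\<^sub>1 * cnj \<omega>\<^sub>2)"
    have "\<omega>\<^sub>1 * cnj \<omega>\<^sub>2 = of_real e" using k by (simp add: complex_eq_iff \<kappa>_def e_def)
    hence "(\<omega>\<^sub>1 * cnj \<omega>\<^sub>2) * \<omega>\<^sub>2 = of_real e * \<omega>\<^sub>2" by (simp only:)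
    moreover have "(\<omega>\<^sub>1 * cnj \<omega>\<^sub>2) * \<omega>\<^sub>2 = of_real ((cmod \<omega>\<^sub>2)\<^sup>2) * \<omega>\<^sub>1"
      unfolding complex_norm_square by (simp add: mult_ac)
    ultimately have "of_real ((cmod \<omega>\<^sub>2)\<^sup>2) * \<omega>\<^sub>1 + of_real (- e) * \<omega>\<^sub>2 = 0" by simp
    from ind[OF this] show False using w2 by simp
  qed
  define \<sigma> where "\<sigma> = (\<lambda>x. Im (x * cnj \<omega>\<^sub>2) / \<kappa>)"
  define \<rho> where "\<rho> = (\<lambda>x. - Im (x * cnj \<omega>\<^sub>1) / \<kappa>)"
  have coord: "\<sigma> (of_real s * \<omega>\<^sub>1 + of_real t * \<omega>\<^sub>2) = s" "\<rho> (of_real s * \<omega>\<^sub>1 + of_real t * \<omega>\<^sub>2) = t" for s t :: real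
  proof -
    have "Im ((of_real s * \<omega>\<^sub>1 + of_real t * \<omega>\<^sub>2) * cnj \<omega>\<^sub>2) = s * \<kappa>"
      "Im ((of_real s * \<omega>\<^sub>1 + of_real t * \<omega>\<^sub>2) * cnj \<omega>\<^sub>1) = - t * \<kappa>"
      by (simp_all add: \<kappa>_def algebra_simps)
    thus "\<sigma> (of_real s * \<omega>\<^sub>1 + of_real t * \<omega>\<^sub>2) = s" "\<rho> (of_real s * \<omega>\<^sub>1 + of_real t * \<omega>\<^sub>2) = t"
      unfolding \<sigma>_def \<rho>_def using k0 by simp_all
  qed
  have expand: "x = of_real (\<sigma> x) * \<omega>\<^sub>1 + of_real (\<rho> x) * \<omega>\<^sub>2" for x
  proof (rule complex_eqI)
    show "Re x = Re (of_real (\<sigma> x) * \<omega>\<^sub>1 + of_real (\<rho> x) * \<omega>\<^sub>2)"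
      using k0 by (simp add: \<sigma>_def \<rho>_def field_simps) (simp add: \<kappa>_def algebra_simps)
    show "Im x = Im (of_real (\<sigma> x) * \<omega>\<^sub>1 + of_real (\<rho> x) * \<omega>\<^sub>2)"
      using k0 by (simp add: \<sigma>_def \<rho>_def field_simps) (simp add: \<kappa>_def algebra_simps)
  qed
  \<comment> \<open>These integers bring the coordinates of the lattice point \<open>x0\<close>
    relative to the corner \<open>c\<close> into \<open>[0, 1)\<close>.\<close>
  define m n where "m = \<lceil>- \<sigma> (- c)\<rceil>" "n = \<lceil>- \<rho> (- c)\<rceil>"
  define s0 t0 where "s0 = of_int m + \<sigma> (- c)" "t0 = of_int n + \<rho> (- c)"
  have st0: "0 \<le> s0" "s0 < 1" "0 \<le> t0" "t0 < 1" unfolding s0_t0_def m_n_def by linarith+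
  define x0 where "x0 = of_int m * \<omega>\<^sub>1 + of_int n * \<omega>\<^sub>2"
  have x0R: "x0 \<in> R" using L unfolding lattice_basis_def x0_def by blast
  have x0c: "x0 - c = of_real s0 * \<omega>\<^sub>1 + of_real t0 * \<omega>\<^sub>2"
    using expand[of "- c"] by (simp add: x0_def s0_t0_def algebra_simps)
  define W where "W = {x. 0 < \<sigma> (x - c)} \<inter> {x. \<sigma> (x - c) < 1} \<inter> {x. 0 < \<rho> (x - c)} \<inter> {x. \<rho> (x - c) < 1} \<inter> ball x0 (1/2)"
  have cont: "continuous_on UNIV (\<lambda>x. \<sigma> (x - c))" "continuous_on UNIV (\<lambda>x. \<rho> (x - c))"
    unfolding \<sigma>_def \<rho>_def using k0 by (auto intro!: continuous_intros)
  have oW: "open W" unfolding W_def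
    using cont by (intro open_Int open_Collect_less open_ball) (auto intro: continuous_on_const)
  have WF: "W \<subseteq> F"
  proof
    fix x assume x: "x \<in> W"
    have "x = c + of_real (\<sigma> (x - c)) * \<omega>\<^sub>1 + of_real (\<rho> (x - c)) * \<omega>\<^sub>2"
      using expand[of "x - c"] by (simp add: algebra_simps)
    moreover have "0 \<le> \<sigma> (x - c) \<and> \<sigma> (x - c) < 1 \<and> 0 \<le> \<rho> (x - c) \<and> \<rho> (x - c) < 1" using x by (auto simp: W_def)
    ultimately show "x \<in> F" unfolding Feq by blast
  qed
  have "W \<noteq> {}"
  proof -
    define d where "d = cmod (\<omega>\<^sub>1 + \<omega>\<^sub>2) + 1"
    have d: "d > 0" unfolding d_def using norm_ge_zero[of "\<omega>\<^sub>1 + \<omega>\<^sub>2"] by linarith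
    \<comment> \<open>Small enough to enter the open parallelogram while staying within 1/2 of
      \<open>x0\<close>.\<close>
    define e where "e = min (1 / (2 * d)) (min ((1 - s0) / 2) ((1 - t0) / 2))"
    have e0: "0 < e" unfolding e_def using st0 d by simp
    have "e \<le> 1 / (2 * d)" "e \<le> (1 - s0) / 2" "e \<le> (1 - t0) / 2"
      unfolding e_def by linarith+
    note e = e0 this
    define x where "x = x0 + of_real e * (\<omega>\<^sub>1 + \<omega>\<^sub>2)"
    have xc: "x - c = of_real (s0 + e) * \<omega>\<^sub>1 + of_real (t0 + e) * \<omega>\<^sub>2"
    proof -
      have "x - c = (x0 - c) + of_real e * (\<omega>\<^sub>1 + \<omega>\<^sub>2)" by (simp add: x_def)
      thus ?thesis unfolding x0c by (simp add: algebra_simps)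
    qed
    have "\<sigma> (x - c) = s0 + e" "\<rho> (x - c) = t0 + e" unfolding xc coord by auto
    moreover have "dist x0 x < 1 / 2"
    proof -
      have "dist x0 x = e * cmod (\<omega>\<^sub>1 + \<omega>\<^sub>2)" using e by (simp add: x_def dist_norm norm_mult)
      also have "\<dots> < e * d" using e by (simp add: d_def)
      also have "\<dots> \<le> 1 / (2 * d) * d" using e d by (intro mult_right_mono) auto
      finally show ?thesis using d by simp
    qed
    ultimately have "x \<in> W" using e st0 unfolding W_def by simp
    thus ?thesis by blast
  qed
  define h where "h = (\<lambda>p x. (1 - (cmod (snd p * x - fst p))\<^sup>2) / (cmod (snd p))\<^sup>2)"
  \<comment> \<open>Pairs with \<open>|b| > 2\<close>, or with \<open>|b| \<le> 2\<close> and
    \<open>|a| > r\<close>, have \<open>hform\<close> at least 1 once \<open>|x - x0| < 1/2\<close>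
    and \<open>t^2 > 3/4\<close>: in the second case \<open>|b * x| \<le> r - 1\<close>.\<close>
  define r where "r = 3 + 2 * cmod x0"
  define S where "S = {p. unimodular (fst p) (snd p) \<and> snd p \<noteq> 0 \<and> cmod (snd p) \<le> 2 \<and> cmod (fst p) \<le> r}"
  have "S \<subseteq> {a \<in> R. cmod a \<le> r} \<times> {b \<in> R. cmod b \<le> 2}" by (auto simp: S_def unimodular_def)
  hence fS: "finite S" using finite_R_ball by (meson finite_SigmaI finite_subset)
  have x01: "unimodular x0 1" unfolding unimodular_def using x0R R_0 R_1 by (intro conjI bexI[of _ 0] bexI[of _ 1]) auto
  have pS: "(x0, 1) \<in> S" using x01 norm_ge_zero[of x0] unfolding S_def r_def by (auto intro: order_trans)
  have conth: "continuous_on UNIV (h p)" if "p \<in> S" for p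
    unfolding h_def using that by (auto intro!: continuous_intros simp: S_def)
  have "S \<noteq> {}" using pS by blast
  have "\<exists>p\<in>S. \<exists>V. open V \<and> V \<noteq> {} \<and> V \<subseteq> W \<and> (\<forall>x\<in>V. \<forall>k\<in>S. h k x \<le> h p x)"
    by (rule finite_max_on_open[OF fS \<open>S \<noteq> {}\<close> oW \<open>W \<noteq> {}\<close>]) (rule conth)
  then obtain p V where pV: "p \<in> S" "open V" "V \<noteq> {}" "V \<subseteq> W" "\<forall>x\<in>V. \<forall>k\<in>S. h k x \<le> h p x"
    by (elim bexE exE conjE) (rule that)
  have h34: "h p x > 3/4" if "x \<in> V" for x
  proof -
    have "cmod (x - x0) < 1/2" using that pV(4) by (auto simp: W_def dist_norm norm_minus_commute)
    hence "(cmod (x - x0))\<^sup>2 < (1/2)\<^sup>2" by (intro power_strict_mono) auto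
    hence "h (x0, 1) x > 3/4" by (simp add: h_def power2_eq_square)
    thus ?thesis using pV(5) that pS by force
  qed
  obtain lam mu where p: "p = (lam, mu)" by (cases p)
  have um: "unimodular lam mu" "mu \<noteq> 0" using pV(1) by (auto simp: S_def p)
  define U where "U = hemisphere lam mu \<inter> (V \<times> UNIV)"
  have "openin (top_of_set (hemisphere lam mu)) U" unfolding U_def using pV(2) by (intro openin_open_Int open_Times) auto
  moreover have "U \<noteq> {}"
  proof -
    obtain x where x: "x \<in> V" using pV(3) by blast
    have hp: "h p x = (1 - (cmod (mu * x - lam))\<^sup>2) / (cmod mu)\<^sup>2" by (simp add: h_def p)
    have "h p x > 0" using h34[OF x] by linarith
    hence "(x, sqrt (h p x)) \<in> hemisphere lam mu"
      unfolding hemisphere_iff[OF um(2)] hp[symmetric] by simp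
    thus ?thesis using x unfolding U_def by blast
  qed
  moreover have "U \<subseteq> hemisphere lam mu \<inter> bianchi_polyhedron rr F"
  proof
    fix P assume P: "P \<in> U"
    obtain x t where xt: "P = (x, t)" by (cases P)
    have xV: "x \<in> V" and hemi: "(x, t) \<in> hemisphere lam mu" using P by (auto simp: U_def xt)
    have t: "t > 0" "t\<^sup>2 = h p x" using hemi unfolding hemisphere_iff[OF um(2)] by (auto simp: h_def p)
    have t34: "t\<^sup>2 > 3/4" using t h34[OF xV] by simp
    have "x \<in> closure F" using xV pV(4) WF closure_subset by blast
    moreover have "1 \<le> hform x t a b" if ab: "unimodular a b" for a b
    proof (cases "b = 0")
      case True
      have "a \<in> R" "a \<noteq> 0" using ab True by (auto simp: unimodular_def)
      hence "1\<^sup>2 \<le> (cmod a)\<^sup>2" using R_cmod_ge_1 by (intro power_mono) auto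
      thus ?thesis using True by (simp add: hform_def)
    next
      case False
      consider "(a, b) \<in> S" | "cmod b > 2" | "cmod b \<le> 2" "cmod a > r"
        using ab False by (force simp: S_def not_le)
      thus ?thesis
      proof cases
        case 1
        hence "h (a, b) x \<le> t\<^sup>2" using pV(5) xV t by simp
        thus ?thesis using False by (simp add: h_def hform_def field_simps)
      next
        case 2
        have "2\<^sup>2 * (3/4) \<le> (cmod b)\<^sup>2 * t\<^sup>2" using 2 t34 by (intro mult_mono power_mono) auto
        hence "1 \<le> (cmod b)\<^sup>2 * t\<^sup>2" by simp
        thus ?thesis unfolding hform_def using zero_le_power2[of "cmod (b * x - a)"] by linarith
      next
        case 3
        have "cmod x \<le> cmod x0 + 1"
        proof -
          have "cmod (x - x0) < 1/2" using xV pV(4) by (auto simp: W_def dist_norm norm_minus_commute)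
          thus ?thesis using norm_triangle_ineq2[of x x0] by linarith
        qed
        hence "cmod (b * x) \<le> 2 * (cmod x0 + 1)" unfolding norm_mult using 3 by (intro mult_mono) auto
        moreover have "cmod a - cmod (b * x) \<le> cmod (b * x - a)"
          using norm_triangle_ineq2[of a "b * x"] by (simp add: norm_minus_commute)
        ultimately have "1 \<le> cmod (b * x - a)" using 3 unfolding r_def by (simp add: distrib_left)
        hence "1\<^sup>2 \<le> (cmod (b * x - a))\<^sup>2" by (intro power_mono) auto
        thus ?thesis unfolding hform_def by (simp add: add_increasing2)
      qed
    qed
    ultimately have "(x, t) \<in> bianchi_polyhedron rr F" unfolding bianchi_polyhedron_iff using t by blast
    thus "P \<in> hemisphere lam mu \<inter> bianchi_polyhedron rr F" using hemi xt by blast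
  qed
  ultimately show ?thesis using um by blast
qed

text \<open>As \<open>swan_number\<close> is a \<open>Max\<close>, the set of moduli has to be
  finite, which \<open>bound\<close> itself gives, and nonempty, by
  \<open>visible_hemisphere_exists\<close>.\<close>

lemma swan_number_bound:
  assumes F: "fundamental_parallelogram R F"
    and bound: "\<And>lam mu z t. unimodular lam mu \<Longrightarrow> mu \<noteq> 0 \<Longrightarrow> (z, t) \<in> hemisphere lam mu \<Longrightarrow>
       (z, t) \<in> bianchi_polyhedron rr F \<Longrightarrow> cmod mu < X"
  shows "swan_number rr F < X"
proof -
  define S where "S = {cmod mu | mu. mu \<in> carrier rr \<and> mu \<noteq> 0 \<and>
     (\<exists>lam \<in> carrier rr. Idl\<^bsub>rr\<^esub> {lam, mu} = carrier rr \<and>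
        (\<exists>U. U \<noteq> {} \<and> openin (top_of_set (hemisphere lam mu)) U \<and>
             U \<subseteq> hemisphere lam mu \<inter> bianchi_polyhedron rr F))}"
  have lt: "\<exists>mu\<in>R. y = cmod mu \<and> cmod mu < X" if y: "y \<in> S" for y
  proof -
    obtain mu lam U where *: "y = cmod mu" "mu \<in> R" "mu \<noteq> 0" "lam \<in> R" "Idl\<^bsub>rr\<^esub> {lam, mu} = carrier rr"
      "U \<noteq> {}" "U \<subseteq> hemisphere lam mu \<inter> bianchi_polyhedron rr F"
      using y unfolding S_def by auto
    obtain z t where "(z, t) \<in> U" using *(6) by auto
    hence "cmod mu < X" using * bound[of lam mu z t] unimodular_iff[of lam mu] by blast
    thus ?thesis using * by blast
  qed
  have "S \<subseteq> cmod ` {x \<in> R. cmod x \<le> X}" using lt by force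
  hence fS: "finite S" using finite_R_ball finite_subset by blast
  obtain lam mu where lm: "unimodular lam mu" "mu \<noteq> 0" "\<exists>U. U \<noteq> {} \<and> openin (top_of_set (hemisphere lam mu)) U \<and>
        U \<subseteq> hemisphere lam mu \<inter> bianchi_polyhedron rr F" using visible_hemisphere_exists[OF F] by blast
  have "lam \<in> R" "mu \<in> R" using lm by (auto simp: unimodular_def)
  hence "cmod mu \<in> S" unfolding S_def rr_simps(1) using lm unimodular_iff[of lam mu] rr_simps(1) by blast
  hence "Max S \<in> S" using fS by (intro Max_in) auto
  from lt[OF this] have "Max S < X" by (elim bexE conjE) (simp only:)
  thus ?thesis unfolding swan_number_def S_def .
qed

end

theorem theorem4p3:
  fixes K F :: "complex set" and \<delta> :: complex and J :: int
  assumes "imaginary_quadratic_field K"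
    and "fundamental_parallelogram (carrier (ring_of_integers K)) F"
    and "\<delta> \<in> carrier (ring_of_integers K)"
    and "properfactor (ring_of_integers K) \<delta> (of_int (field_discriminant K))"
    and "\<forall>d \<in> carrier (ring_of_integers K).
           properfactor (ring_of_integers K) d (of_int (field_discriminant K)) \<longrightarrow> cmod d \<le> cmod \<delta>"
    and "max_ideal_j (ring_of_integers K)
           (2 * max (cmod \<delta>) (of_int J * sqrt \<bar>of_int (field_discriminant K)\<bar>)) \<le> of_int J"
  shows "swan_number (ring_of_integers K) F
           < 14 * of_int J * max (cmod \<delta>) (of_int J * sqrt \<bar>of_int (field_discriminant K)\<bar>)"
proof -
  define R where "R = carrier (ring_of_integers K)"
  define \<Delta> where "\<Delta> = field_discriminant K"
  define M where "M = max (cmod \<delta>) (of_int J * sqrt \<bar>of_int \<Delta>\<bar>)"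
  have rr: "ring_of_integers K = complex_ring\<lparr>carrier := R\<rparr>" by (simp add: R_def ring_of_integers_def)
  obtain \<omega>\<^sub>1 \<omega>\<^sub>2 where "lattice_basis (carrier (ring_of_integers K)) \<omega>\<^sub>1 \<omega>\<^sub>2"
    using assms(2) unfolding fundamental_parallelogram_def by blast
  from imag_quad_order_ring_of_integers[OF assms(1) this]
  interpret imag_quad_order R unfolding R_def .
  have disc: "D = \<Delta>" if "R = {of_int p + of_int q * w | p q. True}" "Im w > 0" "(of_int D :: complex) = (w - cnj w)\<^sup>2" for w D
    using field_discriminant_eq[of K w D] that unfolding R_def \<Delta>_def by simp
  obtain w where w: "w \<in> R" "Im w > 0" "R = {of_int a + of_int b * w | a b. True}" by (rule R_basis) blast
  have D0: "\<Delta> \<noteq> 0"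
  proof -
    obtain T where T: "w + cnj w = of_int T" using R_trace[OF w(1)] by (auto elim: Ints_cases)
    obtain N where N: "w * cnj w = of_int N" using R_norm[OF w(1)] by (auto elim: Ints_cases)
    have "(w - cnj w)\<^sup>2 = (w + cnj w)\<^sup>2 - 4 * (w * cnj w)" by (simp add: power2_eq_square algebra_simps)
    also have "\<dots> = of_int (T\<^sup>2 - 4 * N)" unfolding T N by simp
    finally have e: "of_int (T\<^sup>2 - 4 * N) = (w - cnj w)\<^sup>2" by simp
    hence "T\<^sup>2 - 4 * N = \<Delta>" using disc[OF w(3,2)] by blast
    moreover have "w - cnj w \<noteq> 0" using w(2) by (auto simp: complex_eq_iff)
    ultimately show ?thesis using e by auto
  qed
  have pf: "properfactor rr d (of_int \<Delta>) \<longleftrightarrow> (\<exists>c\<in>R. of_int \<Delta> = d * c) \<and> \<not> (\<exists>c\<in>R. d = of_int \<Delta> * c)" for d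
    by (simp add: properfactor_def factor_def)
  have dR: "\<delta> \<in> R" and dpf: "properfactor rr \<delta> (of_int \<Delta>)"
    and dmax: "\<And>d. d \<in> R \<Longrightarrow> properfactor rr d (of_int \<Delta>) \<Longrightarrow> cmod d \<le> cmod \<delta>"
    and maxj: "max_ideal_j rr (2 * M) \<le> of_int J"
    using assms(3-6) unfolding rr \<Delta>_def[symmetric] M_def[symmetric] by auto
  have "\<delta> \<noteq> 0" using dpf D0 unfolding pf by auto
  hence "cmod \<delta> \<ge> 1" using R_cmod_ge_1[OF dR] by blast
  hence M1: "M \<ge> 1" unfolding M_def by simp
  \<comment> \<open>\<open>\<Delta> / q\<close> is a proper divisor of \<Delta>, so maximality of
    \<delta> gives \<open>|\<Delta>| / q \<le> |\<delta>|\<close>.\<close>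
  have Mq: "\<bar>of_int \<Delta>\<bar> / real q \<le> M" if q: "prime q" "int q dvd \<Delta>" for q :: nat
  proof -
    obtain d where d: "\<Delta> = int q * d" using q by auto
    have d0: "d \<noteq> 0" using D0 d by auto
    have "properfactor rr (of_int d) (of_int \<Delta>)" unfolding pf
    proof (intro conjI notI)
      show "\<exists>c\<in>R. of_int \<Delta> = of_int d * c" using R_of_nat[of q] by (intro bexI[of _ "of_nat q"]) (simp_all add: d)
      assume "\<exists>c\<in>R. of_int d = of_int \<Delta> * c"
      then obtain c where c: "c \<in> R" "of_int d = of_int \<Delta> * c" by blast
      hence qc: "of_nat q * c = 1" using d d0 by simp
      hence "c \<noteq> 0" by auto
      hence "cmod c \<ge> 1" using R_cmod_ge_1 c by blast
      moreover have "real q * cmod c = 1" using arg_cong[OF qc, of cmod] by (simp add: norm_mult)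
      moreover have "real q > 1" using prime_gt_1_nat[OF q(1)] by simp
      moreover have "real q * 1 \<le> real q * cmod c" using \<open>cmod c \<ge> 1\<close> by (intro mult_left_mono) auto
      ultimately show False by linarith
    qed
    hence "cmod (of_int d) \<le> cmod \<delta>" using dmax[OF R_of_int] by blast
    hence "\<bar>of_int d\<bar> \<le> cmod \<delta>" by simp
    moreover have "\<bar>of_int \<Delta>\<bar> / real q = \<bar>of_int d\<bar>" using prime_gt_1_nat[OF q(1)] by (simp add: d abs_mult)
    ultimately show ?thesis unfolding M_def by simp
  qed
  \<comment> \<open>The unit ideal is among those governed by \<open>J\<close>. An interval of
    length \<open>J\<close> starting at 1/2 must contain an integer, so
    \<open>J \<ge> 1/2\<close>.\<close>
  have J1: "J \<ge> 1"
  proof -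
    have iR: "ideal_of R" by (auto simp: ideal_of_def R_closed)
    have "ideal_norm rr R \<le> card {0::complex}"
      by (rule ideal_norm_le_card(2)[OF iR]) (auto simp: R_0)
    hence "sqrt (real (ideal_norm rr R)) \<le> sqrt 1" by (intro real_sqrt_le_mono) simp
    hence "sqrt (real (ideal_norm rr R)) \<le> 1" unfolding real_sqrt_one .
    hence n: "sqrt (real (ideal_norm rr R)) < 2 * M" using M1 by linarith
    have adm: "admissible_shift rr R 0"
      by (rule admissible_shiftI[OF iR R_0]) (use R_0 in \<open>auto intro!: image_eqI[of _ _ 0]\<close>)
    have np: "\<not> R \<subseteq> P" if "prime_of P" "principal_of P" for P using prime_of_1[OF that(1)] R_1 by blast
    have "\<exists>j::int. 1/2 \<le> real_of_int j \<and> of_int j \<le> 1/2 + real_of_int J \<and> coprime_shift R 0 j"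
      by (rule max_ideal_j_works[OF maxj iR R_1 _ n np R_0 adm]) simp_all
    then obtain j :: int where j: "1/2 \<le> real_of_int j" "of_int j \<le> 1/2 + real_of_int J" by blast
    hence "j \<ge> 1" by linarith
    hence "real_of_int j \<ge> 1" by simp
    hence "real_of_int J > 0" using j by linarith
    thus ?thesis by simp
  qed
  have "swan_number rr F < 14 * of_int J * M"
  proof (rule swan_number_bound)
    show "fundamental_parallelogram R F" using assms(2) by (simp add: R_def)
    show "cmod mu < 14 * of_int J * M" if "unimodular lam mu" "mu \<noteq> 0" "(z, t) \<in> hemisphere lam mu"
      "(z, t) \<in> bianchi_polyhedron rr F" for lam mu z t
      by (rule visible_hemisphere_bound[OF maxj J1 disc _ Mq that]) (use M1 in \<open>auto simp: M_def\<close>)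
  qed
  thus ?thesis unfolding rr[symmetric] M_def \<Delta>_def .
qed

end
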